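(* Let $n\geqslant2$, let $D\subset\mathbb{R}^n$ be a domain and let $p>n-1$. Let $f:D\rightarrow\mathbb{R}^n$ be a (continuous) mapping that is differentiable almost everywhere and has the $N$-Luzin property with respect to the Lebesgue measure in $\mathbb{R}^n$, and let $N(f,D)<\infty$. Let $y_0\in\overline{f(D)}\setminus\{\infty\}$, $r_0=\sup_{y\in f(D)}|y-y_0|$, $0<\varepsilon_0<r_0$ and $0<\varepsilon<\varepsilon_0$. Suppose that $$m\bigl(f(\{x\in D: J(x,f)=0\})\bigr)=0 .$$ Denote by $\Sigma_\varepsilon$ the family of all sets of the form $f^{-1}(S(y_0,r)\cap f(D))$, $r\in(\varepsilon,r_0)$. Suppose, in addition, that $f$ has the $N^{-1}$-property on $S(y_0,r)\cap f(D)$ for almost all $r\in(\varepsilon,r_0)$ relative to the Hausdorff measure $\mathcal{H}^{n-1}$ on $S(y_0,r)$. Then $$\widetilde{M}_{\frac{p}{n-1}}(\Sigma_\varepsilon)\geqslant\frac{1}{N^{\frac{p}{n-1}}(f,D)}\ \inf_{\rho\in\mathrm{ext\,adm}_p\,f(\Sigma_\varepsilon)}\ \int_{f(D)\cap A(y_0,\varepsilon,r_0)}\frac{\rho^p(y)}{Q^{\frac{p-n+1}{n-1}}(y)}\,dm(y),$$ where $$Q(y)=\sum_{x\in f^{-1}(y)}K_{O,\alpha}(x,f),\qquad \alpha=\frac{p}{p-n+1}.$$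
   Context: Notation: $m$ is Lebesgue measure in $\mathbb{R}^n$, $\mathcal{H}^{n-1}$ is the $(n-1)$-dimensional Hausdorff measure, $S(y_0,r)=\{y\in\mathbb{R}^n:|y-y_0|=r\}$, $A(y_0,r_1,r_2)=\{y\in\mathbb{R}^n:r_1<|y-y_0|<r_2\}$. Conventions: $a/\infty=0$ for $a\neq\infty$, $a/0=\infty$ for $a>0$, $0\cdot\infty=0$. $N$-Luzin property: $m(E)=0$ implies $m(f(E))=0$ for $E\subset D$. The $N^{-1}$-property on $S(y_0,r)\cap f(D)$ relative to $\mathcal{H}^{n-1}$: if $E\subset S(y_0,r)\cap f(D)$ and $\mathcal{H}^{n-1}(E)=0$, then $\mathcal{H}^{n-1}(f^{-1}(E))=0$. At points $x$ of differentiability of $f$, put $\|f'(x)\|=\max_{h\in\mathbb{R}^n\setminus\{0\}}\frac{|f'(x)h|}{|h|}$ and $J(x,f)=\det f'(x)$; the set $\{x\in D:J(x,f)=0\}$ consists of points of differentiability. The outer dilatation of order $\alpha$ is $$K_{O,\alpha}(x,f)=\begin{cases}\dfrac{\|f'(x)\|^{\alpha}}{|J(x,f)|},& J(x,f)\neq0,\\ 1,& f'(x)=0,\\ \infty,&\text{otherwise.}\end{cases}$$ The multiplicity is $N(f,D)=\sup_{y\in\mathbb{R}^n}\mathrm{card}\{x\in D:f(x)=y\}$. The function $Q$ (also denoted $K_{I,\alpha}(y,f^{-1})$) is defined for those $y$ that are not images of points at which $f$ fails to have a total differential; this is almost every $y$, by the $N$-Luzin property. For a family $\Sigma$ of subsets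 $\sigma$ of $D$ and $q>1$, $\widetilde{M}_q(\Sigma)=\inf\int_{\mathbb{R}^n}\rho^q\,dm$, where the infimum is over all nonnegative Borel functions $\rho$ on $\mathbb{R}^n$ such that $\int_\sigma\rho\,d\mathcal{H}^{n-1}\geqslant1$ for every $\sigma\in\Sigma$. $f(\Sigma_\varepsilon)$ is the family of the surfaces $S_r=S(y_0,r)\cap f(D)$, $r\in(\varepsilon,r_0)$; the integral $\int_{S}\,\cdot\,d\mathcal{A}$ over such a surface is the integral with respect to $\mathcal{H}^{n-1}$ over the set $S(y_0,r)\cap f(D)$. For a family $\Gamma$ of surfaces, a Borel function $\rho:\mathbb{R}^n\to[0,\infty]$ is admissible, $\rho\in\mathrm{adm}\,\Gamma$, if $\int_S\rho^{n-1}\,d\mathcal{A}\geqslant1$ for every $S\in\Gamma$, and the $p$-modulus is $M_p(\Gamma)=\inf_{\rho\in\mathrm{adm}\,\Gamma}\int_{\mathbb{R}^n}\rho^p\,dm$. A property holds for $p$-almost all surfaces of $\Gamma$ if it holds for all of them except a subfamily of $p$-modulus zero. A Lebesgue measurable function $\rho:\mathbb{R}^n\to[0,\infty]$ is $p$-extensively admissible for $\Gamma$, written $\rho\in\mathrm{ext\,adm}_p\,\Gamma$, if $\int_S\rho^{n-1}\,d\mathcal{A}\geqslant1$ for $p$-almost all surfaces $S\in\Gamma$. *)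

theory Defs
  imports "HOL-Analysis.Analysis"
begin

section \<open>Hausdorff measure\<close>

text \<open>
  The factor \<open>unit_ball_vol k / 2 ^ k\<close> is the normalization for which \<open>k\<close>-dimensional Hausdorff
  measure agrees with surface area. Empty sets of a covering contribute nothing, also for \<open>k = 0\<close>
  (where \<open>0 ^ 0 = 1\<close>).
\<close>

definition hausdorff_content :: "nat \<Rightarrow> 'a::metric_space set \<Rightarrow> ennreal" where
  "hausdorff_content k U =
     (if U = {} then 0 else ennreal (unit_ball_vol (real k) * (diameter U / 2) ^ k))"

definition hausdorff_pre :: "nat \<Rightarrow> real \<Rightarrow> 'a::metric_space set \<Rightarrow> ennreal" where
  "hausdorff_pre k \<delta> E =
     (INF U \<in> {U :: nat \<Rightarrow> 'a set. E \<subseteq> (\<Union>i. U i) \<and> (\<forall>i. bounded (U i) \<and> diameter (U i) \<le> \<delta>)}.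
        \<Sum>i. hausdorff_content k (U i))"

definition hausdorff_outer :: "nat \<Rightarrow> 'a::metric_space set \<Rightarrow> ennreal" where
  "hausdorff_outer k E = (SUP \<delta> \<in> {0<..}. hausdorff_pre k \<delta> E)"

definition hausdorff_measure :: "nat \<Rightarrow> 'a::metric_space measure" where
  "hausdorff_measure k =
     measure_of UNIV (lambda_system UNIV UNIV (hausdorff_outer k)) (hausdorff_outer k)"

lemma hausdorff_pre_mono: "A \<subseteq> B \<Longrightarrow> hausdorff_pre k \<delta> A \<le> hausdorff_pre k \<delta> B"
  unfolding hausdorff_pre_def by (intro INF_superset_mono) auto

lemma hausdorff_pre_subadditive:
  fixes A :: "nat \<Rightarrow> 'a::metric_space set"
  shows "hausdorff_pre k \<delta> (\<Union>i. A i) \<le> (\<Sum>i. hausdorff_pre k \<delta> (A i))"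
proof (rule ennreal_le_epsilon)
  let ?C = "\<lambda>E. {U :: nat \<Rightarrow> 'a set. E \<subseteq> (\<Union>i. U i) \<and> (\<forall>i. bounded (U i) \<and> diameter (U i) \<le> \<delta>)}"
  fix e :: real
  assume "0 < e" and fin: "(\<Sum>i. hausdorff_pre k \<delta> (A i)) < top"
  define d where "d n = ennreal (e * (1/2) ^ Suc n)" for n
  have dpos: "0 < d n" for n using \<open>0 < e\<close> by (simp add: d_def)
  have finA: "hausdorff_pre k \<delta> (A n) < top" for n
    using fin by (metis ennreal_suminf_lessD)
  have "\<exists>U. U \<in> ?C (A n) \<and> (\<Sum>i. hausdorff_content k (U i)) \<le> hausdorff_pre k \<delta> (A n) + d n" for n
  proof -
    have "hausdorff_pre k \<delta> (A n) < hausdorff_pre k \<delta> (A n) + d n"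
      using finA[of n] dpos[of n] by auto
    then have "(INF U \<in> ?C (A n). \<Sum>i. hausdorff_content k (U i)) < hausdorff_pre k \<delta> (A n) + d n"
      by (simp only: hausdorff_pre_def)
    then obtain U where "U \<in> ?C (A n)"
      "(\<Sum>i. hausdorff_content k (U i)) < hausdorff_pre k \<delta> (A n) + d n"
      unfolding INF_less_iff by blast
    then show ?thesis by (meson less_imp_le)
  qed
  then have "\<exists>V. \<forall>n. V n \<in> ?C (A n) \<and>
      (\<Sum>i. hausdorff_content k (V n i)) \<le> hausdorff_pre k \<delta> (A n) + d n"
    by (intro choice allI)
  then obtain V where V: "\<And>n. V n \<in> ?C (A n)"
    "\<And>n. (\<Sum>i. hausdorff_content k (V n i)) \<le> hausdorff_pre k \<delta> (A n) + d n"
    by blast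
  define W where "W = case_prod V \<circ> prod_decode"
  have W: "W \<in> ?C (\<Union>i. A i)"
  proof (intro CollectI conjI allI subsetI)
    fix x assume "x \<in> (\<Union>i. A i)"
    then obtain n where "x \<in> A n" by blast
    then obtain i where "x \<in> V n i" using V(1)[of n] by blast
    then show "x \<in> (\<Union>i. W i)"
      by (intro UN_I[of "prod_encode (n, i)"]) (simp_all add: W_def)
  next
    fix i
    show "bounded (W i)" "diameter (W i) \<le> \<delta>"
      using V(1)[of "fst (prod_decode i)"] by (simp_all add: W_def split_beta)
  qed
  have "hausdorff_pre k \<delta> (\<Union>i. A i) \<le> (\<Sum>i. hausdorff_content k (W i))"
    unfolding hausdorff_pre_def using W by (rule INF_lower)
  also have "\<dots> = (\<Sum>n. \<Sum>i. hausdorff_content k (V n i))"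
    using suminf_ennreal_2dimen[of "\<lambda>n. \<Sum>i. hausdorff_content k (V n i)"
        "\<lambda>(n, i). hausdorff_content k (V n i)"]
    by (simp add: W_def comp_def split_beta)
  also have "\<dots> \<le> (\<Sum>n. hausdorff_pre k \<delta> (A n) + d n)"
    by (intro suminf_le V(2)) auto
  also have "\<dots> = (\<Sum>n. hausdorff_pre k \<delta> (A n)) + (\<Sum>n. d n)"
    by (intro suminf_add[symmetric]) auto
  also have "(\<Sum>n. d n) = ennreal e"
    unfolding d_def using \<open>0 < e\<close> sums_mult[OF power_half_series, of e]
    by (intro suminf_ennreal_eq) auto
  finally show "hausdorff_pre k \<delta> (\<Union>i. A i) \<le> (\<Sum>n. hausdorff_pre k \<delta> (A n)) + ennreal e" .
qed

lemma outer_measure_space_hausdorff_outer: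
  "outer_measure_space UNIV (hausdorff_outer k :: 'a::metric_space set \<Rightarrow> ennreal)"
  unfolding outer_measure_space_def
proof (intro conjI)
  have "hausdorff_pre k \<delta> ({} :: 'a set) \<le> 0" if "\<delta> > 0" for \<delta>
  proof -
    have "hausdorff_pre k \<delta> ({} :: 'a set) \<le> (\<Sum>i::nat. hausdorff_content k ({} :: 'a set))"
      unfolding hausdorff_pre_def using that
      by (intro INF_lower2[of "\<lambda>_. {}"]) auto
    then show ?thesis by (simp add: hausdorff_content_def)
  qed
  then show "positive UNIV (hausdorff_outer k :: 'a set \<Rightarrow> ennreal)"
    unfolding positive_def hausdorff_outer_def
    by (metis (no_types, lifting) SUP_least greaterThan_iff le_zero_eq)
  show "increasing UNIV (hausdorff_outer k :: 'a set \<Rightarrow> ennreal)"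
    unfolding increasing_def hausdorff_outer_def
    by (auto intro!: SUP_mono' hausdorff_pre_mono)
  show "countably_subadditive UNIV (hausdorff_outer k :: 'a set \<Rightarrow> ennreal)"
    unfolding countably_subadditive_def
  proof safe
    fix A :: "nat \<Rightarrow> 'a set"
    have "hausdorff_pre k \<delta> (\<Union>i. A i) \<le> (\<Sum>i. hausdorff_outer k (A i))" if "\<delta> > 0" for \<delta>
    proof (rule order_trans[OF hausdorff_pre_subadditive])
      show "(\<Sum>i. hausdorff_pre k \<delta> (A i)) \<le> (\<Sum>i. hausdorff_outer k (A i))"
        using that by (intro suminf_le) (auto simp: hausdorff_outer_def intro!: SUP_upper)
    qed
    then show "hausdorff_outer k (\<Union>i. A i) \<le> (\<Sum>i. hausdorff_outer k (A i))"
      unfolding hausdorff_outer_def[of k "\<Union>i. A i"] by (auto intro: SUP_least)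
  qed
qed

lemma
  fixes A :: "'a::metric_space set"
  shows space_hausdorff_measure: "space (hausdorff_measure k :: 'a measure) = UNIV"
    and sets_hausdorff_measure:
      "sets (hausdorff_measure k :: 'a measure) = lambda_system UNIV UNIV (hausdorff_outer k)"
    and emeasure_hausdorff_measure:
      "A \<in> sets (hausdorff_measure k) \<Longrightarrow> emeasure (hausdorff_measure k) A = hausdorff_outer k A"
proof -
  interpret sigma_algebra "UNIV :: 'a set" UNIV
    using sigma_algebra_Pow[of "UNIV :: 'a set"] by simp
  have ms: "measure_space UNIV (lambda_system UNIV UNIV (hausdorff_outer k))
              (hausdorff_outer k :: 'a set \<Rightarrow> ennreal)"
    by (rule caratheodory_lemma) (rule outer_measure_space_hausdorff_outer)
  then interpret L: sigma_algebra "UNIV :: 'a set" "lambda_system UNIV UNIV (hausdorff_outer k)"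
    by (simp add: measure_space_def)
  show "space (hausdorff_measure k :: 'a measure) = UNIV"
    by (simp add: hausdorff_measure_def)
  show sets: "sets (hausdorff_measure k :: 'a measure) = lambda_system UNIV UNIV (hausdorff_outer k)"
    by (simp add: hausdorff_measure_def L.sets_measure_of_eq)
  show "emeasure (hausdorff_measure k) A = hausdorff_outer k A"
    if "A \<in> sets (hausdorff_measure k)"
    using emeasure_measure_of_sigma[of UNIV "lambda_system UNIV UNIV (hausdorff_outer k)"
        "hausdorff_outer k" A] ms that sets
    by (simp add: hausdorff_measure_def measure_space_def)
qed


section \<open>Powers and moduli\<close>

text \<open>Real powers of extended nonnegative reals, meant for positive exponents only.\<close>

definition enn_powr :: "ennreal \<Rightarrow> real \<Rightarrow> ennreal" where
  "enn_powr x a = (if x = top then top else ennreal (enn2real x powr a))"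

text \<open>
  Codimension-one surfaces are identified with their underlying sets, and integration over a
  surface is integration with respect to \<open>\<H>\<close>-measure of dimension \<open>CARD('n) - 1\<close>.
\<close>

definition hyper_measure :: "(real ^ 'n) measure" where
  "hyper_measure = hausdorff_measure (CARD('n) - 1)"

definition modulus_tilde :: "real \<Rightarrow> (real ^ 'n) set set \<Rightarrow> ennreal" where
  "modulus_tilde q \<Sigma> =
     (INF \<rho> \<in> {\<rho> \<in> borel_measurable borel. \<forall>\<sigma>\<in>\<Sigma>. (\<integral>\<^sup>+x\<in>\<sigma>. \<rho> x \<partial>hyper_measure) \<ge> 1}.
        \<integral>\<^sup>+x. enn_powr (\<rho> x) q \<partial>lebesgue)"

definition adm :: "(real ^ 'n) set set \<Rightarrow> (real ^ 'n \<Rightarrow> ennreal) set" where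
  "adm \<Gamma> = {\<rho> \<in> borel_measurable borel.
     \<forall>S\<in>\<Gamma>. (\<integral>\<^sup>+y\<in>S. \<rho> y ^ (CARD('n) - 1) \<partial>hyper_measure) \<ge> 1}"

definition modulus :: "real \<Rightarrow> (real ^ 'n) set set \<Rightarrow> ennreal" where
  "modulus p \<Gamma> = (INF \<rho> \<in> adm \<Gamma>. \<integral>\<^sup>+x. enn_powr (\<rho> x) p \<partial>lebesgue)"

definition almost_all_surfaces :: "real \<Rightarrow> (real ^ 'n) set set \<Rightarrow> ((real ^ 'n) set \<Rightarrow> bool) \<Rightarrow> bool" where
  "almost_all_surfaces p \<Gamma> P \<longleftrightarrow> (\<exists>\<Gamma>\<^sub>0 \<subseteq> \<Gamma>. modulus p \<Gamma>\<^sub>0 = 0 \<and> (\<forall>S \<in> \<Gamma> - \<Gamma>\<^sub>0. P S))"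

text \<open>
  A Lebesgue measurable \<open>\<rho>\<close> need not be measurable with respect to \<open>hyper_measure\<close> on every surface;
  where it is not, \<open>nn_integral\<close> is the lower integral. For concentric spheres this concerns only
  a null set of radii.
\<close>

definition ext_adm :: "real \<Rightarrow> (real ^ 'n) set set \<Rightarrow> (real ^ 'n \<Rightarrow> ennreal) set" where
  "ext_adm p \<Gamma> = {\<rho> \<in> borel_measurable lebesgue.
     almost_all_surfaces p \<Gamma> (\<lambda>S. (\<integral>\<^sup>+y\<in>S. \<rho> y ^ (CARD('n) - 1) \<partial>hyper_measure) \<ge> 1)}"


section \<open>Mappings\<close>

definition luzin_N :: "(real ^ 'n) set \<Rightarrow> (real ^ 'n \<Rightarrow> real ^ 'n) \<Rightarrow> bool" where
  "luzin_N D f \<longleftrightarrow> (\<forall>E\<subseteq>D. E \<in> null_sets lebesgue \<longrightarrow> f ` E \<in> null_sets lebesgue)"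

definition luzin_N_inv_on_sphere ::
    "(real ^ 'n) set \<Rightarrow> (real ^ 'n \<Rightarrow> real ^ 'n) \<Rightarrow> real ^ 'n \<Rightarrow> real \<Rightarrow> bool" where
  "luzin_N_inv_on_sphere D f y\<^sub>0 r \<longleftrightarrow>
     (\<forall>E \<subseteq> sphere y\<^sub>0 r \<inter> f ` D.
        hausdorff_outer (CARD('n) - 1) E = 0 \<longrightarrow> hausdorff_outer (CARD('n) - 1) (D \<inter> f -` E) = 0)"

definition multiplicity_on :: "(real ^ 'n) set \<Rightarrow> (real ^ 'n \<Rightarrow> real ^ 'n) \<Rightarrow> ennreal" where
  "multiplicity_on D f = (SUP y. emeasure (count_space UNIV) {x \<in> D. f x = y})"

definition jacobian_det :: "(real ^ 'n \<Rightarrow> real ^ 'n) \<Rightarrow> real ^ 'n \<Rightarrow> real" where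
  "jacobian_det f x = det (matrix (frechet_derivative f (at x)))"

definition outer_dilatation :: "real \<Rightarrow> (real ^ 'n \<Rightarrow> real ^ 'n) \<Rightarrow> real ^ 'n \<Rightarrow> ennreal" where
  "outer_dilatation \<alpha> f x =
     (if jacobian_det f x \<noteq> 0 then
        ennreal (onorm (frechet_derivative f (at x)) powr \<alpha> / \<bar>jacobian_det f x\<bar>)
      else if frechet_derivative f (at x) = (\<lambda>h. 0) then 1
      else \<infinity>)"

text \<open>
  The functions \<open>jacobian_det f\<close> and \<open>outer_dilatation \<alpha> f\<close> are meaningful only at points of
  differentiability. Hence \<open>Q_dilatation D f \<alpha> y\<close> is meaningful unless \<open>y\<close> is the image of a point
  of \<open>D\<close> where \<open>f\<close> is not differentiable; for an almost everywhere differentiable \<open>f\<close> with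
  Luzin's property those \<open>y\<close> form a Lebesgue null set, which no integral below sees. The sum is the
  intended one when the fibres of \<open>f\<close> are finite, in particular if the multiplicity is finite.
\<close>

definition Q_dilatation :: "(real ^ 'n) set \<Rightarrow> (real ^ 'n \<Rightarrow> real ^ 'n) \<Rightarrow> real \<Rightarrow> real ^ 'n \<Rightarrow> ennreal" where
  "Q_dilatation D f \<alpha> y = (\<Sum>x \<in> {x \<in> D. f x = y}. outer_dilatation \<alpha> f x)"

definition image_surfaces ::
    "(real ^ 'n) set \<Rightarrow> (real ^ 'n \<Rightarrow> real ^ 'n) \<Rightarrow> real ^ 'n \<Rightarrow> real \<Rightarrow> ereal \<Rightarrow> (real ^ 'n) set set" where
  "image_surfaces D f y\<^sub>0 \<epsilon> r\<^sub>0 = {sphere y\<^sub>0 r \<inter> f ` D | r. \<epsilon> < r \<and> ereal r < r\<^sub>0}"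

definition preimage_surfaces ::
    "(real ^ 'n) set \<Rightarrow> (real ^ 'n \<Rightarrow> real ^ 'n) \<Rightarrow> real ^ 'n \<Rightarrow> real \<Rightarrow> ereal \<Rightarrow> (real ^ 'n) set set" where
  "preimage_surfaces D f y\<^sub>0 \<epsilon> r\<^sub>0 = {D \<inter> f -` (sphere y\<^sub>0 r \<inter> f ` D) | r. \<epsilon> < r \<and> ereal r < r\<^sub>0}"

definition annulus :: "'a::metric_space \<Rightarrow> real \<Rightarrow> ereal \<Rightarrow> 'a set" where
  "annulus y\<^sub>0 r\<^sub>1 r\<^sub>2 = {y. r\<^sub>1 < dist y y\<^sub>0 \<and> ereal (dist y y\<^sub>0) < r\<^sub>2}"

end

theory Submission
  imports Defs
begin

text \<open>
  Given a density \<open>\<rho>\<close> admissible for the preimages of the spheres, put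
  \<open>R y = (\<Sum>x\<in>f\<^sup>-\<^sup>1(y). \<rho>(x) * \<parallel>f'(x)\<parallel> / |J(x,f)|)\<close>. Splitting \<open>D\<close> into countably many pieces on
  which \<open>f\<close> is nearly affine shows that the integral of \<open>R\<close> over almost every sphere is at least that of \<open>\<rho>\<close>
  over its preimage, since an injective linear map \<open>T\<close> shrinks hypersurface area at most by the factor
  \<open>|det T| / \<parallel>T\<parallel>\<close>. Here the part of \<open>D\<close> outside the pieces is harmless: its image is Lebesgue null,
  hence null on almost every sphere, and the inverse Luzin property applies. Hoelder's inequality bounds
  \<open>R\<^sup>q / Q\<^sup>q\<^sup>-\<^sup>1\<close> by \<open>\<Sum>x\<in>f\<^sup>-\<^sup>1(y). \<rho>(x)\<^sup>q / |J(x,f)|\<close>, where \<open>q = p / (n - 1)\<close>, and this has integral at most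
  \<open>\<integral> \<rho>\<^sup>q\<close>. So \<open>R\<^sup>1\<^sup>/\<^sup>(\<^sup>n\<^sup>-\<^sup>1\<^sup>)\<close> is extensively admissible, provided a null set of radii gives a family of modulus
  zero. The latter requires that every slice \<open>S(y\<^sub>0,r) \<inter> f(D)\<close> has positive area, because a density that is
  infinite on the exceptional spheres cannot see a slice of area zero. That is a topological fact:
  if \<open>f\<close> has finite fibres, the preimage of a set of area zero does not separate \<open>D\<close>.
\<close>

section \<open>Hausdorff outer measure\<close>

text \<open>The exponent \<alpha> is conjugate to q: Hoelder's inequality is applied on a fibre with
  weights 1 / |J|, and q = p / (n - 1) gives q / (q - 1) = p / (p - n + 1). Freezing the weights on
  the pieces costs a tolerance \<eta>, which survives only as the factor
  \<open>(1 + \<eta>) powr (q + 1)\<close> and tends to 1. The multiplicity N enters twice: its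
  finiteness gives finite fibres, both for the sum Q and for the topological step, and N \<ge> 1
  makes the factor 1 / N^q at most 1. The area comparison uses the normal direction of the spheres
  at f(x), so points over y0 are excluded from the pieces; radii above \<epsilon> > 0 avoid them.
  The pieces are taken F-sigma so that their images, and with them R, are Borel. The inverse Luzin
  property speaks of arbitrary subsets of a sphere, hence the estimates are stated for Hausdorff
  outer measure. Change of area under linear maps is deduced from change of volume of prisms, and
  Hausdorff measure itself is handled only through coverings, Lipschitz maps and translation
  invariance.\<close>

lemma hausdorff_outer_mono: "A \<subseteq> B \<Longrightarrow> hausdorff_outer k A \<le> hausdorff_outer k B"
  using outer_measure_space_hausdorff_outer[of k]
  unfolding outer_measure_space_def increasing_def by blast

lemma hausdorff_outer_empty [simp]: "hausdorff_outer k {} = 0"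
  using outer_measure_space_hausdorff_outer[of k]
  unfolding outer_measure_space_def positive_def by blast

lemma hausdorff_outer_UN_le:
  fixes A :: "nat \<Rightarrow> 'a::metric_space set"
  shows "hausdorff_outer k (\<Union>i. A i) \<le> (\<Sum>i. hausdorff_outer k (A i))"
proof -
  have *: "hausdorff_pre k \<delta> (\<Union>i. A i) \<le> (\<Sum>i. hausdorff_outer k (A i))" if "\<delta> > 0" for \<delta>
  proof (rule order_trans[OF hausdorff_pre_subadditive])
    show "(\<Sum>i. hausdorff_pre k \<delta> (A i)) \<le> (\<Sum>i. hausdorff_outer k (A i))"
      using that by (intro suminf_le) (auto simp: hausdorff_outer_def intro!: SUP_upper)
  qed
  show ?thesis
    unfolding hausdorff_outer_def[of k "\<Union>i. A i"] using * by (auto intro: SUP_least)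
qed

lemma hausdorff_outer_Un_le:
  "hausdorff_outer k (A \<union> B) \<le> hausdorff_outer k A + hausdorff_outer k B"
proof -
  let ?C = "\<lambda>i::nat. if i = 0 then A else if i = 1 then B else {}"
  have "A \<union> B = (\<Union>i. ?C i)"
    by (auto split: if_splits)
  then have "hausdorff_outer k (A \<union> B) \<le> (\<Sum>i. hausdorff_outer k (?C i))"
    using hausdorff_outer_UN_le[of k ?C] by simp
  also have "\<dots> = (\<Sum>i\<in>{0,1}. hausdorff_outer k (?C i))"
    by (rule suminf_finite) auto
  finally show ?thesis by simp
qed

lemma hausdorff_outer_null_subset:
  "\<lbrakk>hausdorff_outer k B = 0; A \<subseteq> B\<rbrakk> \<Longrightarrow> hausdorff_outer k A = 0"
  using hausdorff_outer_mono[of A B k] by simp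

lemma hausdorff_pre_le_cover:
  assumes "E \<subseteq> (\<Union>i::nat. U i)" "\<And>i. bounded (U i)" "\<And>i. diameter (U i) \<le> \<delta>"
  shows "hausdorff_pre k \<delta> E \<le> (\<Sum>i. hausdorff_content k (U i))"
  unfolding hausdorff_pre_def using assms by (intro INF_lower) auto

lemma hausdorff_pre_antimono:
  "\<delta> \<le> \<delta>' \<Longrightarrow> hausdorff_pre k \<delta>' E \<le> hausdorff_pre k \<delta> E"
  unfolding hausdorff_pre_def by (intro INF_superset_mono) (auto intro: order_trans)

lemma hausdorff_pre_le_outer: "0 < \<delta> \<Longrightarrow> hausdorff_pre k \<delta> E \<le> hausdorff_outer k E"
  unfolding hausdorff_outer_def by (rule SUP_upper) simp

lemma hausdorff_pre_obtain_cover: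
  assumes "hausdorff_pre k \<delta> E < c"
  obtains U :: "nat \<Rightarrow> 'a::metric_space set" where "E \<subseteq> (\<Union>i. U i)" "\<And>i. bounded (U i)"
    "\<And>i. diameter (U i) \<le> \<delta>" "(\<Sum>i. hausdorff_content k (U i)) < c"
  using assms unfolding hausdorff_pre_def INF_less_iff by blast

lemma hausdorff_content_empty [simp]: "hausdorff_content k {} = 0"
  by (simp add: hausdorff_content_def)

lemma hausdorff_content_mono:
  assumes "A \<subseteq> B" "bounded B"
  shows "hausdorff_content k A \<le> hausdorff_content k B"
proof (cases "A = {}")
  case False
  have "diameter A \<le> diameter B" "0 \<le> diameter A"
    using assms diameter_subset bounded_subset diameter_ge_0 by blast+
  then show ?thesis
    using False assms(1) unfolding hausdorff_content_def
    by (auto intro!: ennreal_leI mult_left_mono power_mono divide_right_mono)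
qed simp

lemma diameter_leI:
  assumes "0 \<le> d" "\<And>x y. \<lbrakk>x \<in> S; y \<in> S\<rbrakk> \<Longrightarrow> dist x y \<le> d"
  shows "diameter S \<le> d"
  using assms by (auto simp: diameter_def intro!: cSUP_least)

section \<open>Lipschitz maps, separated sets, and measurability of Borel sets\<close>

text \<open>A cover of mesh \<delta> / L is mapped to a cover of mesh \<delta>. Intersecting the
  covering sets with \<open>A\<close> before mapping them confines the use of the Lipschitz
  condition to \<open>A\<close>.\<close>

lemma hausdorff_outer_lipschitz_image:
  fixes g :: "'a::metric_space \<Rightarrow> 'b::metric_space"
  assumes L: "L > 0" and lip: "\<And>x y. \<lbrakk>x \<in> A; y \<in> A\<rbrakk> \<Longrightarrow> dist (g x) (g y) \<le> L * dist x y"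
  shows "hausdorff_outer k (g ` A) \<le> ennreal (L ^ k) * hausdorff_outer k A"
proof -
  let ?c = "ennreal (L ^ k)"
  have c: "0 < ?c" "?c \<noteq> top" using L by simp_all
  have img: "bounded (g ` (U \<inter> A))" "diameter (g ` (U \<inter> A)) \<le> L * diameter U"
    if "bounded U" for U
  proof -
    have *: "dist (g x) (g y) \<le> L * diameter U" if "x \<in> U \<inter> A" "y \<in> U \<inter> A" for x y
      using lip[of x y] that L diameter_bounded_bound[OF \<open>bounded U\<close>, of x y]
      by (meson IntD1 IntD2 less_imp_le mult_left_mono order_trans)
    have "dist a b \<le> L * diameter U" if "a \<in> g ` (U \<inter> A)" "b \<in> g ` (U \<inter> A)" for a b
      using that * by blast
    moreover have "0 \<le> L * diameter U" using L diameter_ge_0[OF \<open>bounded U\<close>] by simp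
    ultimately show "bounded (g ` (U \<inter> A))" "diameter (g ` (U \<inter> A)) \<le> L * diameter U"
      unfolding bounded_two_points by (blast, intro diameter_leI)
  qed
  have "hausdorff_pre k \<delta> (g ` A) \<le> ?c * hausdorff_outer k A" if "\<delta> > 0" for \<delta>
  proof -
    \<comment> \<open>With the constant on the left, the claim is a lower bound for an infimum over
      covers of \<open>A\<close> and can be tested cover by cover.\<close>
    have "hausdorff_pre k \<delta> (g ` A) / ?c \<le> hausdorff_pre k (\<delta> / L) A"
      unfolding hausdorff_pre_def[of k "\<delta> / L"]
    proof (rule INF_greatest, rule divide_le_posI_ennreal[OF c(1)])
      fix U :: "nat \<Rightarrow> 'a set"
      assume "U \<in> {U. A \<subseteq> (\<Union>i. U i) \<and> (\<forall>i. bounded (U i) \<and> diameter (U i) \<le> \<delta> / L)}"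
      then have U: "A \<subseteq> (\<Union>i. U i)" "\<And>i. bounded (U i)" "\<And>i. diameter (U i) \<le> \<delta> / L" by auto
      have content: "hausdorff_content k (g ` (U i \<inter> A)) \<le> ?c * hausdorff_content k (U i)" for i
      proof (cases "U i \<inter> A = {}")
        case False
        have "(diameter (g ` (U i \<inter> A)) / 2) ^ k \<le> (L * (diameter (U i) / 2)) ^ k"
          using img[OF U(2)[of i]] diameter_ge_0[OF img(1)[OF U(2)[of i]]]
          by (intro power_mono) auto
        then have "unit_ball_vol (real k) * (diameter (g ` (U i \<inter> A)) / 2) ^ k
              \<le> L ^ k * (unit_ball_vol (real k) * (diameter (U i) / 2) ^ k)"
          using mult_left_mono[of _ _ "unit_ball_vol (real k)"]
          by (simp add: power_mult_distrib mult.left_commute del: times_divide_eq_right)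
        then show ?thesis
          using False L unfolding hausdorff_content_def
          by (auto simp: ennreal_mult'[symmetric] intro!: ennreal_leI)
      qed simp
      have "hausdorff_pre k \<delta> (g ` A) \<le> (\<Sum>i. hausdorff_content k (g ` (U i \<inter> A)))"
      proof (rule hausdorff_pre_le_cover)
        show "g ` A \<subseteq> (\<Union>i. g ` (U i \<inter> A))" using U(1) by blast
        show "diameter (g ` (U i \<inter> A)) \<le> \<delta>" for i
          using img(2)[OF U(2)[of i]] U(3)[of i] L
          by (smt (verit, ccfv_SIG) mult.commute pos_le_divide_eq)
      qed (use img U in blast)
      also have "\<dots> \<le> (\<Sum>i. ?c * hausdorff_content k (U i))"
        by (intro suminf_le content) auto
      also have "\<dots> = ?c * (\<Sum>i. hausdorff_content k (U i))" by simp
      finally show "hausdorff_pre k \<delta> (g ` A) \<le> ?c * (\<Sum>i. hausdorff_content k (U i))" .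
    qed
    also have "\<dots> \<le> hausdorff_outer k A"
      using that L by (intro hausdorff_pre_le_outer) simp
    finally have "?c * (hausdorff_pre k \<delta> (g ` A) / ?c) \<le> ?c * hausdorff_outer k A"
      by (rule mult_left_mono) simp
    then show ?thesis
      using c by (simp add: ennreal_times_divide mult.commute[of ?c] ennreal_mult_divide_eq)
  qed
  then show ?thesis
    unfolding hausdorff_outer_def[of k "g ` A"] by (auto intro: SUP_least)
qed

text \<open>A covering set of diameter below \<open>d\<close> cannot meet both \<open>A\<close> and
  \<open>B\<close>, so every fine cover of the union splits into a cover of \<open>A\<close> and a
  cover of \<open>B\<close>.\<close>

lemma hausdorff_outer_separated:
  fixes A B :: "'a::metric_space set"
  assumes "d > 0" and sep: "\<And>x y. \<lbrakk>x \<in> A; y \<in> B\<rbrakk> \<Longrightarrow> d \<le> dist x y"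
  shows "hausdorff_outer k A + hausdorff_outer k B \<le> hausdorff_outer k (A \<union> B)"
proof -
  have pre: "hausdorff_pre k \<delta> A + hausdorff_pre k \<delta> B \<le> hausdorff_outer k (A \<union> B)"
    if \<delta>: "0 < \<delta>" "\<delta> < d" for \<delta>
  proof -
    have "hausdorff_pre k \<delta> A + hausdorff_pre k \<delta> B \<le> hausdorff_pre k \<delta> (A \<union> B)"
      unfolding hausdorff_pre_def[of k \<delta> "A \<union> B"]
    proof (rule INF_greatest)
      fix U :: "nat \<Rightarrow> 'a set"
      assume "U \<in> {U. A \<union> B \<subseteq> (\<Union>i. U i) \<and> (\<forall>i. bounded (U i) \<and> diameter (U i) \<le> \<delta>)}"
      then have U: "A \<union> B \<subseteq> (\<Union>i. U i)" "\<And>i. bounded (U i)" "\<And>i. diameter (U i) \<le> \<delta>" by auto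
      have le: "hausdorff_pre k \<delta> E \<le> (\<Sum>i. hausdorff_content k (U i \<inter> E))" if "E \<subseteq> (\<Union>i. U i)" for E
        using that U(2,3) by (intro hausdorff_pre_le_cover)
          (auto intro: bounded_Int order_trans[OF diameter_subset[OF Int_lower1]])
      have "hausdorff_content k (U i \<inter> A) + hausdorff_content k (U i \<inter> B) \<le> hausdorff_content k (U i)" for i
      proof -
        have "U i \<inter> A = {} \<or> U i \<inter> B = {}"
        proof (rule ccontr)
          assume "\<not> ?thesis"
          then obtain x y where "x \<in> U i" "x \<in> A" "y \<in> U i" "y \<in> B" by blast
          then show False
            using diameter_bounded_bound[OF U(2), of x i y] U(3)[of i] sep[of x y] \<delta> by auto
        qed
        then show ?thesis
          using hausdorff_content_mono[OF _ U(2)[of i], of "U i \<inter> A"]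
            hausdorff_content_mono[OF _ U(2)[of i], of "U i \<inter> B"] by auto
      qed
      then have "(\<Sum>i. hausdorff_content k (U i \<inter> A) + hausdorff_content k (U i \<inter> B))
            \<le> (\<Sum>i. hausdorff_content k (U i))"
        by (intro suminf_le) auto
      moreover have "(\<Sum>i. hausdorff_content k (U i \<inter> A) + hausdorff_content k (U i \<inter> B))
         = (\<Sum>i. hausdorff_content k (U i \<inter> A)) + (\<Sum>i. hausdorff_content k (U i \<inter> B))"
        by (intro suminf_add[symmetric]) auto
      ultimately show "hausdorff_pre k \<delta> A + hausdorff_pre k \<delta> B \<le> (\<Sum>i. hausdorff_content k (U i))"
        using add_mono[OF le[of A] le[of B]] U(1) by simp
    qed
    then show ?thesis using hausdorff_pre_le_outer[OF \<delta>(1)] order_trans by blast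
  qed
  \<comment> \<open>The two mesh sizes are decoupled so that the suprema defining the two outer
    measures can be taken one after the other.\<close>
  have "hausdorff_pre k \<delta>1 A + hausdorff_pre k \<delta>2 B \<le> hausdorff_outer k (A \<union> B)"
    if "0 < \<delta>1" "0 < \<delta>2" for \<delta>1 \<delta>2
  proof -
    define \<delta> where "\<delta> = min (d / 2) (min \<delta>1 \<delta>2)"
    have "hausdorff_pre k \<delta>1 A + hausdorff_pre k \<delta>2 B \<le> hausdorff_pre k \<delta> A + hausdorff_pre k \<delta> B"
      by (intro add_mono hausdorff_pre_antimono) (auto simp: \<delta>_def)
    also have "\<dots> \<le> hausdorff_outer k (A \<union> B)"
      using that assms(1) by (intro pre) (auto simp: \<delta>_def)
    finally show ?thesis .
  qed
  note pre2 = this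
  have pre1: "hausdorff_pre k \<delta>1 A + hausdorff_outer k B \<le> hausdorff_outer k (A \<union> B)"
    if "0 < \<delta>1" for \<delta>1
  proof -
    have eq: "hausdorff_pre k \<delta>1 A + hausdorff_outer k B
        = (SUP \<delta>\<in>{0<..}. hausdorff_pre k \<delta>1 A + hausdorff_pre k \<delta> B)"
      unfolding hausdorff_outer_def by (rule ennreal_SUP_add_right) simp
    show ?thesis unfolding eq using that pre2 by (intro SUP_least) simp
  qed
  have eq: "hausdorff_outer k A + hausdorff_outer k B
      = (SUP \<delta>\<in>{0<..}. hausdorff_pre k \<delta> A + hausdorff_outer k B)"
    unfolding hausdorff_outer_def[of k A] by (rule ennreal_SUP_add_left[symmetric]) simp
  show ?thesis unfolding eq using pre1 by (intro SUP_least) simp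
qed

text \<open>
  Caratheodory's criterion for metric outer measures: the part of \<open>X\<close> outside the closed set \<open>C\<close>
  is exhausted by sets at positive distance from \<open>C\<close>, and the rings between consecutive ones
  have summable measure because rings of equal parity are separated.
\<close>

lemma hausdorff_outer_split_closed:
  fixes C :: "'a::metric_space set"
  assumes C: "closed C"
  shows "hausdorff_outer k (X \<inter> C) + hausdorff_outer k (X - C) \<le> hausdorff_outer k X"
proof (cases "C = {} \<or> hausdorff_outer k X = top")
  case False
  then have ne: "C \<noteq> {}" and fin: "hausdorff_outer k X < top"
    by (auto simp: less_top)
  define T where "T m = {x \<in> X - C. 1 / real (Suc m) \<le> infdist x C}" for m
  define R where "R m = {x \<in> X - C. 1 / real (m + 2) \<le> infdist x C \<and> infdist x C < 1 / real (m + 1)}" for m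
  have inf_pos: "0 < infdist x C" if "x \<notin> C" for x
    using that C ne in_closed_iff_infdist_zero[OF C ne, of x] infdist_nonneg[of x C] by auto
  have lipi: "infdist x C \<le> infdist y C + dist x y" for x y
    by (rule infdist_triangle)
  have inT: "hausdorff_outer k (X \<inter> C) + hausdorff_outer k (T m) \<le> hausdorff_outer k X" for m
  proof -
    have "hausdorff_outer k (X \<inter> C) + hausdorff_outer k (T m) \<le> hausdorff_outer k ((X \<inter> C) \<union> T m)"
    proof (rule hausdorff_outer_separated)
      show "0 < 1 / real (Suc m)" by simp
      show "1 / real (Suc m) \<le> dist x y" if "x \<in> X \<inter> C" "y \<in> T m" for x y
        using that infdist_le[of x C y] by (auto simp: T_def dist_commute)
    qed
    also have "\<dots> \<le> hausdorff_outer k X" by (rule hausdorff_outer_mono) (auto simp: T_def)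
    finally show ?thesis .
  qed
  have parity: "(\<Sum>i<N. hausdorff_outer k (R (2 * i + p))) \<le> hausdorff_outer k (\<Union>i<N. R (2 * i + p))" for N p
  proof (induction N)
    case (Suc N)
    have "(\<Sum>i<Suc N. hausdorff_outer k (R (2 * i + p)))
        \<le> hausdorff_outer k (\<Union>i<N. R (2 * i + p)) + hausdorff_outer k (R (2 * N + p))"
      using Suc by (simp add: add_right_mono)
    also have "\<dots> \<le> hausdorff_outer k ((\<Union>i<N. R (2 * i + p)) \<union> R (2 * N + p))"
    proof (rule hausdorff_outer_separated)
      \<comment> \<open>The earlier rings have distance at least 1 / (2N + p) from \<open>C\<close>,
        the new one less than 1 / (2N + p + 1). For \<open>N = 0\<close> there are no earlier rings,
        while \<open>?d\<close> need not be positive there because 1 / 0 = 0; any positive number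
        will do.\<close>
      let ?d = "1 / real (2 * N + p) - 1 / real (2 * N + p + 1)"
      show "0 < (if N = 0 then 1 else ?d)" by (auto intro!: divide_strict_left_mono)
      fix x y assume x: "x \<in> (\<Union>i<N. R (2 * i + p))" and y: "y \<in> R (2 * N + p)"
      then obtain i where i: "i < N" "x \<in> R (2 * i + p)" by blast
      have "1 / real (2 * N + p) \<le> 1 / real (2 * i + p + 2)"
        using i(1) by (intro divide_left_mono) (auto simp del: of_nat_add of_nat_mult)
      also have "\<dots> \<le> infdist x C" using i(2) by (simp add: R_def algebra_simps)
      finally have "1 / real (2 * N + p) \<le> infdist x C" .
      moreover have "infdist y C < 1 / real (2 * N + p + 1)" using y by (simp add: R_def)
      ultimately show "(if N = 0 then 1 else ?d) \<le> dist x y"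
        using lipi[of x y] i(1) by auto
    qed
    also have "(\<Union>i<N. R (2 * i + p)) \<union> R (2 * N + p) = (\<Union>i<Suc N. R (2 * i + p))"
      by (auto simp: less_Suc_eq)
    finally show ?case .
  qed simp
  have par_fin: "(\<Sum>i. hausdorff_outer k (R (2 * i + p))) < top" for p
  proof -
    have "(\<Sum>i. hausdorff_outer k (R (2 * i + p))) \<le> hausdorff_outer k X"
      unfolding suminf_eq_SUP
      by (intro SUP_least order_trans[OF parity] hausdorff_outer_mono) (auto simp: R_def)
    then show ?thesis using fin by simp
  qed
  have "(\<Sum>i. hausdorff_outer k (R i)) < top"
  proof -
    have "(\<Sum>i<N. hausdorff_outer k (R i)) \<le>
        (\<Sum>i. hausdorff_outer k (R (2 * i + 0))) + (\<Sum>i. hausdorff_outer k (R (2 * i + 1)))" for N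
    proof -
      have "(\<Sum>i<N. hausdorff_outer k (R i)) \<le> (\<Sum>i<2 * N. hausdorff_outer k (R i))"
        by (intro sum_mono2) auto
      also have "\<dots> = (\<Sum>i<N. hausdorff_outer k (R (2 * i + 0))) + (\<Sum>i<N. hausdorff_outer k (R (2 * i + 1)))"
        by (induction N) (simp_all add: algebra_simps)
      also have "\<dots> \<le> (\<Sum>i. hausdorff_outer k (R (2 * i + 0))) + (\<Sum>i. hausdorff_outer k (R (2 * i + 1)))"
        by (intro add_mono sum_le_suminf) auto
      finally show ?thesis .
    qed
    then have "(\<Sum>i. hausdorff_outer k (R i)) \<le>
        (\<Sum>i. hausdorff_outer k (R (2 * i + 0))) + (\<Sum>i. hausdorff_outer k (R (2 * i + 1)))"
      unfolding suminf_eq_SUP[of "\<lambda>i. hausdorff_outer k (R i)"] by (rule SUP_least)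
    also have "\<dots> < top" using par_fin[of 0] par_fin[of 1] by simp
    finally show ?thesis .
  qed
  then have tail: "(\<lambda>m. \<Sum>i. hausdorff_outer k (R (i + m))) \<longlonglongrightarrow> 0"
  proof -
    assume f: "(\<Sum>i. hausdorff_outer k (R i)) < top"
    define a where "a i = enn2real (hausdorff_outer k (R i))" for i
    have fini: "hausdorff_outer k (R i) < top" for i using f ennreal_suminf_lessD by blast
    have ai: "hausdorff_outer k (R i) = ennreal (a i)" "0 \<le> a i" for i
      using fini[of i] by (simp_all add: a_def)
    have sa: "summable a"
      using f unfolding ai(1) by (intro summable_suminf_not_top) (auto simp: ai(2))
    have "(\<Sum>i. hausdorff_outer k (R (i + m))) = ennreal (\<Sum>i. a (i + m))" for m
      unfolding ai(1) using sa ai(2) by (intro suminf_ennreal2) (auto simp: summable_iff_shift)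
    moreover have "(\<lambda>m. ennreal (\<Sum>i. a (i + m))) \<longlonglongrightarrow> ennreal 0"
      using suminf_exist_split2[OF sa] by (intro tendsto_ennrealI)
    ultimately show ?thesis by simp
  qed
  have bound: "hausdorff_outer k (X \<inter> C) + hausdorff_outer k (X - C)
      \<le> hausdorff_outer k X + (\<Sum>i. hausdorff_outer k (R (i + m)))" for m
  proof -
    have "X - C \<subseteq> T m \<union> (\<Union>i. R (i + m))"
    proof
      fix x assume x: "x \<in> X - C"
      then have pos: "0 < infdist x C" using inf_pos by blast
      show "x \<in> T m \<union> (\<Union>i. R (i + m))"
      proof (cases "1 / real (Suc m) \<le> infdist x C")
        case True
        then show ?thesis using x by (simp add: T_def)
      next
        case False
        \<comment> \<open>This least index is larger than \<open>m\<close>, and \<open>x\<close>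
          lies in the ring with index \<open>j - 1\<close>.\<close>
        define j where "j = (LEAST j. 1 / real (Suc j) \<le> infdist x C)"
        have ex: "\<exists>j. 1 / real (Suc j) \<le> infdist x C"
          using pos by (metis nat_approx_posE less_imp_le)
        have j: "1 / real (Suc j) \<le> infdist x C" unfolding j_def by (rule LeastI_ex[OF ex])
        have "m < j"
        proof (rule ccontr)
          assume "\<not> m < j"
          then have "1 / real (Suc m) \<le> 1 / real (Suc j)" by (intro divide_left_mono) auto
          then show False using j False by linarith
        qed
        then obtain i where i: "j = Suc (i + m)" by (metis add.commute less_imp_Suc_add)
        have "\<not> 1 / real (Suc (i + m)) \<le> infdist x C"
          using not_less_Least[of "i + m" "\<lambda>j. 1 / real (Suc j) \<le> infdist x C"] i j_def by simp
        then have "x \<in> R (i + m)" using x j i by (auto simp: R_def)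
        then show ?thesis by blast
      qed
    qed
    then have "hausdorff_outer k (X - C) \<le> hausdorff_outer k (T m) + (\<Sum>i. hausdorff_outer k (R (i + m)))"
      using hausdorff_outer_mono hausdorff_outer_Un_le hausdorff_outer_UN_le[of k "\<lambda>i. R (i + m)"]
      by (meson add_left_mono order_trans)
    then have "hausdorff_outer k (X \<inter> C) + hausdorff_outer k (X - C)
        \<le> (hausdorff_outer k (X \<inter> C) + hausdorff_outer k (T m)) + (\<Sum>i. hausdorff_outer k (R (i + m)))"
      by (simp add: add.assoc add_left_mono)
    also have "\<dots> \<le> hausdorff_outer k X + (\<Sum>i. hausdorff_outer k (R (i + m)))"
      by (intro add_right_mono inT)
    finally show ?thesis .
  qed
  have "(\<lambda>m. hausdorff_outer k X + (\<Sum>i. hausdorff_outer k (R (i + m)))) \<longlonglongrightarrow> hausdorff_outer k X + 0"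
    by (intro tendsto_add tendsto_const tail)
  then show ?thesis
    using bound by (intro LIMSEQ_le_const[where X = "\<lambda>m. hausdorff_outer k X + (\<Sum>i. hausdorff_outer k (R (i + m)))"]) auto
qed auto

lemma sets_borel_subset_hausdorff_measure:
  "sets borel \<subseteq> sets (hausdorff_measure k :: 'a::metric_space measure)"
proof -
  have "Collect closed \<subseteq> sets (hausdorff_measure k :: 'a measure)"
  proof
    fix C :: "'a set" assume "C \<in> Collect closed"
    then have C: "closed C" by simp
    have "hausdorff_outer k (C \<inter> X) + hausdorff_outer k ((UNIV - C) \<inter> X) = hausdorff_outer k X" for X
    proof (rule antisym)
      have "C \<inter> X = X \<inter> C" "(UNIV - C) \<inter> X = X - C" by auto
      then show "hausdorff_outer k (C \<inter> X) + hausdorff_outer k ((UNIV - C) \<inter> X) \<le> hausdorff_outer k X"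
        using hausdorff_outer_split_closed[OF C, of k X] by simp
      have "X \<subseteq> (C \<inter> X) \<union> ((UNIV - C) \<inter> X)" by auto
      then show "hausdorff_outer k X \<le> hausdorff_outer k (C \<inter> X) + hausdorff_outer k ((UNIV - C) \<inter> X)"
        using hausdorff_outer_mono hausdorff_outer_Un_le order_trans by blast
    qed
    then show "C \<in> sets (hausdorff_measure k)"
      unfolding sets_hausdorff_measure lambda_system_def by simp
  qed
  then have "sigma_sets UNIV (Collect closed) \<subseteq> sets (hausdorff_measure k :: 'a measure)"
    using sets.sigma_sets_subset[of "Collect closed" "hausdorff_measure k :: 'a measure"]
    by (simp add: space_hausdorff_measure)
  then show ?thesis by (simp add: borel_eq_closed)
qed

lemma emeasure_hausdorff_borel:
  "A \<in> sets borel \<Longrightarrow> emeasure (hausdorff_measure k) A = hausdorff_outer k A"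
  using sets_borel_subset_hausdorff_measure emeasure_hausdorff_measure by blast

text \<open>Passing to closures does not change the diameters of covering sets. The intersection,
  over finer and finer near-optimal covers, of the unions of these closures is therefore covered as
  cheaply as \<open>A\<close>.\<close>

lemma hausdorff_borel_hull:
  fixes A :: "'a::metric_space set"
  obtains B where "B \<in> sets borel" "A \<subseteq> B" "hausdorff_outer k B = hausdorff_outer k A"
proof (cases "hausdorff_outer k A = top")
  case True
  have "hausdorff_outer k (UNIV :: 'a set) = hausdorff_outer k A"
    using hausdorff_outer_mono[of A UNIV k] True by (simp add: top_unique)
  then show ?thesis using that[of UNIV] by simp
next
  case False
  define d where "d m = 1 / real (Suc m)" for m
  have fin: "hausdorff_pre k (d m) A < hausdorff_outer k A + ennreal (d m)" for m
  proof -
    have "hausdorff_pre k (d m) A \<le> hausdorff_outer k A"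
      by (intro hausdorff_pre_le_outer) (simp add: d_def)
    moreover have "0 < ennreal (d m)" by (simp add: d_def)
    ultimately show ?thesis using False
      by (metis add.right_neutral ennreal_add_left_cancel_less infinity_ennreal_def less_top order.strict_trans1)
  qed
  have "\<exists>U :: nat \<Rightarrow> 'a set. A \<subseteq> (\<Union>i. U i) \<and> (\<forall>i. bounded (U i) \<and> diameter (U i) \<le> d m) \<and>
      (\<Sum>i. hausdorff_content k (U i)) < hausdorff_outer k A + ennreal (d m)" for m
    by (rule hausdorff_pre_obtain_cover[OF fin[of m]]) blast
  then obtain U where U: "\<And>m. A \<subseteq> (\<Union>i. U m i)" "\<And>m i. bounded (U m i)" "\<And>m i. diameter (U m i) \<le> d m"
    "\<And>m. (\<Sum>i. hausdorff_content k (U m i)) < hausdorff_outer k A + ennreal (d m)"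
    by metis
  define B where "B = (\<Inter>m. \<Union>i. closure (U m i))"
  have B: "B \<in> sets borel" unfolding B_def by auto
  have AB: "A \<subseteq> B" unfolding B_def using U(1) closure_subset by blast
  have "hausdorff_pre k \<delta> B \<le> hausdorff_outer k A" if "\<delta> > 0" for \<delta>
  proof (rule ennreal_le_epsilon)
    fix e :: real assume "0 < e"
    have "0 < min \<delta> e" using that \<open>0 < e\<close> by simp
    then obtain m where "1 / real (Suc m) < min \<delta> e" by (rule nat_approx_posE)
    then have m: "d m < min \<delta> e" by (simp add: d_def)
    have cont: "hausdorff_content k (closure (U m i)) = hausdorff_content k (U m i)" for i
      using diameter_closure[OF U(2)] by (simp add: hausdorff_content_def)
    have "hausdorff_pre k \<delta> B \<le> (\<Sum>i. hausdorff_content k (closure (U m i)))"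
    proof (rule hausdorff_pre_le_cover)
      show "B \<subseteq> (\<Union>i. closure (U m i))" unfolding B_def by blast
      show "diameter (closure (U m i)) \<le> \<delta>" for i
        using diameter_closure[OF U(2)] U(3)[of m i] m by simp
    qed (use U(2) in blast)
    also have "\<dots> \<le> hausdorff_outer k A + ennreal (d m)" unfolding cont using U(4) by (rule less_imp_le)
    also have "\<dots> \<le> hausdorff_outer k A + ennreal e" using m by (intro add_left_mono ennreal_leI) simp
    finally show "hausdorff_pre k \<delta> B \<le> hausdorff_outer k A + ennreal e" .
  qed
  then have "hausdorff_outer k B \<le> hausdorff_outer k A"
    unfolding hausdorff_outer_def[of k B] by (auto intro: SUP_least)
  then show ?thesis using that[OF B AB] hausdorff_outer_mono[OF AB] by (simp add: antisym)
qed

section \<open>Null sets and slices\<close>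

lemma unit_ball_vol_neq_0 [simp]: "0 \<le> n \<Longrightarrow> unit_ball_vol n \<noteq> 0"
  using unit_ball_vol_pos[of n] by linarith

lemma hausdorff_content_dist_le:
  assumes "0 < k" "0 \<le> d" "\<And>x y. \<lbrakk>x \<in> U; y \<in> U\<rbrakk> \<Longrightarrow> dist x y \<le> d"
  shows "hausdorff_content k U \<le> ennreal (unit_ball_vol (real k) * (d / 2) ^ k)"
proof -
  have "bounded U" unfolding bounded_two_points using assms(3) by blast
  then have "diameter U \<le> d" "0 \<le> diameter U"
    using diameter_leI[of d U] assms(2,3) diameter_ge_0 by blast+
  then show ?thesis
    unfolding hausdorff_content_def
    by (auto intro!: ennreal_leI mult_left_mono power_mono divide_right_mono)
qed

section \<open>Economical covers of null sets, null cylinders and null slices\<close>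

text \<open>Covering sets may be single points, but the application divides by their size. Hence
  each diameter is enlarged to a positive \<open>d i\<close>, at a cost that decays geometrically;
  the upper bound 2 comes from starting with mesh 1 and enlarging by less than 1.\<close>

lemma hausdorff_null_cover:
  fixes A :: "'a::metric_space set"
  assumes "hausdorff_outer k A = 0" "0 < k" "0 < e"
  obtains U :: "nat \<Rightarrow> 'a set" and d :: "nat \<Rightarrow> real"
  where "A \<subseteq> (\<Union>i. U i)" "\<And>i. 0 < d i" "\<And>i. d i \<le> 2"
    "\<And>i x y. \<lbrakk>x \<in> U i; y \<in> U i\<rbrakk> \<Longrightarrow> dist x y \<le> d i" "(\<Sum>i. ennreal (d i ^ k)) \<le> ennreal e"
proof -
  let ?w = "unit_ball_vol (real k) / 2 ^ k"
  have vol: "0 < unit_ball_vol (real k)" by simp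
  then have w: "0 < ?w" by simp
  have "0 < ?w * (e / 2)" using w assms(3) by (intro mult_pos_pos) auto
  then have "0 < ennreal (?w * (e / 2))" by (simp only: ennreal_less_zero_iff)
  then have "hausdorff_pre k 1 A < ennreal (?w * (e / 2))"
    using hausdorff_pre_le_outer[of 1 k A] assms(1) by simp
  then obtain U :: "nat \<Rightarrow> 'a set" where U: "A \<subseteq> (\<Union>i. U i)" "\<And>i. bounded (U i)"
    "\<And>i. diameter (U i) \<le> 1" "(\<Sum>i. hausdorff_content k (U i)) < ennreal (?w * (e / 2))"
    by (rule hausdorff_pre_obtain_cover) blast
  have content: "hausdorff_content k (U i) = ennreal ?w * ennreal (diameter (U i) ^ k)" for i
    using assms(2) w diameter_ge_0[OF U(2)[of i]]
    by (auto simp: hausdorff_content_def power_divide ennreal_mult[symmetric])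
  have "ennreal ?w * (\<Sum>i. ennreal (diameter (U i) ^ k)) \<le> ennreal ?w * ennreal (e / 2)"
    using U(4) w assms(3) unfolding content ennreal_suminf_cmult
    by (subst ennreal_mult[symmetric]) (auto simp: less_imp_le)
  then have sumU: "(\<Sum>i. ennreal (diameter (U i) ^ k)) \<le> ennreal (e / 2)"
    by (subst (asm) ennreal_mult_le_mult_iff) auto
  have "\<exists>d. 0 < d \<and> d \<le> 2 \<and> diameter (U i) \<le> d \<and>
      d ^ k \<le> diameter (U i) ^ k + (e / 2) * (1 / 2) ^ Suc i" for i
  proof -
    have "((\<lambda>t. (diameter (U i) + t) ^ k) \<longlongrightarrow> (diameter (U i) + 0) ^ k) (at_right 0)"
      by (intro tendsto_intros)
    moreover have "(diameter (U i) + 0) ^ k < diameter (U i) ^ k + (e / 2) * (1 / 2) ^ Suc i"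
      using assms(3) by simp
    ultimately have "\<forall>\<^sub>F t in at_right 0. (diameter (U i) + t) ^ k < diameter (U i) ^ k + (e / 2) * (1 / 2) ^ Suc i"
      by (rule order_tendstoD)
    moreover have "\<forall>\<^sub>F t in at_right 0. t \<in> {0<..<1::real}"
      by (rule eventually_at_right_real) simp
    ultimately have "\<forall>\<^sub>F t in at_right 0. (diameter (U i) + t) ^ k < diameter (U i) ^ k + (e / 2) * (1 / 2) ^ Suc i
        \<and> t \<in> {0<..<1::real}"
      by (rule eventually_conj)
    then obtain t where "(diameter (U i) + t) ^ k < diameter (U i) ^ k + (e / 2) * (1 / 2) ^ Suc i" "t \<in> {0<..<1}"
      using eventually_happens trivial_limit_at_right_real by blast
    then show ?thesis
      using diameter_ge_0[OF U(2)[of i]] U(3)[of i] by (intro exI[of _ "diameter (U i) + t"]) auto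
  qed
  then obtain d where d: "\<And>i. 0 < d i" "\<And>i. d i \<le> 2" "\<And>i. diameter (U i) \<le> d i"
    "\<And>i. d i ^ k \<le> diameter (U i) ^ k + (e / 2) * (1 / 2) ^ Suc i" by metis
  have "(\<Sum>i. ennreal (d i ^ k)) \<le> (\<Sum>i. ennreal (diameter (U i) ^ k) + ennreal ((e / 2) * (1 / 2) ^ Suc i))"
    using d(4) assms(3) diameter_ge_0[OF U(2)]
    by (intro suminf_le) (auto simp flip: ennreal_plus intro!: ennreal_leI)
  also have "\<dots> = (\<Sum>i. ennreal (diameter (U i) ^ k)) + (\<Sum>i. ennreal ((e / 2) * (1 / 2) ^ Suc i))"
    by (intro suminf_add[symmetric]) auto
  also have "(\<Sum>i. ennreal ((e / 2) * (1 / 2) ^ Suc i)) = ennreal (e / 2)"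
    using assms(3) sums_mult[OF power_half_series, of "e / 2"] by (intro suminf_ennreal_eq) auto
  also have "(\<Sum>i. ennreal (diameter (U i) ^ k)) + ennreal (e / 2) \<le> ennreal (e / 2) + ennreal (e / 2)"
    by (intro add_right_mono sumU)
  also have "\<dots> = ennreal e" using assms(3) by (simp flip: ennreal_plus)
  finally have sumd: "(\<Sum>i. ennreal (d i ^ k)) \<le> ennreal e" .
  have "dist x y \<le> d i" if "x \<in> U i" "y \<in> U i" for i x y
    using diameter_bounded_bound[OF U(2) that] d(3)[of i] by linarith
  then show thesis using that[of U d] U(1) d(1,2) sumd by blast
qed

text \<open>The product of a null set of dimension \<open>k\<close> with an interval is null in
  dimension \<open>k + 1\<close>: over a covering set of size d the unit interval is cut into about
  1 / d pieces of length d, each giving a set inside a ball of radius proportional to d. The total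
  volume over this covering set is proportional to d^k.\<close>

lemma lipschitz_cylinder_null:
  fixes \<Phi> :: "'a::metric_space \<Rightarrow> real \<Rightarrow> 'b::euclidean_space"
  assumes "hausdorff_outer k A = 0" "0 < k" "DIM('b) = Suc k"
    and lip: "\<And>x y s t. \<lbrakk>x \<in> A; y \<in> A; s \<in> {0..1}; t \<in> {0..1}\<rbrakk>
       \<Longrightarrow> dist (\<Phi> x s) (\<Phi> y t) \<le> L * (dist x y + \<bar>s - t\<bar>)"
  shows "negligible (\<Union>x\<in>A. \<Phi> x ` {0..1})"
proof -
  define M where "M = max L 1"
  have M: "1 \<le> M" by (simp add: M_def)
  have lipM: "dist (\<Phi> x s) (\<Phi> y t) \<le> M * (dist x y + \<bar>s - t\<bar>)"
    if "x \<in> A" "y \<in> A" "s \<in> {0..1}" "t \<in> {0..1}" for x y s t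
  proof -
    have "L * (dist x y + \<bar>s - t\<bar>) \<le> M * (dist x y + \<bar>s - t\<bar>)"
      by (intro mult_right_mono) (auto simp: M_def)
    then show ?thesis using lip[OF that] by linarith
  qed
  let ?n = "DIM('b)"
  \<comment> \<open>At most 1 / d + 2 balls are used per covering set, and this is at most 5 / d
    because d \<le> 2.\<close>
  define W where "W = 5 * (unit_ball_vol (real ?n) * (2 * M) ^ ?n)"
  have W: "0 < W" using M by (simp add: W_def)
  show ?thesis unfolding negligible_outer_le
  proof (intro allI impI)
    fix e :: real assume e: "0 < e"
    obtain U :: "nat \<Rightarrow> 'a set" and d where U: "A \<subseteq> (\<Union>i. U i)" "\<And>i. 0 < d i" "\<And>i. d i \<le> 2"
      "\<And>i x y. \<lbrakk>x \<in> U i; y \<in> U i\<rbrakk> \<Longrightarrow> dist x y \<le> d i" "(\<Sum>i. ennreal (d i ^ k)) \<le> ennreal (e / W)"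
      by (rule hausdorff_null_cover[OF assms(1,2), of "e / W"]) (use W e in auto)
    define m where "m i = nat \<lceil>1 / d i\<rceil>" for i
    define P where "P i j = (\<Union>x\<in>U i \<inter> A. \<Phi> x ` ({0..1} \<inter> {real j * d i .. real (Suc j) * d i}))" for i j
    have "\<exists>c. P i j \<subseteq> cball c (2 * M * d i)" for i j
    proof (cases "P i j = {}")
      case False
      then obtain c where c: "c \<in> P i j" by blast
      have "dist c z \<le> 2 * M * d i" if z: "z \<in> P i j" for z
      proof -
        obtain x s where x: "x \<in> U i \<inter> A" "s \<in> {0..1} \<inter> {real j * d i .. real (Suc j) * d i}" "c = \<Phi> x s"
          using c by (auto simp: P_def)
        obtain y t where y: "y \<in> U i \<inter> A" "t \<in> {0..1} \<inter> {real j * d i .. real (Suc j) * d i}" "z = \<Phi> y t"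
          using z by (auto simp: P_def)
        have "\<bar>s - t\<bar> \<le> d i" using x(2) y(2) by (auto simp: algebra_simps abs_le_iff)
        moreover have "dist x y \<le> d i" using U(4) x y by blast
        ultimately have "M * (dist x y + \<bar>s - t\<bar>) \<le> M * (2 * d i)"
          using M by (intro mult_left_mono) auto
        then show ?thesis using lipM[of x y s t] x y by simp
      qed
      then show ?thesis by (intro exI[of _ c]) auto
    qed auto
    then obtain c where c: "\<And>i j. P i j \<subseteq> cball (c i j) (2 * M * d i)" by metis
    define T where "T i = (\<Union>j\<le>m i. cball (c i j) (2 * M * d i))" for i
    have emT: "emeasure lebesgue (T i) \<le> ennreal (W * d i ^ k)" for i
    proof -
      have "emeasure lebesgue (T i) \<le> (\<Sum>j\<le>m i. emeasure lebesgue (cball (c i j) (2 * M * d i)))"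
        unfolding T_def by (intro emeasure_subadditive_finite) auto
      also have "\<dots> = (\<Sum>j\<le>m i. ennreal (unit_ball_vol (real ?n) * (2 * M * d i) ^ ?n))"
        using M U(2)[of i] by (intro sum.cong) (auto simp: emeasure_cball)
      also have "\<dots> = ennreal ((real (m i) + 1) * (unit_ball_vol (real ?n) * (2 * M * d i) ^ ?n))"
        using M U(2)[of i] by (subst sum_ennreal) (auto simp: algebra_simps)
      also have "\<dots> \<le> ennreal (W * d i ^ k)"
      proof (rule ennreal_leI)
        have "real (m i) + 1 \<le> 1 / d i + 2"
          using U(2)[of i] unfolding m_def by (simp add: of_nat_nat) linarith
        also have "\<dots> \<le> 5 / d i" using U(2,3)[of i] by (simp add: field_simps)
        finally have "(real (m i) + 1) * (unit_ball_vol (real ?n) * (2 * M * d i) ^ ?n)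
           \<le> 5 / d i * (unit_ball_vol (real ?n) * (2 * M * d i) ^ ?n)"
          using M U(2)[of i] by (intro mult_right_mono) auto
        also have "\<dots> = W * d i ^ k"
          using U(2)[of i] by (simp add: W_def assms(3) power_mult_distrib)
        finally show "(real (m i) + 1) * (unit_ball_vol (real ?n) * (2 * M * d i) ^ ?n) \<le> W * d i ^ k" .
      qed
      finally show ?thesis .
    qed
    have "emeasure lebesgue (\<Union>i. T i) \<le> (\<Sum>i. emeasure lebesgue (T i))"
      by (intro emeasure_subadditive_countably) (auto simp: T_def)
    also have "\<dots> \<le> (\<Sum>i. ennreal W * ennreal (d i ^ k))"
      using emT W U(2) by (intro suminf_le) (auto simp: ennreal_mult less_imp_le)
    also have "\<dots> = ennreal W * (\<Sum>i. ennreal (d i ^ k))" by simp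
    also have "\<dots> \<le> ennreal W * ennreal (e / W)" by (intro mult_left_mono U(5)) simp
    also have "\<dots> = ennreal e" using W e by (simp add: ennreal_mult[symmetric])
    finally have em: "emeasure lebesgue (\<Union>i. T i) \<le> ennreal e" .
    have Tm: "(\<Union>i. T i) \<in> sets lebesgue" by (auto simp: T_def)
    have cov: "(\<Union>x\<in>A. \<Phi> x ` {0..1}) \<subseteq> (\<Union>i. T i)"
    proof
      fix z assume "z \<in> (\<Union>x\<in>A. \<Phi> x ` {0..1})"
      then obtain x s where x: "x \<in> A" "0 \<le> s" "s \<le> 1" "z = \<Phi> x s" by auto
      then obtain i where i: "x \<in> U i" using U(1) by blast
      define j where "j = nat \<lfloor>s / d i\<rfloor>"
      have sd: "0 \<le> s / d i" using x U(2)[of i] by simp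
      have j: "real j \<le> s / d i" "s / d i \<le> real (Suc j)"
        using sd unfolding j_def by (simp_all add: of_nat_nat) linarith
      then have "real j * d i \<le> s" "s \<le> real (Suc j) * d i"
        using U(2)[of i] by (simp_all add: field_simps)
      then have "z \<in> P i j"
        unfolding P_def using x i by (intro UN_I[of x] image_eqI[of _ _ s]) auto
      moreover have "j \<le> m i"
        unfolding j_def m_def using x U(2)[of i]
        by (intro nat_mono order_trans[OF floor_le_ceiling] ceiling_mono divide_right_mono) auto
      ultimately show "z \<in> (\<Union>i. T i)" using c unfolding T_def by blast
    qed
    show "\<exists>T. (\<Union>x\<in>A. \<Phi> x ` {0..1}) \<subseteq> T \<and> T \<in> lmeasurable \<and> measure lebesgue T \<le> e"
    proof (intro exI conjI)
      show "(\<Union>i. T i) \<in> lmeasurable"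
        using Tm em by (auto simp: fmeasurable_def intro: le_less_trans)
      show "measure lebesgue (\<Union>i. T i) \<le> e"
        unfolding measure_def using em e by (metis enn2real_leI less_imp_le)
    qed (rule cov)
  qed
qed

text \<open>Vitali's covering lemma: disjoint balls inside an open set of small volume cover
  \<open>A\<close> after enlargement by the factor 5. Since the volumes of the disjoint balls add up
  to little, so do the powers of the enlarged radii.\<close>

lemma null_set_ball_cover:
  fixes A :: "'a::euclidean_space set"
  assumes A: "A \<in> null_sets lebesgue" and "0 < e" "0 < \<delta>"
  obtains c :: "nat \<Rightarrow> 'a" and d :: "nat \<Rightarrow> real"
  where "A \<subseteq> (\<Union>i. cball (c i) (d i))" "\<And>i. 0 \<le> d i" "\<And>i. d i \<le> \<delta>"
    "(\<Sum>i. ennreal (d i ^ DIM('a))) \<le> ennreal e"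
proof -
  let ?n = "DIM('a)" let ?w = "unit_ball_vol (real ?n)"
  \<comment> \<open>Chosen so that the volume of the unit ball and the enlargement factor 5^n cancel
    exactly in the final sum.\<close>
  define e' where "e' = ?w * e / 5 ^ ?n"
  have e': "0 < e'" using assms(2) by (simp add: e'_def)
  obtain V where V: "open V" "A \<subseteq> V" "emeasure lebesgue (V - A) < ennreal e'"
    by (rule sets_lebesgue_outer_open[OF null_setsD2[OF A] e'])
  have emV: "emeasure lebesgue V < ennreal e'"
  proof -
    have "V = (V - A) \<union> A" using V(2) by blast
    moreover have "emeasure lebesgue ((V - A) \<union> A) = emeasure lebesgue (V - A)"
      by (rule emeasure_Un_null_set) (use A V(1) in auto)
    ultimately show ?thesis using V(3) by simp
  qed
  have "\<exists>r. 0 < r \<and> r \<le> \<delta> / 5 \<and> cball x r \<subseteq> V" if "x \<in> A" for x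
  proof -
    obtain r where "0 < r" "cball x r \<subseteq> V" using V(1,2) \<open>x \<in> A\<close> open_contains_cball by blast
    then show ?thesis using assms(3)
      by (intro exI[of _ "min r (\<delta> / 5)"]) (auto simp: subset_eq)
  qed
  then obtain r where r: "\<And>x. x \<in> A \<Longrightarrow> 0 < r x \<and> r x \<le> \<delta> / 5 \<and> cball x (r x) \<subseteq> V" by metis
  obtain C where C: "countable C" "C \<subseteq> A" "pairwise (\<lambda>i j. disjnt (cball i (r i)) (cball j (r j))) C"
    "A \<subseteq> (\<Union>i\<in>C. cball i (5 * r i))"
    by (rule Vitali_covering_lemma_cballs[where S = A and K = A and a = "\<lambda>x. x" and r = r and B = "\<delta> / 5"]) (use r in force)+
  define N where "N = to_nat_on C ` C"
  define c where "c = from_nat_into C"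
  define d where "d j = (if j \<in> N then 5 * r (c j) else 0)" for j
  have cN: "c j \<in> C" if "j \<in> N" for j
    using that C(1) by (auto simp: N_def c_def)
  have inj: "i = j" if "i \<in> N" "j \<in> N" "c i = c j" for i j
    using that C(1) by (auto simp: N_def c_def)
  define B where "B j = (if j \<in> N then cball (c j) (r (c j)) else {})" for j
  have dis: "disjoint_family B"
    unfolding disjoint_family_on_def
  proof (intro ballI impI)
    fix i j :: nat assume "i \<noteq> j"
    show "B i \<inter> B j = {}"
    proof (cases "i \<in> N \<and> j \<in> N")
      case True
      then have "c i \<noteq> c j" using inj \<open>i \<noteq> j\<close> by blast
      then show ?thesis
        using True C(3) cN by (auto simp: B_def pairwise_def disjnt_def)
    qed (auto simp: B_def)
  qed
  have emB: "emeasure lebesgue (B j) = ennreal (?w / 5 ^ ?n) * ennreal (d j ^ ?n)" for j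
  proof (cases "j \<in> N")
    case True
    then have "0 < r (c j)" using cN C(2) r by blast
    then show ?thesis using True
      by (simp add: B_def d_def emeasure_cball power_mult_distrib ennreal_mult[symmetric])
  qed (simp add: B_def d_def)
  have "ennreal (?w / 5 ^ ?n) * (\<Sum>j. ennreal (d j ^ ?n)) = (\<Sum>j. emeasure lebesgue (B j))"
    by (simp add: emB)
  also have "\<dots> = emeasure lebesgue (\<Union>j. B j)"
    by (intro suminf_emeasure dis) (auto simp: B_def)
  also have "\<dots> \<le> emeasure lebesgue V"
  proof (rule emeasure_mono)
    show "(\<Union>j. B j) \<subseteq> V"
    proof
      fix z assume "z \<in> (\<Union>j. B j)"
      then obtain j where "j \<in> N" "z \<in> cball (c j) (r (c j))" by (auto simp: B_def split: if_splits)
      then show "z \<in> V" using r[of "c j"] cN[of j] C(2) by blast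
    qed
  qed (use V(1) in auto)
  also have "\<dots> \<le> ennreal e'" using emV by simp
  also have "ennreal e' = ennreal (?w / 5 ^ ?n) * ennreal e"
    using assms(2) by (simp add: e'_def ennreal_mult[symmetric])
  finally have sum: "(\<Sum>j. ennreal (d j ^ ?n)) \<le> ennreal e"
    by (subst (asm) ennreal_mult_le_mult_iff) auto
  show thesis
  proof (rule that[of c d])
    show "A \<subseteq> (\<Union>i. cball (c i) (d i))"
    proof
      fix x assume "x \<in> A"
      then obtain i where i: "i \<in> C" "x \<in> cball i (5 * r i)" using C(4) by blast
      then have "to_nat_on C i \<in> N" "c (to_nat_on C i) = i" using C(1) by (auto simp: N_def c_def)
      then show "x \<in> (\<Union>i. cball (c i) (d i))" using i by (intro UN_I[of "to_nat_on C i"]) (auto simp: d_def)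
    qed
    show "0 \<le> d i" "d i \<le> \<delta>" for i
      using cN[of i] C(2) r[of "c i"] assms(3) by (auto simp: d_def)
    show "(\<Sum>i. ennreal (d i ^ DIM('a))) \<le> ennreal e" by (rule sum)
  qed
qed

text \<open>An Eilenberg-type inequality: a covering of \<open>A\<close> by balls of radii \<open>d i\<close> covers the slice over \<open>r\<close> by
  those balls that meet it, and each ball meets slices over an interval of length at most \<open>2 * d i\<close>.\<close>

lemma AE_slice_hausdorff_null:
  fixes u :: "'a::euclidean_space \<Rightarrow> real"
  assumes A: "A \<in> null_sets lebesgue" and k: "0 < k" "DIM('a) = Suc k"
    and u: "\<And>x y. \<bar>u x - u y\<bar> \<le> dist x y"
  shows "AE r in lebesgue. hausdorff_outer k (A \<inter> {x. u x = r}) = 0"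
proof -
  let ?w = "unit_ball_vol (real k)"
  have "AE r in lborel. hausdorff_pre k \<delta> (A \<inter> {x. u x = r}) = 0" if \<delta>: "0 < \<delta>" for \<delta>
  proof -
    \<comment> \<open>A ball of radius d contributes \<open>?w * d ^ k\<close> to the slices over an
      interval of length 2d, which explains the divisor \<open>2 * ?w\<close>: the integral over all
      radii becomes at most 1 / (j + 1).\<close>
    have "\<exists>c d. A \<subseteq> (\<Union>i. cball (c i) (d i)) \<and> (\<forall>i. 0 \<le> d i \<and> d i \<le> \<delta> / 2) \<and>
      (\<Sum>i. ennreal (d i ^ DIM('a))) \<le> ennreal (1 / real (Suc j) / (2 * ?w))" for j
    proof -
      have "0 < 1 / real (Suc j) / (2 * ?w)" by simp
      then obtain c d where "A \<subseteq> (\<Union>i. cball (c i) (d i))" "\<And>i. 0 \<le> d i" "\<And>i. d i \<le> \<delta> / 2"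
        "(\<Sum>i. ennreal (d i ^ DIM('a))) \<le> ennreal (1 / real (Suc j) / (2 * ?w))"
        by (rule null_set_ball_cover[OF A, where \<delta> = "\<delta> / 2"]) (use \<delta> in \<open>simp; fail\<close>, blast)
      then show ?thesis by blast
    qed
    then have "\<forall>j. \<exists>cd. A \<subseteq> (\<Union>i. cball (fst cd i) (snd cd i)) \<and> (\<forall>i. 0 \<le> snd cd i \<and> snd cd i \<le> \<delta> / 2) \<and>
      (\<Sum>i. ennreal (snd cd i ^ DIM('a))) \<le> ennreal (1 / real (Suc j) / (2 * ?w))"
      by (simp only: split_paired_Ex fst_conv snd_conv) blast
    from choice[OF this] obtain cd where cd: "\<forall>j. A \<subseteq> (\<Union>i. cball (fst (cd j) i) (snd (cd j) i)) \<and>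
      (\<forall>i. 0 \<le> snd (cd j) i \<and> snd (cd j) i \<le> \<delta> / 2) \<and>
      (\<Sum>i. ennreal (snd (cd j) i ^ DIM('a))) \<le> ennreal (1 / real (Suc j) / (2 * ?w))" ..
    define c :: "nat \<Rightarrow> nat \<Rightarrow> 'a" where "c j = fst (cd j)" for j
    define d where "d j = snd (cd j)" for j
    have c: "\<And>j. A \<subseteq> (\<Union>i. cball (c j i) (d j i))"
      and d: "\<And>j i. 0 \<le> d j i \<and> d j i \<le> \<delta> / 2"
      and sum: "\<And>j. (\<Sum>i. ennreal (d j i ^ DIM('a))) \<le> ennreal (1 / real (Suc j) / (2 * ?w))"
      using cd by (auto simp: c_def d_def)
    define I where "I j i = {u (c j i) - d j i .. u (c j i) + d j i}" for j i
    define h where "h j r = (\<Sum>i. ennreal (?w * d j i ^ k) * indicator (I j i) r)" for j r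
    have hm [measurable]: "h j \<in> borel_measurable borel" for j
      unfolding h_def I_def by measurable
    have pre: "hausdorff_pre k \<delta> (A \<inter> {x. u x = r}) \<le> h j r" for j r
    proof -
      let ?U = "\<lambda>i. if r \<in> I j i then cball (c j i) (d j i) else {}"
      have "hausdorff_pre k \<delta> (A \<inter> {x. u x = r}) \<le> (\<Sum>i. hausdorff_content k (?U i))"
      proof (rule hausdorff_pre_le_cover)
        show "A \<inter> {x. u x = r} \<subseteq> (\<Union>i. ?U i)"
        proof
          fix x assume x: "x \<in> A \<inter> {x. u x = r}"
          then obtain i where i: "x \<in> cball (c j i) (d j i)" using c by blast
          then have "r \<in> I j i" using u[of x "c j i"] x by (auto simp: I_def dist_commute abs_le_iff)
          then show "x \<in> (\<Union>i. ?U i)" using i by (intro UN_I[of i]) auto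
        qed
        show "diameter (?U i) \<le> \<delta>" for i using d[of j i] \<delta> by (auto simp: diameter_cball)
      qed auto
      also have "\<dots> \<le> h j r" unfolding h_def
      proof (intro suminf_le)
        fix i show "hausdorff_content k (?U i) \<le> ennreal (?w * d j i ^ k) * indicator (I j i) r"
          using d[of j i] by (auto simp: hausdorff_content_def diameter_cball)
      qed auto
      finally show ?thesis .
    qed
    have inth: "(\<integral>\<^sup>+r. h j r \<partial>lborel) \<le> ennreal (1 / real (Suc j))" for j
    proof -
      have "(\<integral>\<^sup>+r. h j r \<partial>lborel) = (\<Sum>i. \<integral>\<^sup>+r. ennreal (?w * d j i ^ k) * indicator (I j i) r \<partial>lborel)"
        unfolding h_def I_def by (intro nn_integral_suminf) measurable
      also have "\<dots> = (\<Sum>i. ennreal (2 * ?w) * ennreal (d j i ^ DIM('a)))"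
      proof (intro suminf_cong)
        fix i
        have "(\<integral>\<^sup>+r. ennreal (?w * d j i ^ k) * indicator (I j i) r \<partial>lborel)
            = ennreal (?w * d j i ^ k) * emeasure lborel (I j i)"
          by (intro nn_integral_cmult_indicator) (simp add: I_def)
        also have "\<dots> = ennreal (?w * d j i ^ k) * ennreal (2 * d j i)"
          using d[of j i] by (simp add: I_def)
        also have "\<dots> = ennreal (2 * ?w) * ennreal (d j i ^ DIM('a))"
          using d[of j i] by (simp add: k(2) ennreal_mult[symmetric] mult_ac)
        finally show "(\<integral>\<^sup>+r. ennreal (?w * d j i ^ k) * indicator (I j i) r \<partial>lborel)
           = ennreal (2 * ?w) * ennreal (d j i ^ DIM('a))" .
      qed
      also have "\<dots> = ennreal (2 * ?w) * (\<Sum>i. ennreal (d j i ^ DIM('a)))" by simp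
      also have "\<dots> \<le> ennreal (2 * ?w) * ennreal (1 / real (Suc j) / (2 * ?w))"
        by (intro mult_left_mono sum) simp
      also have "\<dots> = ennreal (1 / real (Suc j))"
        by (subst ennreal_mult[symmetric]) auto
      finally show ?thesis .
    qed
    have *: "(\<integral>\<^sup>+r. (INF j. h j r) \<partial>lborel) \<le> ennreal (1 / real (Suc j))" for j
      by (rule order_trans[OF nn_integral_mono inth[of j]]) (rule INF_lower, simp)
    \<comment> \<open>A single bound \<open>h j\<close> controls the slices only in the mean. The
      infimum over \<open>j\<close> still dominates the premeasure of every slice and has integral
      zero, hence vanishes almost everywhere.\<close>
    have "(\<integral>\<^sup>+r. (INF j. h j r) \<partial>lborel) \<le> 0"
    proof (rule ennreal_le_epsilon)
      fix e :: real assume "0 < e"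
      obtain j where "1 / real (Suc j) < e" by (rule nat_approx_posE[OF \<open>0 < e\<close>])
      then have "ennreal (1 / real (Suc j)) \<le> ennreal e" by (intro ennreal_leI) simp
      then show "(\<integral>\<^sup>+r. (INF j. h j r) \<partial>lborel) \<le> 0 + ennreal e" using *[of j] by simp
    qed
    then have "AE r in lborel. (INF j. h j r) = 0"
      by (subst nn_integral_0_iff_AE[symmetric]) (auto simp: zero_less_iff_neq_zero)
    then show ?thesis
    proof eventually_elim
      case (elim r)
      have "hausdorff_pre k \<delta> (A \<inter> {x. u x = r}) \<le> (INF j. h j r)"
        by (intro INF_greatest pre)
      then show ?case using elim by simp
    qed
  qed
  then have "AE r in lborel. \<forall>m. hausdorff_pre k (1 / real (Suc m)) (A \<inter> {x. u x = r}) = 0"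
    by (simp add: AE_all_countable)
  then have "AE r in lborel. hausdorff_outer k (A \<inter> {x. u x = r}) = 0"
  proof eventually_elim
    case (elim r)
    have "hausdorff_pre k \<delta> (A \<inter> {x. u x = r}) \<le> 0" if "0 < \<delta>" for \<delta>
    proof -
      obtain m where "1 / real (Suc m) < \<delta>" by (rule nat_approx_posE[OF \<open>0 < \<delta>\<close>])
      then have "hausdorff_pre k \<delta> (A \<inter> {x. u x = r}) \<le> hausdorff_pre k (1 / real (Suc m)) (A \<inter> {x. u x = r})"
        by (intro hausdorff_pre_antimono) simp
      also have "\<dots> = 0" using elim by blast
      finally show ?thesis .
    qed
    then have "hausdorff_outer k (A \<inter> {x. u x = r}) \<le> 0"
      unfolding hausdorff_outer_def by (intro SUP_least) auto
    then show ?case by simp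
  qed
  then show ?thesis by (rule AE_completion)
qed

section \<open>Volume under Lipschitz maps, and two applications of Fubini's theorem\<close>

text \<open>Disjoint balls centred in \<open>E\<close> exhaust \<open>E\<close> up to a null set,
  and the part of \<open>E\<close> in such a ball is mapped into a ball whose radius is
  \<open>L\<close> times as large. The sharp constant \<open>L ^ DIM('a)\<close> matters: it is
  applied later with \<open>L\<close> close to 1.\<close>

lemma emeasure_lipschitz_image:
  fixes \<phi> :: "'a::euclidean_space \<Rightarrow> 'a"
  assumes E: "E \<in> sets lebesgue" and L: "0 < L"
    and lip: "\<And>x y. \<lbrakk>x \<in> E; y \<in> E\<rbrakk> \<Longrightarrow> dist (\<phi> x) (\<phi> y) \<le> L * dist x y"
  shows "emeasure lebesgue (\<phi> ` E) \<le> ennreal (L ^ DIM('a)) * emeasure lebesgue E"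
proof (cases "emeasure lebesgue E = top")
  case True
  then show ?thesis using L by (simp add: ennreal_mult_top)
next
  case False
  let ?n = "DIM('a)" let ?w = "unit_ball_vol (real ?n)"
  have main: "emeasure lebesgue (\<phi> ` E) \<le> ennreal (L ^ ?n) * emeasure lebesgue V"
    if V: "open V" "E \<subseteq> V" for V
  proof -
    \<comment> \<open>Centres lie in \<open>E\<close> because the Lipschitz bound holds only there;
      the balls lie in \<open>V\<close> so that their total volume is controlled.\<close>
    define K where "K = {(x, r). x \<in> E \<and> 0 < r \<and> cball x r \<subseteq> V}"
    obtain C where C: "countable C" "C \<subseteq> K"
      "pairwise (\<lambda>i j. disjnt (cball (fst i) (snd i)) (cball (fst j) (snd j))) C"
      "negligible (E - (\<Union>i\<in>C. cball (fst i) (snd i)))"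
    proof (rule Vitali_covering_theorem_cballs[of K snd E fst])
      show "0 < snd i" if "i \<in> K" for i using that by (auto simp: K_def)
      show "\<exists>i. i \<in> K \<and> x \<in> cball (fst i) (snd i) \<and> snd i < d" if "x \<in> E" "0 < d" for x d
      proof -
        have "x \<in> V" using V(2) that(1) by blast
        then obtain r where r: "0 < r" "cball x r \<subseteq> V" using V(1) open_contains_cball by blast
        have "(x, min r (d / 2)) \<in> K" using r that by (auto simp: K_def subset_eq)
        then show ?thesis using r that by (intro exI[of _ "(x, min r (d / 2))"]) auto
      qed
    qed blast
    define N where "N = E - (\<Union>i\<in>C. cball (fst i) (snd i))"
    define J where "J = to_nat_on C ` C"
    define c where "c = from_nat_into C"
    have cJ: "c j \<in> C" if "j \<in> J" for j using that C(1) by (auto simp: J_def c_def)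
    have cK: "fst (c j) \<in> E" "0 < snd (c j)" "cball (fst (c j)) (snd (c j)) \<subseteq> V" if "j \<in> J" for j
      using subsetD[OF C(2) cJ[OF that]] by (auto simp: K_def split_beta subset_eq)
    have inj: "i = j" if "i \<in> J" "j \<in> J" "c i = c j" for i j
      using that C(1) by (auto simp: J_def c_def)
    define B where "B j = (if j \<in> J then cball (fst (c j)) (snd (c j)) else {})" for j
    define B' where "B' j = (if j \<in> J then cball (\<phi> (fst (c j))) (L * snd (c j)) else {})" for j
    have dis: "disjoint_family B"
      unfolding disjoint_family_on_def
    proof (intro ballI impI)
      fix i j :: nat assume "i \<noteq> j"
      show "B i \<inter> B j = {}"
      proof (cases "i \<in> J \<and> j \<in> J")
        case True
        then have "c i \<noteq> c j" using inj \<open>i \<noteq> j\<close> by blast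
        then have "disjnt (cball (fst (c i)) (snd (c i))) (cball (fst (c j)) (snd (c j)))"
          using True C(3) cJ unfolding pairwise_def by blast
        then show ?thesis using True by (simp add: B_def disjnt_def)
      qed (auto simp: B_def)
    qed
    have eB: "emeasure lebesgue (B' j) = ennreal (L ^ ?n) * emeasure lebesgue (B j)" for j
      using cK[of j] L
      by (auto simp: B_def B'_def emeasure_cball power_mult_distrib ennreal_mult[symmetric] mult_ac)
    have negN: "negligible (\<phi> ` N)"
    proof (rule negligible_locally_Lipschitz_image)
      show "negligible N" using C(4) by (simp add: N_def)
      show "\<exists>T b. open T \<and> x \<in> T \<and> (\<forall>y \<in> N \<inter> T. norm (\<phi> y - \<phi> x) \<le> b * norm (y - x))" if "x \<in> N" for x
        using that lip by (intro exI[of _ UNIV] exI[of _ L]) (auto simp: N_def dist_norm)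
    qed simp
    have "\<phi> ` E \<subseteq> \<phi> ` N \<union> (\<Union>j. B' j)"
    proof
      fix z assume "z \<in> \<phi> ` E"
      then obtain x where x: "x \<in> E" "z = \<phi> x" by blast
      show "z \<in> \<phi> ` N \<union> (\<Union>j. B' j)"
      proof (cases "x \<in> N")
        case False
        then obtain i where i: "i \<in> C" "x \<in> cball (fst i) (snd i)" using x by (auto simp: N_def)
        have j: "to_nat_on C i \<in> J" "c (to_nat_on C i) = i" using i C(1) by (auto simp: J_def c_def)
        have "fst i \<in> E" using i C(2) by (auto simp: K_def)
        then have "dist (\<phi> (fst i)) (\<phi> x) \<le> L * dist (fst i) x" using lip x by blast
        also have "\<dots> \<le> L * snd i" using i(2) L by (intro mult_left_mono) auto
        finally have "z \<in> B' (to_nat_on C i)" using j x by (simp add: B'_def)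
        then show ?thesis by blast
      qed (use x in auto)
    qed
    then have "emeasure lebesgue (\<phi> ` E) \<le> emeasure lebesgue (\<phi> ` N \<union> (\<Union>j. B' j))"
      using negN by (intro emeasure_mono) (auto simp: B'_def negligible_iff_null_sets)
    also have "\<dots> = emeasure lebesgue (\<Union>j. B' j)"
      using negN by (subst Un_commute, intro emeasure_Un_null_set) (auto simp: B'_def negligible_iff_null_sets)
    also have "\<dots> \<le> (\<Sum>j. emeasure lebesgue (B' j))"
      by (intro emeasure_subadditive_countably) (auto simp: B'_def)
    also have "\<dots> = ennreal (L ^ ?n) * (\<Sum>j. emeasure lebesgue (B j))" by (simp add: eB)
    also have "(\<Sum>j. emeasure lebesgue (B j)) = emeasure lebesgue (\<Union>j. B j)"
      by (intro suminf_emeasure dis) (auto simp: B_def)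
    also have "\<dots> \<le> emeasure lebesgue V"
      using cK(3) V(1) by (intro emeasure_mono) (auto simp: B_def split: if_splits)
    finally show ?thesis by (simp add: mult_left_mono)
  qed
  show ?thesis
  proof (rule ennreal_le_epsilon)
    fix e :: real assume e: "0 < e"
    let ?e = "e / L ^ ?n"
    have "0 < ?e" using e L by simp
    then obtain V where V: "open V" "E \<subseteq> V" "emeasure lebesgue (V - E) < ennreal ?e"
      by (rule sets_lebesgue_outer_open[OF E])
    have "emeasure lebesgue V \<le> emeasure lebesgue E + ennreal ?e"
    proof -
      have eq: "E \<union> (V - E) = V" using V(2) by blast
      have "emeasure lebesgue (E \<union> (V - E)) \<le> emeasure lebesgue E + emeasure lebesgue (V - E)"
        by (rule emeasure_subadditive) (use E V(1) in auto)
      then have "emeasure lebesgue V \<le> emeasure lebesgue E + emeasure lebesgue (V - E)"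
        by (simp only: eq)
      also have "\<dots> \<le> emeasure lebesgue E + ennreal ?e"
        using V(3) by (intro add_left_mono less_imp_le)
      finally show ?thesis .
    qed
    then have "ennreal (L ^ ?n) * emeasure lebesgue V \<le> ennreal (L ^ ?n) * (emeasure lebesgue E + ennreal ?e)"
      by (intro mult_left_mono) auto
    with main[OF V(1,2)] have "emeasure lebesgue (\<phi> ` E) \<le> ennreal (L ^ ?n) * (emeasure lebesgue E + ennreal ?e)"
      by (rule order_trans)
    also have "\<dots> = ennreal (L ^ ?n) * emeasure lebesgue E + ennreal e"
      using L e by (simp add: distrib_left ennreal_mult[symmetric])
    finally show "emeasure lebesgue (\<phi> ` E) \<le> ennreal (L ^ ?n) * emeasure lebesgue E + ennreal e" .
  qed
qed

text \<open>
  Uniqueness of Haar measure, for measures that live on an additive subgroup \<open>V\<close>: compute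
  \<open>\<integral>\<integral> 1\<^sub>A(x) 1\<^sub>B(x + y)\<close> in both orders.
\<close>

lemma translation_invariant_emeasure_commute:
  fixes M N :: "'a::euclidean_space measure"
  assumes "sigma_finite_measure M" "sigma_finite_measure N"
    and sets[measurable_cong]: "sets M = sets borel" "sets N = sets borel"
    and V: "AE x in M. x \<in> V" "AE x in N. x \<in> V" "\<And>v. v \<in> V \<Longrightarrow> - v \<in> V"
    and M: "\<And>v. v \<in> V \<Longrightarrow> distr M borel (\<lambda>x. x + v) = M"
    and N: "\<And>v. v \<in> V \<Longrightarrow> distr N borel (\<lambda>x. x + v) = N"
    and A[measurable]: "A \<in> sets borel" and B[measurable]: "B \<in> sets borel"
  shows "emeasure M A * emeasure N B = emeasure M B * emeasure N (uminus -` A)"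
proof -
  interpret pair_sigma_finite M N using assms(1,2) by (rule pair_sigma_finite.intro)
  have shiftM: "(\<integral>\<^sup>+x. g (x + v) \<partial>M) = (\<integral>\<^sup>+x. g x \<partial>M)" if "v \<in> V" "g \<in> borel_measurable borel" for g v
  proof -
    have "(\<integral>\<^sup>+x. g x \<partial>M) = (\<integral>\<^sup>+x. g x \<partial>distr M borel (\<lambda>x. x + v))"
      by (simp only: M[OF that(1)])
    also have "\<dots> = (\<integral>\<^sup>+x. g (x + v) \<partial>M)"
      using that(2) by (intro nn_integral_distr) measurable
    finally show ?thesis by simp
  qed
  have shiftN: "(\<integral>\<^sup>+x. g (x + v) \<partial>N) = (\<integral>\<^sup>+x. g x \<partial>N)" if "v \<in> V" "g \<in> borel_measurable borel" for g v
  proof -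
    have "(\<integral>\<^sup>+x. g x \<partial>N) = (\<integral>\<^sup>+x. g x \<partial>distr N borel (\<lambda>x. x + v))"
      by (simp only: N[OF that(1)])
    also have "\<dots> = (\<integral>\<^sup>+x. g (x + v) \<partial>N)"
      using that(2) by (intro nn_integral_distr) measurable
    finally show ?thesis by simp
  qed
  have m1: "(\<lambda>(x, y). indicator A x * indicator B (x + y) :: ennreal) \<in> borel_measurable (M \<Otimes>\<^sub>M N)"
    by measurable
  have m2: "(\<lambda>(x, y). indicator A (x - y) * indicator B x :: ennreal) \<in> borel_measurable (M \<Otimes>\<^sub>M N)"
    by measurable
  have minusA: "uminus -` A \<in> sets borel"
  proof -
    have "(\<lambda>x. - x) -` A \<inter> space borel \<in> sets borel" by (rule measurable_sets[OF _ A]) measurable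
    then show ?thesis by simp
  qed
  have "emeasure M A * emeasure N B = (\<integral>\<^sup>+x. indicator A x * emeasure N B \<partial>M)"
    by (simp add: nn_integral_multc sets)
  also have "\<dots> = (\<integral>\<^sup>+x. \<integral>\<^sup>+y. indicator A x * indicator B (x + y) \<partial>N \<partial>M)"
  \<comment> \<open>Almost every \<open>x\<close> lies in \<open>V\<close>, so invariance under the
    translation by \<open>x\<close> is available.\<close>
  proof (rule nn_integral_cong_AE, use V(1) in eventually_elim)
    case (elim x)
    have "(\<integral>\<^sup>+y. indicator A x * indicator B (x + y) \<partial>N) = indicator A x * (\<integral>\<^sup>+y. indicator B (y + x) \<partial>N)"
      by (subst nn_integral_cmult) (auto simp: add.commute)
    also have "(\<integral>\<^sup>+y. indicator B (y + x) \<partial>N) = emeasure N B"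
      using shiftN[OF elim, of "indicator B"] by (simp add: sets)
    finally show ?case by simp
  qed
  also have "\<dots> = (\<integral>\<^sup>+y. \<integral>\<^sup>+x. indicator A x * indicator B (x + y) \<partial>M \<partial>N)"
    using Fubini'[OF m1] by simp
  also have "\<dots> = (\<integral>\<^sup>+y. \<integral>\<^sup>+x. indicator A (x - y) * indicator B x \<partial>M \<partial>N)"
  proof (rule nn_integral_cong_AE, use V(2) in eventually_elim)
    case (elim y)
    show ?case using shiftM[OF elim, of "\<lambda>x. indicator A (x - y) * indicator B x"] by simp
  qed
  also have "\<dots> = (\<integral>\<^sup>+x. \<integral>\<^sup>+y. indicator A (x - y) * indicator B x \<partial>N \<partial>M)"
    using Fubini'[OF m2] by simp
  also have "\<dots> = (\<integral>\<^sup>+x. indicator B x * emeasure N (uminus -` A) \<partial>M)"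
  proof (rule nn_integral_cong_AE, use V(1) in eventually_elim)
    case (elim x)
    have "(\<integral>\<^sup>+y. indicator A (x - y) * indicator B x \<partial>N) = (\<integral>\<^sup>+y. indicator A (x - y) \<partial>N) * indicator B x"
      by (subst nn_integral_multc) auto
    also have "(\<integral>\<^sup>+y. indicator A (x - y) \<partial>N) = (\<integral>\<^sup>+y. indicator (uminus -` A) (y + - x) \<partial>N)"
      by (intro nn_integral_cong) (simp add: indicator_def)
    also have "\<dots> = emeasure N (uminus -` A)"
      using shiftN[OF V(3)[OF elim], of "indicator (uminus -` A)"] minusA by (simp add: sets)
    finally show ?case by (simp add: mult.commute)
  qed
  also have "\<dots> = emeasure M B * emeasure N (uminus -` A)"
    by (simp add: nn_integral_multc sets)
  finally show ?thesis .
qed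

text \<open>By Fubini's theorem along rays, some dilate of the set is null.\<close>

lemma null_sets_radial:
  fixes y0 :: "'a::euclidean_space"
  assumes Z: "Z \<in> null_sets lborel"
  shows "{y. dist y y0 \<in> Z} \<in> null_sets lborel"
proof -
  have Zb[measurable]: "Z \<in> sets borel" using Z by auto
  define A where "A = {y. dist y y0 \<in> Z}"
  have Ab[measurable]: "A \<in> sets borel" unfolding A_def by measurable
  \<comment> \<open>For fixed \<open>y\<close> the point \<open>y0 + t *\<^sub>R y\<close> runs
    along a ray and its distance from \<open>y0\<close> is \<open>t * norm y\<close>; for fixed
    \<open>t\<close> the set of \<open>y\<close> is a dilate of \<open>A\<close>. The interval keeps
    \<open>t\<close> away from 0.\<close>
  let ?f = "\<lambda>(y, t). indicator A (y0 + t *\<^sub>R y) * indicator {1..2} t :: ennreal"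
  have m: "?f \<in> borel_measurable (lborel \<Otimes>\<^sub>M lborel)" by measurable
  have "(\<integral>\<^sup>+t. \<integral>\<^sup>+y. ?f (y, t) \<partial>lborel \<partial>lborel) = (\<integral>\<^sup>+y. \<integral>\<^sup>+t. ?f (y, t) \<partial>lborel \<partial>lborel)"
    using lborel_pair.Fubini'[of "\<lambda>y t. indicator A (y0 + t *\<^sub>R y) * indicator {1..2} t"] m by simp
  also have "\<dots> = (\<integral>\<^sup>+(y::'a). 0 \<partial>lborel)"
  proof (rule nn_integral_cong_AE)
    have "AE y in lborel. y \<noteq> (0::'a)" by (rule AE_lborel_singleton)
    then show "AE y in lborel. (\<integral>\<^sup>+t. ?f (y, t) \<partial>lborel) = 0"
    proof eventually_elim
      case (elim y)
      have "AE s in lborel. s \<notin> Z" using Z by (rule AE_not_in)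
      then have "AE s in distr lborel borel (\<lambda>t. 0 + norm y *\<^sub>R t). s \<notin> Z"
        using lborel_affine[of "norm y" "0::real"] elim
        by (subst (asm) lborel_affine[of "norm y" "0::real"]) (auto simp: AE_density)
      then have "AE t in lborel. 0 + norm y *\<^sub>R t \<notin> Z"
        by (subst (asm) AE_distr_iff) auto
      then have "AE t in lborel. ?f (y, t) = 0"
      proof eventually_elim
        case (elim t)
        then show ?case by (auto simp: A_def dist_norm indicator_def mult.commute)
      qed
      then have "(\<integral>\<^sup>+t. ?f (y, t) \<partial>lborel) = (\<integral>\<^sup>+(t::real). 0 \<partial>lborel)" by (intro nn_integral_cong_AE) auto
      then show ?case by simp
    qed
  qed
  finally have "(\<integral>\<^sup>+t. \<integral>\<^sup>+y. ?f (y, t) \<partial>lborel \<partial>lborel) = 0" by simp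
  then have "AE t in lborel. (\<integral>\<^sup>+y. ?f (y, t) \<partial>lborel) = 0"
    by (subst (asm) nn_integral_0_iff_AE) (auto intro!: lborel.borel_measurable_nn_integral)
  \<comment> \<open>The exceptional parameters form a null set, which cannot contain an interval of
    length 1.\<close>
  moreover have "\<not> (AE t in lborel. t \<notin> {1..2::real})"
  proof
    assume "AE t in lborel. t \<notin> {1..2::real}"
    then have "emeasure lborel {1..2::real} = 0"
      by (subst (asm) AE_iff_measurable[where N = "{1..2}"]) auto
    then show False by simp
  qed
  ultimately have "\<not> (\<forall>t. (\<integral>\<^sup>+y. ?f (y, t) \<partial>lborel) = 0 \<longrightarrow> t \<notin> {1..2})"
    using eventually_mono[of "\<lambda>t. (\<integral>\<^sup>+y. ?f (y, t) \<partial>lborel) = 0" "ae_filter lborel" "\<lambda>t. t \<notin> {1..2}"] by blast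
  then obtain t :: real where t: "t \<in> {1..2}" "(\<integral>\<^sup>+y. ?f (y, t) \<partial>lborel) = 0" by blast
  then have "(\<integral>\<^sup>+y. indicator A (y0 + t *\<^sub>R y) \<partial>lborel) = 0" by simp
  then have "emeasure (distr lborel borel (\<lambda>y. y0 + t *\<^sub>R y)) A = 0"
    using nn_integral_distr[of "\<lambda>y. y0 + t *\<^sub>R y" lborel borel "indicator A"] by simp
  moreover have "emeasure lborel A = emeasure (density (distr lborel borel (\<lambda>y. y0 + t *\<^sub>R y)) (\<lambda>_. ennreal (\<bar>t\<bar> ^ DIM('a)))) A"
    using lborel_affine[of t y0] t(1) by simp
  ultimately have "emeasure lborel A = 0"
    by (simp add: emeasure_density_const)
  then show ?thesis unfolding A_def[symmetric] by (intro null_setsI) auto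
qed

section \<open>Sets with finite-to-one null image do not separate\<close>

lemma finite_positive_lower_bound:
  fixes S :: "real set"
  assumes "finite S" "\<And>x. x \<in> S \<Longrightarrow> 0 < x"
  obtains d where "0 < d" "\<And>x. x \<in> S \<Longrightarrow> d \<le> x"
proof (cases "S = {}")
  case True
  then show ?thesis using that[of 1] by simp
next
  case False
  then show ?thesis using that[of "Min S"] assms by simp
qed

text \<open>The fibre over \<open>y\<close> is finite, so small balls about its points are disjoint,
  and by compactness they contain every point whose image is close enough to \<open>y\<close>. There
  \<open>v\<close> replaces \<open>u\<close> by its value at the centre of the ball.\<close>

lemma locally_constant_approximation:
  fixes h :: "'a::metric_space \<Rightarrow> 'b::metric_space" and u :: "'a \<Rightarrow> 'c::real_normed_vector"
  assumes C: "compact C" and h: "continuous_on C h" and u: "continuous_on C u"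
    and fin: "finite {x \<in> C. h x = y}"
  obtains s v V where "0 < s" "finite V" "continuous_on {x \<in> C. dist (h x) y \<le> s} v"
    "\<And>x. \<lbrakk>x \<in> C; dist (h x) y \<le> s\<rbrakk> \<Longrightarrow> v x \<in> V \<and> norm (v x - u x) < 1"
proof -
  define F where "F = {x \<in> C. h x = y}"
  have F: "finite F" using fin by (simp add: F_def)
  have "\<exists>d>0. \<forall>x\<in>C. dist x a < d \<longrightarrow> dist (u x) (u a) < 1" if "a \<in> F" for a
    using u that zero_less_one unfolding continuous_on_iff F_def by blast
  then obtain e where e: "\<And>a. a \<in> F \<Longrightarrow> 0 < e a"
    "\<And>a x. \<lbrakk>a \<in> F; x \<in> C; dist x a < e a\<rbrakk> \<Longrightarrow> dist (u x) (u a) < 1" by metis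
  \<comment> \<open>The radius must respect the continuity of \<open>u\<close> at each fibre point
    and be at most half of every mutual distance.\<close>
  define S where "S = e ` F \<union> (\<lambda>(a, b). dist a b / 2) ` {(a, b) \<in> F \<times> F. a \<noteq> b}"
  have "finite S" unfolding S_def using F
    by (intro finite_UnI finite_imageI) (auto intro: finite_subset[of _ "F \<times> F"])
  moreover have "\<And>x. x \<in> S \<Longrightarrow> 0 < x" using e(1) by (auto simp: S_def)
  ultimately obtain d where d: "0 < d" "\<And>x. x \<in> S \<Longrightarrow> d \<le> x"
    using finite_positive_lower_bound[of S] by metis
  have de: "d \<le> e a" if "a \<in> F" for a using d(2) that by (auto simp: S_def)
  have dd: "2 * d \<le> dist a b" if "a \<in> F" "b \<in> F" "a \<noteq> b" for a b
  proof -
    have "dist a b / 2 \<in> S" unfolding S_def using that by (intro UnI2 image_eqI[of _ _ "(a, b)"]) auto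
    then show ?thesis using d(2) by fastforce
  qed
  define G where "G = C - (\<Union>a\<in>F. ball a d)"
  have "compact G" unfolding G_def using C by (intro compact_diff open_UN) auto
  then have "compact (h ` G)"
    using h by (intro compact_continuous_image) (auto intro: continuous_on_subset simp: G_def)
  then have "open (- (h ` G))" using compact_imp_closed by auto
  moreover have "y \<in> - (h ` G)" using d(1) by (auto simp: G_def F_def)
  ultimately obtain s where s: "0 < s" "cball y s \<subseteq> - (h ` G)" using open_contains_cball by blast
  define T where "T = {x \<in> C. dist (h x) y \<le> s}"
  have T: "\<exists>a\<in>F. dist x a < d" if "x \<in> T" for x
  proof -
    have "x \<notin> G" using that s(2) by (auto simp: T_def dist_commute)
    then show ?thesis using that by (auto simp: G_def T_def dist_commute)
  qed
  define p where "p x = (SOME a. a \<in> F \<and> dist x a < d)" for x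
  have p: "p x \<in> F" "dist x (p x) < d" if "x \<in> T" for x
    using someI_ex[of "\<lambda>a. a \<in> F \<and> dist x a < d"] T[OF that] unfolding p_def by auto
  have p_unique: "p x = a" if "x \<in> T" "a \<in> F" "dist x a < d" for x a
  proof (rule ccontr)
    assume "p x \<noteq> a"
    then have "2 * d \<le> dist (p x) a" using dd p(1)[OF that(1)] that(2) by blast
    then show False using p(2)[OF that(1)] that(3) dist_triangle2[of "p x" a x]
      by (simp add: dist_commute)
  qed
  show thesis
  proof (rule that[of s "u ` F" "\<lambda>x. u (p x)"])
    show "0 < s" by (rule s)
    show "finite (u ` F)" using F by simp
    show "continuous_on {x \<in> C. dist (h x) y \<le> s} (\<lambda>x. u (p x))"
      unfolding T_def[symmetric] continuous_on_iff
    proof (intro ballI allI impI)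
      fix x and e :: real assume x: "x \<in> T" and "0 < e"
      have "dist (u (p z)) (u (p x)) < e" if "z \<in> T" "dist z x < d - dist x (p x)" for z
      proof -
        have "dist z (p x) < d" using that(2) dist_triangle[of z "p x" x] by linarith
        then have "p z = p x" using p_unique that(1) p(1)[OF x] by blast
        then show ?thesis using \<open>0 < e\<close> by simp
      qed
      then show "\<exists>d>0. \<forall>x'\<in>T. dist x' x < d \<longrightarrow> dist (u (p x')) (u (p x)) < e"
        using p(2)[OF x] by (intro exI[of _ "d - dist x (p x)"]) auto
    qed
    show "u (p x) \<in> u ` F \<and> norm (u (p x) - u x) < 1" if "x \<in> C" "dist (h x) y \<le> s" for x
    proof -
      have x: "x \<in> T" using that by (simp add: T_def)
      have "dist x (p x) < e (p x)" using p[OF x] de[of "p x"] by simp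
      then have "dist (u x) (u (p x)) < 1" using e(2) p(1)[OF x] that(1) by blast
      then show ?thesis using p(1)[OF x] by (auto simp: dist_norm norm_minus_commute)
    qed
  qed
qed

text \<open>The straight-line homotopy avoids the origin and can be projected radially to the
  sphere.\<close>

lemma homotopic_normalize:
  fixes p q :: "'a::topological_space \<Rightarrow> 'b::euclidean_space"
  assumes "continuous_on C p" "continuous_on C q"
    and "\<And>x. x \<in> C \<Longrightarrow> 0 \<notin> closed_segment (p x) (q x)"
  shows "homotopic_with_canon (\<lambda>x. True) C (sphere 0 1) (\<lambda>x. p x /\<^sub>R norm (p x)) (\<lambda>x. q x /\<^sub>R norm (q x))"
proof -
  have 1: "homotopic_with_canon (\<lambda>x. True) C (- {0}) p q"
    using assms by (intro homotopic_with_linear) auto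
  have "homotopic_with_canon (\<lambda>x. True) C (sphere 0 1) ((\<lambda>z. z /\<^sub>R norm z) \<circ> p) ((\<lambda>z. z /\<^sub>R norm z) \<circ> q)"
    by (rule homotopic_with_compose_continuous_left[OF 1]) (auto intro!: continuous_intros)
  then show ?thesis by (simp add: o_def)
qed

text \<open>
  The set \<open>C\<close> is tested with Borsuk's separation theorem. A map \<open>u\<close> to the sphere is homotopic to a
  map \<open>\<Psi> / \<bar>\<Psi>\<bar>\<close>, where \<open>\<Psi>\<close> has, up to finitely many choices, the form \<open>\<Theta> \<circ> h\<close> with \<open>\<Theta>\<close> Lipschitz.
  The cone over the image of \<open>\<Psi>\<close> is then Lebesgue null, so \<open>\<Psi> / \<bar>\<Psi>\<bar>\<close> is not onto the sphere.
\<close>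

lemma connected_complement_finite_fibres_null_image:
  fixes h :: "'a::euclidean_space \<Rightarrow> 'b::metric_space"
  assumes C: "compact C" and h: "continuous_on C h" and fin: "\<And>y. finite {x \<in> C. h x = y}"
    and null: "hausdorff_outer k (h ` C) = 0" and k: "0 < k" "DIM('a) = Suc k"
  shows "connected (- C)"
proof -
  have "\<exists>c. homotopic_with_canon (\<lambda>x. True) C (sphere 0 1) u (\<lambda>x. c)"
    if u: "continuous_on C u" and us: "u \<in> C \<rightarrow> sphere (0::'a) 1" for u
  proof -
    have nu: "norm (u x) = 1" if "x \<in> C" for x using us that by auto
    define K where "K = h ` C"
    have "\<forall>y. \<exists>s v V. 0 < s \<and> finite V \<and> continuous_on {x \<in> C. dist (h x) y \<le> s} v \<and>
      (\<forall>x. x \<in> C \<and> dist (h x) y \<le> s \<longrightarrow> v x \<in> V \<and> norm (v x - u x) < 1)"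
    proof
      fix y show "\<exists>s v V. 0 < s \<and> finite V \<and> continuous_on {x \<in> C. dist (h x) y \<le> s} v \<and>
          (\<forall>x. x \<in> C \<and> dist (h x) y \<le> s \<longrightarrow> v x \<in> V \<and> norm (v x - u x) < 1)"
        by (rule locally_constant_approximation[OF C h u fin[of y]]) blast
    qed
    from choice[OF this] obtain s where "\<forall>y. \<exists>v V. 0 < s y \<and> finite V \<and>
      continuous_on {x \<in> C. dist (h x) y \<le> s y} v \<and>
      (\<forall>x. x \<in> C \<and> dist (h x) y \<le> s y \<longrightarrow> v x \<in> V \<and> norm (v x - u x) < 1)" ..
    from choice[OF this] obtain v where "\<forall>y. \<exists>V. 0 < s y \<and> finite V \<and>
      continuous_on {x \<in> C. dist (h x) y \<le> s y} (v y) \<and>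
      (\<forall>x. x \<in> C \<and> dist (h x) y \<le> s y \<longrightarrow> v y x \<in> V \<and> norm (v y x - u x) < 1)" ..
    from choice[OF this] obtain V where svV: "\<forall>y. 0 < s y \<and> finite (V y) \<and>
      continuous_on {x \<in> C. dist (h x) y \<le> s y} (v y) \<and>
      (\<forall>x. x \<in> C \<and> dist (h x) y \<le> s y \<longrightarrow> v y x \<in> V y \<and> norm (v y x - u x) < 1)" ..
    have s: "0 < s y" and V: "finite (V y)" and vc: "continuous_on {x \<in> C. dist (h x) y \<le> s y} (v y)"
      and v: "\<And>x. \<lbrakk>x \<in> C; dist (h x) y \<le> s y\<rbrakk> \<Longrightarrow> v y x \<in> V y \<and> norm (v y x - u x) < 1" for y
      using spec[OF svV, of y] by blast+
    have Kc: "compact K" unfolding K_def using h C by (rule compact_continuous_image)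
    obtain Y where Y: "Y \<subseteq> K" "finite Y" "K \<subseteq> (\<Union>y\<in>Y. ball y (s y))"
      by (rule compactE_image[OF Kc, of K "\<lambda>y. ball y (s y)"]) (use s in force)+
    \<comment> \<open>The value 0 outside the domain of \<open>v y\<close> creates no discontinuity
      in \<Psi>, since the weight \<open>w y\<close> vanishes from distance \<open>s y\<close>
      on.\<close>
    define g where "g y x = (if dist (h x) y \<le> s y then v y x else 0)" for y x
    define w where "w y z = max 0 (s y - dist z y)" for y z
    \<comment> \<open>Weights as in a partition of unity, but not normalized: only the direction of
      \<Psi> matters, and without a division the dependence on \<open>h x\<close> is visibly
      Lipschitz.\<close>
    define \<Psi> where "\<Psi> x = (\<Sum>y\<in>Y. w y (h x) *\<^sub>R g y x)" for x
    have cterm: "continuous_on C (\<lambda>x. w y (h x) *\<^sub>R g y x)" for y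
    proof -
      have "continuous_on C (\<lambda>x. if dist (h x) y \<le> s y then w y (h x) *\<^sub>R v y x else 0)"
      proof (rule continuous_on_cases_le)
        show "continuous_on {t \<in> C. dist (h t) y \<le> s y} (\<lambda>x. w y (h x) *\<^sub>R v y x)"
          unfolding w_def using h vc[of y] by (intro continuous_intros) (auto intro: continuous_on_subset)
        show "continuous_on C (\<lambda>t. dist (h t) y)" using h by (intro continuous_intros)
      qed (auto simp: w_def)
      then show ?thesis by (rule continuous_on_eq) (auto simp: g_def)
    qed
    have \<Psi>c: "continuous_on C \<Psi>" unfolding \<Psi>_def by (intro continuous_on_sum cterm)
    \<comment> \<open>Every local approximation lies within distance less than 1 of the unit vector
      \<open>u x\<close>, so all contributions point into the same open half space and cannot
      cancel.\<close>
    have inner: "0 < \<Psi> x \<bullet> u x" if x: "x \<in> C" for x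
    proof -
      obtain y where y: "y \<in> Y" "h x \<in> ball y (s y)" using Y(3) x by (auto simp: K_def)
      have vu: "0 < v y x \<bullet> u x" if "dist (h x) y \<le> s y" for y
      proof -
        have "v y x \<bullet> u x = u x \<bullet> u x + (v y x - u x) \<bullet> u x" by (simp add: inner_diff_left)
        moreover have "u x \<bullet> u x = 1" using nu[OF x] by (simp add: dot_square_norm)
        moreover have "\<bar>(v y x - u x) \<bullet> u x\<bar> \<le> norm (v y x - u x) * norm (u x)"
          by (rule Cauchy_Schwarz_ineq2)
        ultimately show ?thesis using v[OF x that] nu[OF x] by auto
      qed
      have "0 < (\<Sum>y\<in>Y. w y (h x) * (g y x \<bullet> u x))"
      proof (rule sum_pos2[OF Y(2) y(1)])
        have "dist (h x) y < s y" using y(2) by (simp add: dist_commute)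
        then show "0 < w y (h x) * (g y x \<bullet> u x)"
          using vu[of y] by (simp add: w_def g_def)
        show "0 \<le> w y (h x) * (g y x \<bullet> u x)" if "y \<in> Y" for y
          using vu[of y] by (cases "dist (h x) y \<le> s y") (simp_all add: w_def g_def)
      qed
      then show ?thesis by (simp add: \<Psi>_def inner_sum_left)
    qed
    define \<Theta> where "\<Theta> \<phi> z = (\<Sum>y\<in>Y. w y z *\<^sub>R \<phi> y)" for \<phi> :: "'b \<Rightarrow> 'a" and z
    \<comment> \<open>At each \<open>x\<close> the vector \<Psi> x is a combination of fixed
      Lipschitz weights of \<open>h x\<close> with coefficients from finite sets. Only finitely many
      functions of \<open>h x\<close> therefore occur.\<close>
    define Fns where "Fns = PiE Y (\<lambda>y. insert 0 (V y))"
    have finF: "finite Fns" unfolding Fns_def using Y(2) V by (intro finite_PiE) auto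
    have \<Psi>\<Theta>: "\<exists>\<phi>\<in>Fns. \<Psi> x = \<Theta> \<phi> (h x)" if "x \<in> C" for x
    proof (intro bexI)
      show "restrict (\<lambda>y. g y x) Y \<in> Fns"
        using v that by (auto simp: Fns_def g_def)
      show "\<Psi> x = \<Theta> (restrict (\<lambda>y. g y x) Y) (h x)" by (simp add: \<Psi>_def \<Theta>_def)
    qed
    have cone: "negligible (\<Union>z\<in>K. (\<lambda>t. t *\<^sub>R \<Theta> \<phi> z) ` {0..1})" for \<phi>
    proof (rule lipschitz_cylinder_null[OF _ k, where L = "\<Sum>y\<in>Y. (1 + s y) * norm (\<phi> y)"])
      show "hausdorff_outer k K = 0" using null by (simp add: K_def)
      fix z z' and t t' :: real assume "t \<in> {0..1}" "t' \<in> {0..1}"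
      have "norm (\<Theta> \<phi> z) \<le> (\<Sum>y\<in>Y. norm (w y z *\<^sub>R \<phi> y))" unfolding \<Theta>_def by (rule norm_sum)
      also have "\<dots> \<le> (\<Sum>y\<in>Y. s y * norm (\<phi> y))"
        using s by (intro sum_mono) (auto simp: w_def intro!: mult_right_mono less_imp_le[OF s])
      also have "\<dots> \<le> (\<Sum>y\<in>Y. (1 + s y) * norm (\<phi> y))"
        by (intro sum_mono mult_right_mono) auto
      finally have a: "norm (\<Theta> \<phi> z) \<le> (\<Sum>y\<in>Y. (1 + s y) * norm (\<phi> y))" .
      have "\<Theta> \<phi> z - \<Theta> \<phi> z' = (\<Sum>y\<in>Y. (w y z - w y z') *\<^sub>R \<phi> y)"
        by (simp add: \<Theta>_def sum_subtractf scaleR_diff_left)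
      then have "norm (\<Theta> \<phi> z - \<Theta> \<phi> z') \<le> (\<Sum>y\<in>Y. norm ((w y z - w y z') *\<^sub>R \<phi> y))"
        by (simp only: norm_sum)
      also have "\<dots> \<le> (\<Sum>y\<in>Y. ((1 + s y) * norm (\<phi> y)) * dist z z')"
      proof (rule sum_mono)
        fix y
        have "\<bar>w y z - w y z'\<bar> \<le> dist z z'"
          using dist_triangle[of z y z'] dist_triangle[of z' y z] dist_commute[of z' z]
          by (auto simp: w_def max_def abs_le_iff)
        then have "\<bar>w y z - w y z'\<bar> * norm (\<phi> y) \<le> dist z z' * norm (\<phi> y)"
          by (intro mult_right_mono) auto
        also have "\<dots> \<le> (1 + s y) * (norm (\<phi> y) * dist z z')"
          using s[of y] by (auto simp: algebra_simps)
        finally show "norm ((w y z - w y z') *\<^sub>R \<phi> y) \<le> ((1 + s y) * norm (\<phi> y)) * dist z z'"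
          by (simp add: mult.assoc)
      qed
      also have "\<dots> = (\<Sum>y\<in>Y. (1 + s y) * norm (\<phi> y)) * dist z z'" by (simp add: sum_distrib_right)
      finally have b: "norm (\<Theta> \<phi> z - \<Theta> \<phi> z') \<le> (\<Sum>y\<in>Y. (1 + s y) * norm (\<phi> y)) * dist z z'" .
      have "t *\<^sub>R \<Theta> \<phi> z - t' *\<^sub>R \<Theta> \<phi> z' = (t - t') *\<^sub>R \<Theta> \<phi> z + t' *\<^sub>R (\<Theta> \<phi> z - \<Theta> \<phi> z')"
        by (simp add: algebra_simps)
      then have "dist (t *\<^sub>R \<Theta> \<phi> z) (t' *\<^sub>R \<Theta> \<phi> z') \<le> \<bar>t - t'\<bar> * norm (\<Theta> \<phi> z) + \<bar>t'\<bar> * norm (\<Theta> \<phi> z - \<Theta> \<phi> z')"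
        by (metis dist_norm norm_scaleR norm_triangle_ineq)
      also have "\<dots> \<le> \<bar>t - t'\<bar> * (\<Sum>y\<in>Y. (1 + s y) * norm (\<phi> y)) + 1 * ((\<Sum>y\<in>Y. (1 + s y) * norm (\<phi> y)) * dist z z')"
        using \<open>t' \<in> {0..1}\<close> by (intro add_mono mult_mono a b mult_left_mono) auto
      also have "\<dots> = (\<Sum>y\<in>Y. (1 + s y) * norm (\<phi> y)) * (dist z z' + \<bar>t - t'\<bar>)"
        by (simp add: algebra_simps)
      finally show "dist (t *\<^sub>R \<Theta> \<phi> z) (t' *\<^sub>R \<Theta> \<phi> z') \<le> (\<Sum>y\<in>Y. (1 + s y) * norm (\<phi> y)) * (dist z z' + \<bar>t - t'\<bar>)" .
    qed
    define N where "N = (\<Union>\<phi>\<in>Fns. \<Union>z\<in>K. (\<lambda>t. t *\<^sub>R \<Theta> \<phi> z) ` {0..1})"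
    have N: "negligible N" unfolding N_def using finF cone by (intro negligible_Union finite_imageI) auto
    have inN: "t *\<^sub>R \<Psi> x \<in> N" if "x \<in> C" "t \<in> {0..1}" for x t
      using \<Psi>\<Theta>[OF that(1)] that unfolding N_def K_def by fastforce
    have ne0: "\<Psi> x \<noteq> 0" if "x \<in> C" for x using inner[OF that] by auto
    \<comment> \<open>If \<Psi> took every direction, the segments from 0 to its values would fill a
      ball of radius the minimum of |\<Psi>|, contrary to the cone being null.\<close>
    have "\<exists>e. norm e = 1 \<and> (\<forall>x\<in>C. \<Psi> x \<noteq> norm (\<Psi> x) *\<^sub>R e)"
    proof (cases "C = {}")
      case True
      then show ?thesis using vector_choose_size[of 1] by auto
    next
      case False
      then obtain x0 where x0: "x0 \<in> C" "\<And>x. x \<in> C \<Longrightarrow> norm (\<Psi> x0) \<le> norm (\<Psi> x)"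
        using continuous_attains_inf[OF C, of "\<lambda>x. norm (\<Psi> x)"] \<Psi>c by (auto intro: continuous_on_norm)
      show ?thesis
      proof (rule ccontr)
        assume neg: "\<not> ?thesis"
        have "ball 0 (norm (\<Psi> x0)) \<subseteq> N"
        proof
          fix z :: 'a assume z: "z \<in> ball 0 (norm (\<Psi> x0))"
          show "z \<in> N"
          proof (cases "z = 0")
            case True
            then show ?thesis using inN[OF x0(1), of 0] by simp
          next
            case False
            then have "norm (z /\<^sub>R norm z) = 1" by simp
            then obtain x where x: "x \<in> C" "\<Psi> x = norm (\<Psi> x) *\<^sub>R (z /\<^sub>R norm z)" using neg by blast
            define t where "t = norm z / norm (\<Psi> x)"
            have "t \<in> {0..1}" using z x0(2)[OF x(1)] ne0[OF x(1)] by (auto simp: t_def divide_le_eq_1)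
            moreover have "t *\<^sub>R \<Psi> x = z"
              by (subst x(2)) (use False ne0[OF x(1)] in \<open>simp add: t_def\<close>)
            ultimately show ?thesis using inN[OF x(1), of t] by simp
          qed
        qed
        then have "negligible (ball (0::'a) (norm (\<Psi> x0)))" using N negligible_subset by blast
        then show False using ne0[OF x0(1)] open_not_negligible[of "ball (0::'a) (norm (\<Psi> x0))"] by simp
      qed
    qed
    then obtain e where e: "norm e = 1" "\<And>x. x \<in> C \<Longrightarrow> \<Psi> x \<noteq> norm (\<Psi> x) *\<^sub>R e" by blast
    have "homotopic_with_canon (\<lambda>x. True) C (sphere 0 1) (\<lambda>x. u x /\<^sub>R norm (u x)) (\<lambda>x. \<Psi> x /\<^sub>R norm (\<Psi> x))"
    proof (rule homotopic_normalize[OF u \<Psi>c], rule notI)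
      fix x assume x: "x \<in> C" and "0 \<in> closed_segment (u x) (\<Psi> x)"
      then obtain t where t: "0 \<le> t" "t \<le> 1" "0 = (1 - t) *\<^sub>R u x + t *\<^sub>R \<Psi> x" by (auto simp: closed_segment_def)
      then have "0 = ((1 - t) *\<^sub>R u x + t *\<^sub>R \<Psi> x) \<bullet> u x" by simp
      also have "\<dots> = (1 - t) * 1 + t * (\<Psi> x \<bullet> u x)"
        using nu[OF x] by (simp add: inner_add_left dot_square_norm)
      finally have "0 = (1 - t) + t * (\<Psi> x \<bullet> u x)" by simp
      moreover have "0 < (1 - t) + t * (\<Psi> x \<bullet> u x)"
        using t(1,2) inner[OF x] by (cases "t = 0") (auto intro: add_nonneg_pos)
      ultimately show False by simp
    qed
    then have 1: "homotopic_with_canon (\<lambda>x. True) C (sphere 0 1) u (\<lambda>x. \<Psi> x /\<^sub>R norm (\<Psi> x))"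
      by (rule homotopic_with_eq) (auto simp: nu)
    \<comment> \<open>Since \<Psi> x is never a positive multiple of \<open>e\<close>, the segment
      from \<Psi> x to \<open>- e\<close> misses 0, and the normalized map contracts to a
      constant.\<close>
    have 2: "homotopic_with_canon (\<lambda>x. True) C (sphere 0 1) (\<lambda>x. \<Psi> x /\<^sub>R norm (\<Psi> x)) (\<lambda>x. (- e) /\<^sub>R norm (- e))"
    proof (rule homotopic_normalize[OF \<Psi>c continuous_on_const], rule notI)
      fix x assume x: "x \<in> C" and "0 \<in> closed_segment (\<Psi> x) (- e)"
      then obtain t where t: "0 \<le> t" "t \<le> 1" "0 = (1 - t) *\<^sub>R \<Psi> x + t *\<^sub>R (- e)" by (auto simp: closed_segment_def)
      then have eq: "(1 - t) *\<^sub>R \<Psi> x = t *\<^sub>R e" by simp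
      show False
      proof (cases "t = 1")
        case True
        then show False using eq e(1) by auto
      next
        case False
        have "norm ((1 - t) *\<^sub>R \<Psi> x) = t" using eq t e(1) by simp
        then have "(1 - t) * norm (\<Psi> x) = t" using t by simp
        then have "(1 - t) *\<^sub>R \<Psi> x = (1 - t) *\<^sub>R (norm (\<Psi> x) *\<^sub>R e)" using eq by simp
        then have "1 - t = 0 \<or> \<Psi> x = norm (\<Psi> x) *\<^sub>R e"
          unfolding scaleR_cancel_left by blast
        then show False using False e(2)[OF x] by auto
      qed
    qed
    show ?thesis using homotopic_with_trans[OF 1 2] by blast
  qed
  then show ?thesis using Borsuk_separation_theorem[OF C] k by auto
qed

text \<open>
  The two sides of the level set \<open>{x \<in> D. dist (f x) y0 = r}\<close> come together inside a small ball about a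
  point \<open>c\<close>. Folding the outside into this ball by an inversion \<open>\<phi>\<close> pulls the level set back to a compact
  set \<open>C\<close> that separates the space, whereas a null slice would leave the complement of \<open>C\<close> connected.
\<close>

lemma sphere_slice_hausdorff_nonnull:
  fixes f :: "'a::euclidean_space \<Rightarrow> 'b::metric_space"
  assumes D: "open D" "connected D" and f: "continuous_on D f"
    and fin: "\<And>y. finite {x \<in> D. f x = y}" and k: "0 < k" "DIM('a) = Suc k"
    and a: "a \<in> D" "dist (f a) y0 < r" and b: "b \<in> D" "r < dist (f b) y0"
  shows "hausdorff_outer k (sphere y0 r \<inter> f ` D) \<noteq> 0"
proof
  assume null: "hausdorff_outer k (sphere y0 r \<inter> f ` D) = 0"
  define g where "g x = dist (f x) y0" for x
  have g: "continuous_on D g" unfolding g_def by (intro continuous_intros f)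
  define Dm where "Dm = D \<inter> g -` {..<r}"
  define Dp where "Dp = D \<inter> g -` {r<..}"
  have open_Dm: "open Dm" and open_Dp: "open Dp" unfolding Dm_def Dp_def
    using g D(1) by (auto intro: continuous_open_preimage)
  have disj: "Dm \<inter> Dp = {}" by (auto simp: Dm_def Dp_def)
  \<comment> \<open>The level set has empty interior: otherwise it would contain a small round
    sphere, and the sphere, having a null image, could not separate the space.\<close>
  have empty_int: False if c: "0 < \<delta>" "cball c \<delta> \<subseteq> D" "\<And>x. x \<in> cball c \<delta> \<Longrightarrow> g x = r" for c \<delta>
  proof -
    have sub: "sphere c \<delta> \<subseteq> D" using c(2) by auto
    have "connected (- sphere c \<delta>)"
    proof (rule connected_complement_finite_fibres_null_image[OF _ _ _ _ k])
      show "continuous_on (sphere c \<delta>) f" using f sub continuous_on_subset by blast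
      show "finite {x \<in> sphere c \<delta>. f x = y}" for y
        by (rule finite_subset[OF _ fin[of y]]) (use sub in auto)
      show "hausdorff_outer k (f ` sphere c \<delta>) = 0"
        by (rule hausdorff_outer_null_subset[OF null])
          (use sub c(3) in \<open>auto simp: g_def dist_commute\<close>)
    qed simp
    moreover have "ball c \<delta> \<inter> - cball c \<delta> \<inter> - sphere c \<delta> = {}" "- sphere c \<delta> \<subseteq> ball c \<delta> \<union> - cball c \<delta>" by auto
    moreover have "c \<in> ball c \<delta> \<inter> - sphere c \<delta>" using c(1) by simp
    moreover have "- cball c \<delta> \<inter> - sphere c \<delta> \<noteq> {}"
    proof -
      obtain e :: 'a where "norm e = 2 * \<delta>" using vector_choose_size[of "2 * \<delta>"] c(1) by auto
      then have "c + e \<in> - cball c \<delta> \<inter> - sphere c \<delta>" using c(1) by (simp add: dist_norm)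
      then show ?thesis by blast
    qed
    ultimately have "ball c \<delta> \<inter> - sphere c \<delta> = {} \<or> - cball c \<delta> \<inter> - sphere c \<delta> = {}"
      by (intro connectedD) auto
    then show False
      using \<open>c \<in> ball c \<delta> \<inter> - sphere c \<delta>\<close> \<open>- cball c \<delta> \<inter> - sphere c \<delta> \<noteq> {}\<close> by blast
  qed
  have cover: "D \<subseteq> closure Dm \<union> closure Dp"
  proof (rule subsetI, rule ccontr)
    fix x assume x: "x \<in> D" "x \<notin> closure Dm \<union> closure Dp"
    then have "open (D - (closure Dm \<union> closure Dp))" "x \<in> D - (closure Dm \<union> closure Dp)"
      using D(1) by (auto intro: open_Diff)
    then obtain \<delta> where "0 < \<delta>" "cball x \<delta> \<subseteq> D - (closure Dm \<union> closure Dp)"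
      using open_contains_cball by blast
    moreover have "g z = r" if "z \<in> D - (closure Dm \<union> closure Dp)" for z
    proof -
      have "z \<notin> Dm" "z \<notin> Dp" using that closure_subset by blast+
      then show ?thesis using that by (auto simp: Dm_def Dp_def)
    qed
    ultimately show False using empty_int by blast
  qed
  have ab: "a \<in> Dm" "b \<in> Dp" using a b by (auto simp: Dm_def Dp_def g_def)
  have "closure Dm \<inter> closure Dp \<inter> D \<noteq> {}"
  proof
    assume "closure Dm \<inter> closure Dp \<inter> D = {}"
    moreover have "a \<in> closure Dm \<inter> D" "b \<in> closure Dp \<inter> D" using ab a b closure_subset by blast+
    ultimately show False
      using D(2)[unfolded connected_closed] cover closed_closure by blast
  qed
  then obtain z where z: "z \<in> D" "z \<in> closure Dm" "z \<in> closure Dp" by blast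
  obtain \<rho> where \<rho>: "0 < \<rho>" "cball z \<rho> \<subseteq> D" using D(1) z(1) open_contains_cball by blast
  define \<delta> where "\<delta> = \<rho> / 2"
  have \<delta>: "0 < \<delta>" using \<rho> by (simp add: \<delta>_def)
  obtain c where c: "c \<in> Dm" "dist c z < \<delta> / 2" using z(2) \<delta> unfolding closure_approachable by (metis half_gt_zero)
  obtain b' where b': "b' \<in> Dp" "dist b' z < \<delta> / 2" using z(3) \<delta> unfolding closure_approachable by (metis half_gt_zero)
  have cb: "dist b' c < \<delta>" using c(2) b'(2) dist_triangle2[of b' c z] by linarith
  have cD: "cball c \<delta> \<subseteq> D"
  proof
    fix x assume "x \<in> cball c \<delta>"
    then have "dist c x \<le> \<rho> / 2" by (simp add: \<delta>_def)
    then have "dist z x \<le> \<rho>"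
      using c(2) \<rho>(1) dist_triangle[of z x c] dist_commute[of z c] unfolding \<delta>_def by linarith
    then show "x \<in> D" using \<rho>(2) by auto
  qed
  \<comment> \<open>The maximum makes one formula serve both as the identity inside the ball and as
    the inversion in its boundary sphere outside.\<close>
  define \<phi> where "\<phi> x = c + (\<delta> / max \<delta> (dist x c))\<^sup>2 *\<^sub>R (x - c)" for x
  have \<phi>_in: "\<phi> x = x" if "dist x c \<le> \<delta>" for x
    using that \<delta> by (simp add: \<phi>_def max_def)
  have \<phi>_out: "\<phi> x = c + (\<delta> / dist x c)\<^sup>2 *\<^sub>R (x - c)" "dist (\<phi> x) c = \<delta>\<^sup>2 / dist x c" if "\<delta> < dist x c" for x
  proof -
    show 1: "\<phi> x = c + (\<delta> / dist x c)\<^sup>2 *\<^sub>R (x - c)" using that by (simp add: \<phi>_def max_def)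
    have "0 < dist x c" using that \<delta> by linarith
    then show "dist (\<phi> x) c = \<delta>\<^sup>2 / dist x c"
      unfolding 1 by (simp add: dist_norm power2_eq_square)
  qed
  have \<phi>_cball: "\<phi> x \<in> cball c \<delta>" for x
  proof (cases "dist x c \<le> \<delta>")
    case True
    then show ?thesis using \<phi>_in by (simp add: dist_commute)
  next
    case False
    then have "\<delta> * \<delta> \<le> \<delta> * dist x c" "0 < dist x c" using \<delta> by (auto intro: mult_left_mono)
    then have "\<delta>\<^sup>2 / dist x c \<le> \<delta>" by (simp add: power2_eq_square pos_divide_le_eq)
    then show ?thesis using \<phi>_out(2)[of x] False by (simp add: dist_commute)
  qed
  have \<phi>c: "continuous_on UNIV \<phi>" unfolding \<phi>_def using \<delta> by (intro continuous_intros) auto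
  have \<phi>D: "\<phi> x \<in> D" for x using \<phi>_cball cD by blast
  define C where "C = {x. g (\<phi> x) = r}"
  have g\<phi>: "continuous_on UNIV (\<lambda>x. g (\<phi> x))"
    by (rule continuous_on_compose2[OF g \<phi>c]) (use \<phi>D in auto)
  have "closed C" unfolding C_def
    by (rule closed_Collect_eq[OF g\<phi> continuous_on_const])
  \<comment> \<open>Far away points are sent close to \<open>c\<close>, hence into the open set
    \<open>Dm\<close>, which is disjoint from the level set.\<close>
  moreover have "bounded C"
  proof -
    obtain \<tau> where \<tau>: "0 < \<tau>" "ball c \<tau> \<subseteq> Dm" using open_Dm c(1) open_contains_ball by blast
    have "dist c x \<le> max \<delta> (\<delta>\<^sup>2 / \<tau>)" if x: "x \<in> C" for x
    proof (cases "dist x c \<le> \<delta>")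
      case False
      then have "0 < dist x c" using \<delta> by linarith
      have "\<phi> x \<notin> Dm" using x by (auto simp: C_def Dm_def)
      then have "\<tau> \<le> dist (\<phi> x) c" using \<tau>(2) by (force simp: dist_commute)
      then have "\<tau> \<le> \<delta>\<^sup>2 / dist x c" using \<phi>_out(2)[of x] False by simp
      then show ?thesis using \<open>0 < dist x c\<close> \<tau>(1)
        by (simp add: pos_le_divide_eq dist_commute mult.commute le_max_iff_disj)
    qed (simp add: dist_commute le_max_iff_disj)
    then show ?thesis unfolding bounded_def by blast
  qed
  ultimately have "compact C" by (simp add: compact_eq_bounded_closed)
  \<comment> \<open>A point has at most two preimages: itself and its mirror image, the inversion
    being its own inverse. So the composite with \<open>f\<close> keeps finite fibres.\<close>
  have fib: "finite {x. \<phi> x = w}" for w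
  proof (rule finite_subset)
    show "{x. \<phi> x = w} \<subseteq> {w, c + (\<delta> / dist w c)\<^sup>2 *\<^sub>R (w - c)}"
    proof
      fix x assume "x \<in> {x. \<phi> x = w}"
      then have w: "w = \<phi> x" by simp
      show "x \<in> {w, c + (\<delta> / dist w c)\<^sup>2 *\<^sub>R (w - c)}"
      proof (cases "dist x c \<le> \<delta>")
        case False
        then have pos: "0 < dist x c" using \<delta> by linarith
        have "dist w c = \<delta>\<^sup>2 / dist x c" "w - c = (\<delta> / dist x c)\<^sup>2 *\<^sub>R (x - c)"
          using \<phi>_out[of x] False w by auto
        then have "(\<delta> / dist w c)\<^sup>2 *\<^sub>R (w - c) = x - c"
          using pos \<delta> by (simp add: power2_eq_square)
        then show ?thesis by simp
      qed (use \<phi>_in w in simp)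
    qed
  qed simp
  have "connected (- C)"
  proof (rule connected_complement_finite_fibres_null_image[OF \<open>compact C\<close> _ _ _ k])
    show "continuous_on C (\<lambda>x. f (\<phi> x))"
      by (rule continuous_on_compose2[OF f continuous_on_subset[OF \<phi>c]]) (use \<phi>D in auto)
    show "finite {x \<in> C. f (\<phi> x) = y}" for y
    proof (rule finite_subset)
      show "{x \<in> C. f (\<phi> x) = y} \<subseteq> (\<Union>w\<in>{x \<in> D. f x = y}. {x. \<phi> x = w})" using \<phi>D by auto
      show "finite (\<Union>w\<in>{x \<in> D. f x = y}. {x. \<phi> x = w})" using fin fib by blast
    qed
    show "hausdorff_outer k ((\<lambda>x. f (\<phi> x)) ` C) = 0"
      by (rule hausdorff_outer_null_subset[OF null])
        (use \<phi>D in \<open>auto simp: C_def g_def dist_commute\<close>)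
  qed
  \<comment> \<open>This connected set meets both \<open>Dm\<close> and \<open>Dp\<close>, at the
    points \<open>c\<close> and \<open>b'\<close> fixed by \<phi>, although it lies in their
    disjoint union.\<close>
  then have "connected (\<phi> ` (- C))"
    using \<phi>c by (intro connected_continuous_image) (auto intro: continuous_on_subset)
  moreover have "\<phi> ` (- C) \<subseteq> Dm \<union> Dp" using \<phi>D by (auto simp: C_def Dm_def Dp_def)
  moreover have "c \<in> Dm \<inter> \<phi> ` (- C)"
  proof -
    have "\<phi> c = c" using \<phi>_in[of c] \<delta> by simp
    moreover have "c \<in> - C" using c(1) \<open>\<phi> c = c\<close> by (auto simp: C_def Dm_def)
    ultimately show ?thesis using c(1) by (metis IntI imageI)
  qed
  moreover have "b' \<in> Dp \<inter> \<phi> ` (- C)"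
  proof -
    have "\<phi> b' = b'" using \<phi>_in[of b'] cb by simp
    moreover have "b' \<in> - C" using b'(1) \<open>\<phi> b' = b'\<close> by (auto simp: C_def Dp_def)
    ultimately show ?thesis using b'(1) by (metis IntI imageI)
  qed
  ultimately show False
    using connectedD[OF _ open_Dm open_Dp, of "\<phi> ` (- C)"] disj by blast
qed

section \<open>Linear images of Hausdorff measure on hyperplanes\<close>

lemma sets_borel_linear_image:
  fixes f :: "'a::euclidean_space \<Rightarrow> 'a"
  assumes f: "linear f" "inj f" and E: "E \<in> sets borel"
  shows "f ` E \<in> sets borel"
proof -
  obtain g where g: "linear g" "g \<circ> f = id" using linear_injective_left_inverse[OF f] by blast
  then have fg: "f \<circ> g = id" using linear_inverse_left[OF g(1) f(1)] by blast
  have "f ` E = g -` E \<inter> space borel"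
    using g(2) fg by (auto simp: fun_eq_iff) (metis image_eqI)
  also have "\<dots> \<in> sets borel"
    by (rule measurable_sets[OF _ E])
      (intro borel_measurable_continuous_onI linear_continuous_on linear_conv_bounded_linear[THEN iffD1] g)
  finally show ?thesis .
qed

lemma content_unit_cube_cart: "measure lebesgue (cbox 0 (1 :: real^'n)) = 1"
proof -
  have "(0 :: real^'n) \<in> cbox 0 1" by (simp add: mem_box_cart)
  then have "cbox 0 (1 :: real^'n) \<noteq> {}" by blast
  then show ?thesis by (simp add: content_cbox_cart)
qed

lemma emeasure_unit_cube_cart: "emeasure lborel (cbox 0 (1 :: real^'n)) = 1"
proof -
  have "emeasure lborel (cbox 0 (1 :: real^'n)) \<noteq> top"
    using emeasure_lborel_cbox_finite[of "0 :: real^'n" 1] by (simp add: less_top)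
  then have "emeasure lborel (cbox 0 (1 :: real^'n)) = ennreal (measure lborel (cbox 0 (1 :: real^'n)))"
    by (rule emeasure_eq_ennreal_measure)
  then show ?thesis using content_unit_cube_cart[where 'n = 'n] by simp
qed

text \<open>The set function assigning to \<open>E\<close> the volume of its image under
  \<open>f\<close> is a translation invariant measure, hence a multiple of Lebesgue measure; the
  unit cube reads off the factor.\<close>

lemma emeasure_linear_image_unit_cube:
  fixes f :: "real^'n \<Rightarrow> real^'n"
  assumes f: "linear f" "inj f" and E: "E \<in> sets borel"
  shows "emeasure lborel (f ` E) = emeasure lborel (f ` cbox 0 1) * emeasure lborel E"
proof -
  let ?U = "cbox 0 (1 :: real^'n)"
  obtain g where g: "linear g" "g \<circ> f = id" using linear_injective_left_inverse[OF f] by blast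
  then have "f \<circ> g = id" using linear_inverse_left[OF g(1) f(1)] by blast
  then have fg: "f (g x) = x" and gf: "g (f x) = x" for x using g(2) by (auto simp: fun_eq_iff)
  have gc: "continuous_on UNIV g" using g(1) linear_continuous_on linear_conv_bounded_linear by blast
  have gm[measurable]: "g \<in> borel_measurable borel" using gc by (rule borel_measurable_continuous_onI)
  define N where "N = distr lborel borel g"
  have im: "f ` E = {x. g x \<in> E}" for E 
  proof (intro subset_antisym subsetI)
    fix x assume "x \<in> {x. g x \<in> E}"
    then have "f (g x) \<in> f ` E" by blast
    then show "x \<in> f ` E" by (simp add: fg)
  qed (auto simp: gf)
  have emN: "emeasure N E = emeasure lborel (f ` E)" if "E \<in> sets borel" for E
    using that by (simp add: N_def emeasure_distr im vimage_def)
  have cube: "emeasure lborel ?U = 1" by (rule emeasure_unit_cube_cart)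
  have "emeasure lborel ?U * emeasure N E' = emeasure lborel E' * emeasure N (uminus -` ?U)"
    if "E' \<in> sets borel" for E'
  proof (rule translation_invariant_emeasure_commute[where V = UNIV])
    show "sigma_finite_measure N"
    proof
      define C where "C m = {z. norm (f z) \<le> real m}" for m :: nat
      have fc: "continuous_on UNIV f" using f(1) linear_continuous_on linear_conv_bounded_linear by blast
      have Cb: "C m \<in> sets borel" for m unfolding C_def
        by (rule borel_closed, rule closed_Collect_le) (intro continuous_intros fc)+
      have "emeasure N (C m) \<noteq> \<infinity>" for m
      proof -
        have "f ` C m \<subseteq> cball 0 (real m)" by (auto simp: C_def)
        then have "emeasure lborel (f ` C m) < \<infinity>"
          using emeasure_bounded_finite[of "f ` C m"] bounded_subset[OF bounded_cball] by blast
        then show ?thesis using emN[OF Cb] by simp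
      qed
      moreover have "(\<Union>m. C m) = space N" using real_arch_simple by (auto simp: C_def N_def)
      ultimately show "\<exists>A. countable A \<and> A \<subseteq> sets N \<and> \<Union> A = space N \<and> (\<forall>a\<in>A. emeasure N a \<noteq> \<infinity>)"
        using Cb by (intro exI[of _ "range C"]) (auto simp: N_def)
    qed
    show "distr N borel (\<lambda>x. x + v) = N" for v
    proof -
      have "distr N borel (\<lambda>x. x + v) = distr lborel borel (\<lambda>x. g x + v)"
        unfolding N_def by (subst distr_distr) (auto simp: o_def)
      also have "\<dots> = distr lborel borel (\<lambda>x. g (f v + x))"
        using gf by (simp add: linear_add[OF g(1)] add.commute)
      also have "\<dots> = distr (distr lborel borel ((+) (f v))) borel g"
        by (subst distr_distr) (auto simp: o_def)
      finally show ?thesis by (simp add: lborel_distr_plus N_def)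
    qed
    show "distr lborel borel (\<lambda>x. x + v) = lborel" for v :: "real^'n"
      using lborel_distr_plus[of v] by (simp add: add.commute[of _ v])
  qed (use that in \<open>auto simp: N_def intro: lborel.sigma_finite_measure_axioms\<close>)
  then have "emeasure N E' = emeasure lborel E' * emeasure N (uminus -` ?U)" if "E' \<in> sets borel" for E'
    using that cube by simp
  \<comment> \<open>Applied to the cube itself, the identity determines the volume of the image of
    the reflected cube, which is the unknown factor in the identity for \<open>E\<close>.\<close>
  from this[OF E] this[of ?U] show ?thesis
    using cube E emN by (simp add: mult.commute)
qed

text \<open>Multiplicativity reduces the determinant formula to the images of the unit cube under elementary maps.\<close>

lemma emeasure_linear_image_cart:
  fixes f :: "real^'n \<Rightarrow> real^'n"
  assumes f: "linear f" "inj f" and E: "E \<in> sets borel"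
  shows "emeasure lborel (f ` E) = ennreal \<bar>det (matrix f)\<bar> * emeasure lborel E"
proof -
  let ?U = "cbox 0 (1 :: real^'n)"
  have U: "?U \<in> sets borel" "?U \<in> lmeasurable" by auto
  have mU: "measure lebesgue ?U = 1" "?U \<noteq> {}"
    by (rule content_unit_cube_cart) (metis content_unit_cube_cart measure_empty zero_neq_one)
  have fromm: "emeasure lborel (h ` ?U) = ennreal c"
    if "linear h" "h ` ?U \<in> lmeasurable" "measure lebesgue (h ` ?U) = c" for h :: "real^'n \<Rightarrow> real^'n" and c
  proof -
    have "compact (h ` ?U)"
      using that(1) by (intro compact_continuous_image linear_continuous_on) (auto simp: linear_conv_bounded_linear)
    then have "h ` ?U \<in> sets borel" by (rule borel_compact)
    then show ?thesis
      using that(3) emeasure_eq_measure2[OF that(2)] by simp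
  qed
  \<comment> \<open>Injectivity is kept inside the induction claim so that singular elementary maps
    satisfy it vacuously.\<close>
  have "inj f \<longrightarrow> emeasure lborel (f ` ?U) = ennreal \<bar>det (matrix f)\<bar>"
  proof (rule induct_linear_elementary[OF f(1)])
    fix f g :: "real^'n \<Rightarrow> real^'n"
    assume lin: "linear f" "linear g" and IH: "inj f \<longrightarrow> emeasure lborel (f ` ?U) = ennreal \<bar>det (matrix f)\<bar>"
      "inj g \<longrightarrow> emeasure lborel (g ` ?U) = ennreal \<bar>det (matrix g)\<bar>"
    show "inj (f \<circ> g) \<longrightarrow> emeasure lborel ((f \<circ> g) ` ?U) = ennreal \<bar>det (matrix (f \<circ> g))\<bar>"
    proof
      assume "inj (f \<circ> g)"
      then have g: "inj g" by (rule inj_on_imageI2)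
      have "surj g" using g lin(2) linear_injective_imp_surjective by blast
      then have f: "inj f" using \<open>inj (f \<circ> g)\<close> by (auto simp: inj_def surj_def) metis
      have "emeasure lborel ((f \<circ> g) ` ?U) = emeasure lborel (f ` ?U) * emeasure lborel (g ` ?U)"
        unfolding image_comp[symmetric]
        by (rule emeasure_linear_image_unit_cube[OF lin(1) f sets_borel_linear_image[OF lin(2) g U(1)]])
      then show "emeasure lborel ((f \<circ> g) ` ?U) = ennreal \<bar>det (matrix (f \<circ> g))\<bar>"
        using IH f g by (simp add: matrix_compose[OF lin(2,1)] det_mul abs_mult ennreal_mult)
    qed
  next
    fix f :: "real^'n \<Rightarrow> real^'n" and i assume lin: "linear f" and 0: "\<And>x. f x $ i = 0"
    have "\<not> surj f"
    proof
      assume "surj f"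
      then obtain x where "f x = axis i 1" by (metis surj_def)
      then show False using 0[of x] by simp
    qed
    then show "inj f \<longrightarrow> emeasure lborel (f ` ?U) = ennreal \<bar>det (matrix f)\<bar>"
      using linear_injective_imp_surjective[OF lin] by blast
  next
    fix c :: "'n \<Rightarrow> real"
    have "emeasure lborel ((\<lambda>x. \<chi> i. c i * x $ i) ` ?U) = ennreal \<bar>prod c UNIV\<bar>"
      using measurable_stretch[OF U(2), of c] measure_stretch[OF U(2), of c] mU(1)
      by (intro fromm linearI) (auto simp: vec_eq_iff algebra_simps)
    moreover have "det (matrix (\<lambda>x. \<chi> i. c i * x $ i)) = prod c UNIV"
      by (simp add: axis_def matrix_def det_diagonal)
    ultimately show "inj (\<lambda>x. \<chi> i. c i * x $ i) \<longrightarrow>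
        emeasure lborel ((\<lambda>x. \<chi> i. c i * x $ i) ` ?U) = ennreal \<bar>det (matrix (\<lambda>x. \<chi> i. c i * x $ i))\<bar>"
      by simp
  next
    fix m n :: 'n assume mn: "m \<noteq> n"
    let ?h = "\<lambda>v::real^'n. \<chi> i. v $ Transposition.transpose m n i"
    have "?h (?h x) = x" for x by (simp add: vec_eq_iff)
    moreover have "?h x \<in> ?U" if "x \<in> ?U" for x using that by (simp add: mem_box_cart)
    ultimately have "?h ` ?U = ?U" by (force simp: image_iff)
    then have "emeasure lborel (?h ` ?U) = ennreal 1"
      using emeasure_unit_cube_cart[where 'n = 'n] by simp
    moreover have "\<bar>det (matrix ?h)\<bar> = 1"
    proof -
      have "orthogonal_transformation ?h"
        unfolding orthogonal_transformation_def
      proof (intro conjI allI)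
        show "linear ?h" by (rule linearI) (simp_all add: vec_eq_iff)
        show "?h v \<bullet> ?h w = v \<bullet> w" for v w
          unfolding inner_vec_def
          using sum.reindex_bij_betw[OF bij_transpose, of "\<lambda>i. v $ i \<bullet> w $ i" m n] by simp
      qed
      then show ?thesis by (rule orthogonal_transformation_det)
    qed
    ultimately show "inj ?h \<longrightarrow> emeasure lborel (?h ` ?U) = ennreal \<bar>det (matrix ?h)\<bar>" by simp
  next
    fix m n :: 'n assume mn: "m \<noteq> n"
    let ?h = "\<lambda>x::real^'n. \<chi> i. if i = m then x $ m + x $ n else x $ i"
    have "emeasure lborel (?h ` ?U) = ennreal 1"
      using measurable_shear_interval[OF mn mU(2)] measure_shear_interval[OF mn mU(2)] mU(1)
      by (intro fromm linearI) (auto simp: vec_eq_iff algebra_simps)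
    moreover have "det (matrix ?h) = 1"
    proof -
      have "matrix ?h = (\<chi> i. if i = m then row m (mat 1) + 1 *s row n (mat 1) else row i (mat 1))"
        by (auto simp: matrix_def vec_eq_iff row_def mat_def axis_def)
      then show ?thesis using det_row_operation[OF mn, of "mat 1 :: real^'n^'n" 1] by simp
    qed
    ultimately show "inj ?h \<longrightarrow> emeasure lborel (?h ` ?U) = ennreal \<bar>det (matrix ?h)\<bar>" by simp
  qed
  then show ?thesis using emeasure_linear_image_unit_cube[OF f E] f(2) by simp
qed

section \<open>Area on hyperplanes\<close>

lemma hausdorff_outer_isometry:
  assumes "\<And>x y. \<lbrakk>x \<in> A; y \<in> A\<rbrakk> \<Longrightarrow> dist (g x) (g y) = dist x y"
  shows "hausdorff_outer k (g ` A) = hausdorff_outer k A"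
proof (rule antisym)
  show "hausdorff_outer k (g ` A) \<le> hausdorff_outer k A"
    using hausdorff_outer_lipschitz_image[of 1 A g k] assms by simp
  have inj: "inj_on g A" using assms by (metis dist_eq_0_iff inj_onI)
  have "hausdorff_outer k (the_inv_into A g ` (g ` A)) \<le> ennreal (1 ^ k) * hausdorff_outer k (g ` A)"
    by (rule hausdorff_outer_lipschitz_image) (auto simp: the_inv_into_f_f[OF inj] assms)
  also have "the_inv_into A g ` (g ` A) = A"
    using inj by (simp add: image_image the_inv_into_f_f)
  finally show "hausdorff_outer k A \<le> hausdorff_outer k (g ` A)" by simp
qed

lemma hausdorff_pre_finite_cover:
  assumes "finite I" "E \<subseteq> (\<Union>a\<in>I. U a)" "0 < k" "0 \<le> \<delta>"
    and "\<And>a x y. \<lbrakk>a \<in> I; x \<in> U a; y \<in> U a\<rbrakk> \<Longrightarrow> dist x y \<le> \<delta>"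
  shows "hausdorff_pre k \<delta> E \<le> ennreal (real (card I) * (unit_ball_vol (real k) * (\<delta> / 2) ^ k))"
proof -
  let ?c = "unit_ball_vol (real k) * (\<delta> / 2) ^ k"
  obtain h where h: "bij_betw h {0..<card I} I" using ex_bij_betw_nat_finite[OF assms(1)] by blast
  define W where "W i = (if i < card I then U (h i) else {})" for i
  have hI: "h i \<in> I" if "i < card I" for i using h that by (auto simp: bij_betw_def)
  have W: "dist x y \<le> \<delta>" if "x \<in> W i" "y \<in> W i" for i x y
    using that assms(5) hI by (auto simp: W_def split: if_splits)
  have "hausdorff_pre k \<delta> E \<le> (\<Sum>i. hausdorff_content k (W i))"
  proof (rule hausdorff_pre_le_cover)
    show "E \<subseteq> (\<Union>i. W i)"
    proof
      fix x assume "x \<in> E"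
      then obtain a where "a \<in> I" "x \<in> U a" using assms(2) by blast
      moreover from \<open>a \<in> I\<close> obtain i where "i < card I" "h i = a"
        using h unfolding bij_betw_def by (metis atLeastLessThan_iff imageE)
      ultimately show "x \<in> (\<Union>i. W i)" by (auto simp: W_def)
    qed
    show "bounded (W i)" for i unfolding bounded_two_points using W by blast
    show "diameter (W i) \<le> \<delta>" for i by (rule diameter_leI) (use W assms(4) in auto)
  qed
  also have "\<dots> = (\<Sum>i<card I. hausdorff_content k (W i))"
    by (intro suminf_finite) (auto simp: W_def)
  also have "\<dots> \<le> (\<Sum>i<card I. ennreal ?c)"
    by (intro sum_mono hausdorff_content_dist_le assms W)
  also have "\<dots> = ennreal (real (card I) * ?c)"
    using assms(4) by (subst sum_ennreal) auto
  finally show ?thesis .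
qed

text \<open>A grid of N^(n-1) cells of diameter at most n / N has content bounded independently of
  N. The crude diameter bound by the sum of the coordinates suffices, as only finiteness is
  wanted.\<close>

lemma hausdorff_outer_unit_cube_finite:
  fixes m :: "'n::finite"
  assumes n: "2 \<le> CARD('n)"
  shows "hausdorff_outer (CARD('n) - 1) {x :: real^'n. x $ m = 0 \<and> (\<forall>i. 0 \<le> x $ i \<and> x $ i \<le> 1)} < top"
proof -
  let ?n = "CARD('n)" let ?k = "?n - 1"
  let ?W = "{x :: real^'n. x $ m = 0 \<and> (\<forall>i. 0 \<le> x $ i \<and> x $ i \<le> 1)}"
  define c where "c = unit_ball_vol (real ?k) * (real ?n / 2) ^ ?k"
  have grid: "hausdorff_pre ?k (real ?n / real N) ?W \<le> ennreal c" if N: "0 < N" for N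
  proof -
    define I where "I = PiE (UNIV - {m}) (\<lambda>_. {..<N})"
    define U where "U a = {x :: real^'n. x $ m = 0 \<and> (\<forall>i\<in>UNIV - {m}. real (a i) / N \<le> x $ i \<and> x $ i \<le> (real (a i) + 1) / N)}" for a
    have "hausdorff_pre ?k (real ?n / real N) ?W
        \<le> ennreal (real (card I) * (unit_ball_vol (real ?k) * (real ?n / real N / 2) ^ ?k))"
    proof (rule hausdorff_pre_finite_cover)
      show "finite I" unfolding I_def by (intro finite_PiE) auto
      show "?W \<subseteq> (\<Union>a\<in>I. U a)"
      proof
        fix x assume x: "x \<in> ?W"
        \<comment> \<open>A coordinate equal to 1 is put into the last cell; rounding down would
          give the index \<open>N\<close>, which is out of range.\<close>
        define a where "a = restrict (\<lambda>i. if x $ i = 1 then N - 1 else nat \<lfloor>x $ i * N\<rfloor>) (UNIV - {m})"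
        have ai: "a i < N \<and> real (a i) / N \<le> x $ i \<and> x $ i \<le> (real (a i) + 1) / N" if "i \<noteq> m" for i
        proof (cases "x $ i = 1")
          case True
          then show ?thesis using N that by (simp add: a_def of_nat_diff field_simps)
        next
          case False
          have xi: "0 \<le> x $ i" "x $ i < 1" using x False by (auto simp: less_le)
          then have pos: "0 \<le> x $ i * N" "x $ i * N < N" using N by auto
          have a: "a i = nat \<lfloor>x $ i * N\<rfloor>" using False that by (simp add: a_def)
          have "real (a i) \<le> x $ i * N" "x $ i * N \<le> real (a i) + 1"
            using pos(1) unfolding a by (simp_all add: of_nat_nat)
          moreover from this(1) have "real (a i) < real N" using pos(2) by linarith
          ultimately show ?thesis using N by (auto simp: field_simps)
        qed
        then have "a \<in> I" by (auto simp: I_def a_def PiE_def extensional_def)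
        moreover have "x \<in> U a" using x ai by (auto simp: U_def)
        ultimately show "x \<in> (\<Union>a\<in>I. U a)" by blast
      qed
      show "0 < ?k" using n by simp
      show "0 \<le> real ?n / real N" by simp
      fix a x y assume xy: "x \<in> U a" "y \<in> U a"
      have "\<bar>(x - y) $ i\<bar> \<le> 1 / N" for i
      proof (cases "i = m")
        case False
        then have "x $ i \<in> {real (a i) / N..(real (a i) + 1) / N}" "y $ i \<in> {real (a i) / N..(real (a i) + 1) / N}"
          using xy by (auto simp: U_def)
        then show ?thesis by (auto simp: abs_le_iff add_divide_distrib)
      qed (use xy in \<open>simp add: U_def\<close>)
      then have "(\<Sum>i\<in>UNIV. \<bar>(x - y) $ i\<bar>) \<le> (\<Sum>i\<in>(UNIV :: 'n set). 1 / N)" by (rule sum_mono)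
      then show "dist x y \<le> real ?n / real N"
        unfolding dist_norm using norm_le_l1_cart[of "x - y"] by simp
    qed
    also have "card I = N ^ ?k" by (simp add: I_def card_PiE card_Diff_singleton)
    also have "real (N ^ ?k) * (unit_ball_vol (real ?k) * (real ?n / real N / 2) ^ ?k) = c"
      using N by (simp add: c_def power_divide power_mult_distrib)
    finally show ?thesis .
  qed
  have "hausdorff_pre ?k \<delta> ?W \<le> ennreal c" if "0 < \<delta>" for \<delta>
  proof -
    obtain N :: nat where N: "real ?n / \<delta> < real N" using reals_Archimedean2 by blast
    have "0 < real ?n / \<delta>" using that by simp
    then have "0 < real N" using N by linarith
    then have "real ?n / real N \<le> \<delta>" using N that by (simp add: field_simps)
    then have "hausdorff_pre ?k \<delta> ?W \<le> hausdorff_pre ?k (real ?n / real N) ?W"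
      by (rule hausdorff_pre_antimono)
    also have "\<dots> \<le> ennreal c" using \<open>0 < real N\<close> by (intro grid) simp
    finally show ?thesis .
  qed
  then have "hausdorff_outer ?k ?W \<le> ennreal c"
    unfolding hausdorff_outer_def by (intro SUP_least) auto
  then show ?thesis by (simp add: le_less_trans)
qed

lemma emeasure_distr_density_indicator:
  assumes "h \<in> M \<rightarrow>\<^sub>M borel" "V \<in> sets M" "B \<in> sets borel"
  shows "emeasure (distr (density M (indicator V)) borel h) B = emeasure M (V \<inter> (h -` B \<inter> space M))"
proof -
  have hB: "h -` B \<inter> space M \<in> sets M" using assms(1,3) by (rule measurable_sets)
  have "h \<in> density M (indicator V) \<rightarrow>\<^sub>M borel" using assms(1) by simp
  then have "emeasure (distr (density M (indicator V)) borel h) B = emeasure (density M (indicator V)) (h -` B \<inter> space M)"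
    using assms(3) by (simp add: emeasure_distr)
  also have "\<dots> = (\<integral>\<^sup>+x. indicator V x * indicator (h -` B \<inter> space M) x \<partial>M)"
    using hB assms(2) by (subst emeasure_density) auto
  also have "\<dots> = (\<integral>\<^sup>+x. indicator (V \<inter> (h -` B \<inter> space M)) x \<partial>M)"
    by (intro nn_integral_cong) (simp add: indicator_inter_arith)
  also have "\<dots> = emeasure M (V \<inter> (h -` B \<inter> space M))"
    using hB assms(2) by (intro nn_integral_indicator) auto
  finally show ?thesis .
qed

text \<open>
  Both sides are translation invariant measures on the hyperplane. The constant \<open>\<kappa>\<close> only has to be
  positive and finite, since it cancels later; with the chosen normalization it would be \<open>1\<close>.
\<close>

lemma hausdorff_hyperplane_prism:
  fixes m :: "'n::finite"
  assumes n: "2 \<le> CARD('n)"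
  shows "\<exists>\<kappa>>0. \<forall>E :: (real^'n) set. E \<in> sets borel \<and> E \<subseteq> {x. x $ m = 0} \<longrightarrow>
      emeasure lborel {x. 0 \<le> x $ m \<and> x $ m \<le> 1 \<and> x - (x $ m) *\<^sub>R axis m 1 \<in> E}
        = ennreal \<kappa> * hausdorff_outer (CARD('n) - 1) E"
proof -
  let ?k = "CARD('n) - 1"
  define V where "V = {x :: real^'n. x $ m = 0}"
  define P where "P x = x - (x $ m) *\<^sub>R axis m (1 :: real)" for x :: "real^'n"
  define S where "S = {x :: real^'n. 0 \<le> x $ m \<and> x $ m \<le> 1}"
  have "closed V" unfolding V_def by (intro closed_Collect_eq continuous_intros)
  then have Vb[measurable]: "V \<in> sets borel" by simp
  have Vh: "V \<in> sets hyper_measure"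
    unfolding hyper_measure_def using sets_borel_subset_hausdorff_measure Vb by blast
  have "closed S" unfolding S_def by (intro closed_Collect_conj closed_Collect_le continuous_intros)
  then have Sb[measurable]: "S \<in> sets borel" by simp
  have Pc: "continuous_on UNIV P" unfolding P_def by (intro continuous_intros)
  then have Pm[measurable]: "P \<in> borel_measurable borel" by (rule borel_measurable_continuous_onI)
  have PV: "P x \<in> V" for x by (simp add: P_def V_def)
  \<comment> \<open>Hausdorff measure lives on a larger sigma-algebra. Pushing both measures to the
    Borel sets gives them the same measurable sets, as the uniqueness lemma requires.\<close>
  define M where "M = distr (density hyper_measure (indicator V)) borel (\<lambda>x::real^'n. x)"
  define N where "N = distr (density lborel (indicator S)) borel P"
  have idm: "(\<lambda>x. x) \<in> hyper_measure \<rightarrow>\<^sub>M (borel :: (real^'n) measure)"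
    using sets_borel_subset_hausdorff_measure
    by (intro measurableI) (auto simp: hyper_measure_def space_hausdorff_measure)
  have emM: "emeasure M B = hausdorff_outer ?k (V \<inter> B)" if B: "B \<in> sets borel" for B
    unfolding M_def using emeasure_distr_density_indicator[OF idm Vh B] B Vb
    by (simp add: hyper_measure_def space_hausdorff_measure emeasure_hausdorff_borel)
  have emN: "emeasure N B = emeasure lborel (S \<inter> P -` B)" if B: "B \<in> sets borel" for B
    unfolding N_def using emeasure_distr_density_indicator[of P lborel S B] B by simp
  have sM: "sets M = sets borel" and sN: "sets N = sets borel" by (simp_all add: M_def N_def)
  define Q where "Q c = cbox (- c *\<^sub>R 1) (c *\<^sub>R (1 :: real^'n))" for c :: real
  have Qb[measurable]: "Q c \<in> sets borel" for c by (simp add: Q_def)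
  have Q: "x \<in> Q c \<longleftrightarrow> (\<forall>i. - c \<le> x $ i \<and> x $ i \<le> c)" for x c by (simp add: Q_def mem_box_cart)
  have QM: "emeasure M (Q c) < top" if c: "0 < c" for c
  proof -
    let ?W = "{x :: real^'n. x $ m = 0 \<and> (\<forall>i. 0 \<le> x $ i \<and> x $ i \<le> 1)}"
    let ?g = "\<lambda>x::real^'n. \<chi> i. if i = m then 0 else 2 * c * x $ i - c"
    have "V \<inter> Q c \<subseteq> ?g ` ?W"
    proof
      fix x assume x: "x \<in> V \<inter> Q c"
      let ?y = "\<chi> i. if i = m then 0 else (x $ i + c) / (2 * c)"
      have xc: "0 \<le> x $ i + c" "x $ i + c \<le> 2 * c" for i
      proof -
        have "- c \<le> x $ i" "x $ i \<le> c" using x Q by auto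
        then show "0 \<le> x $ i + c" "x $ i + c \<le> 2 * c" by linarith+
      qed
      have "?y \<in> ?W" using c xc by (auto simp: divide_le_eq)
      moreover have "x = ?g ?y" using x c by (auto simp: V_def vec_eq_iff)
      ultimately show "x \<in> ?g ` ?W" by blast
    qed
    then have "emeasure M (Q c) \<le> hausdorff_outer ?k (?g ` ?W)"
      unfolding emM[OF Qb] by (rule hausdorff_outer_mono)
    also have "\<dots> \<le> ennreal ((2 * c) ^ ?k) * hausdorff_outer ?k ?W"
    proof (rule hausdorff_outer_lipschitz_image)
      show "dist (?g x) (?g y) \<le> 2 * c * dist x y" if "x \<in> ?W" "y \<in> ?W" for x y
      proof -
        have "?g x - ?g y = (2 * c) *\<^sub>R (x - y)"
          using that by (auto simp: vec_eq_iff algebra_simps)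
        then show ?thesis using c by (simp add: dist_norm)
      qed
    qed (use c in simp)
    also have "\<dots> < top" using hausdorff_outer_unit_cube_finite[OF n, of m] by (simp add: ennreal_mult_less_top)
    finally show ?thesis .
  qed
  have QN: "emeasure N (Q c) < top" for c
  proof -
    have "S \<inter> P -` Q c \<subseteq> Q (max c 1)"
    proof
      fix x assume x: "x \<in> S \<inter> P -` Q c"
      have "- max c 1 \<le> x $ i \<and> x $ i \<le> max c 1" for i
      proof (cases "i = m")
        case False
        then have "P x $ i = x $ i" by (simp add: P_def axis_def)
        moreover have "- c \<le> P x $ i" "P x $ i \<le> c" using x Q by auto
        ultimately show ?thesis by linarith
      qed (use x in \<open>auto simp: S_def\<close>)
      then show "x \<in> Q (max c 1)" by (simp add: Q)
    qed
    then have "emeasure lborel (S \<inter> P -` Q c) \<le> emeasure lborel (Q (max c 1))"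
      by (intro emeasure_mono) auto
    also have "\<dots> < top" unfolding Q_def by (rule emeasure_lborel_cbox_finite[unfolded infinity_ennreal_def])
    finally show ?thesis by (simp add: emN)
  qed
  have QU: "(\<Union>j::nat. Q (real (Suc j))) = UNIV"
  proof -
    have "\<exists>j::nat. x \<in> Q (real (Suc j))" for x
    proof -
      obtain j :: nat where j: "norm x \<le> real j" using real_arch_simple by blast
      have "- real (Suc j) \<le> x $ i \<and> x $ i \<le> real (Suc j)" for i
        using component_le_norm_cart[of x i] j by auto
      then show ?thesis using Q by blast
    qed
    then show ?thesis by blast
  qed
  have sfM: "sigma_finite_measure M"
  proof
    show "\<exists>A. countable A \<and> A \<subseteq> sets M \<and> \<Union> A = space M \<and> (\<forall>a\<in>A. emeasure M a \<noteq> \<infinity>)"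
      using QU QM by (intro exI[of _ "range (\<lambda>j::nat. Q (real (Suc j)))"]) (auto simp: M_def less_top)
  qed
  have sfN: "sigma_finite_measure N"
  proof
    show "\<exists>A. countable A \<and> A \<subseteq> sets N \<and> \<Union> A = space N \<and> (\<forall>a\<in>A. emeasure N a \<noteq> \<infinity>)"
      using QU QN by (intro exI[of _ "range (\<lambda>j::nat. Q (real (Suc j)))"]) (auto simp: N_def less_top)
  qed
  have invM: "distr M borel (\<lambda>x. x + v) = M" if v: "v \<in> V" for v
  proof (rule measure_eqI)
    fix B assume "B \<in> sets (distr M borel (\<lambda>x. x + v))"
    then have B[measurable]: "B \<in> sets borel" by simp
    have pre: "(\<lambda>x. x + v) -` B \<in> sets borel"
      using measurable_sets[of "\<lambda>x. x + v" borel borel B] by simp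
    have "emeasure (distr M borel (\<lambda>x. x + v)) B = emeasure M ((\<lambda>x. x + v) -` B)"
      using sM by (subst emeasure_distr) (auto simp: M_def)
    also have "\<dots> = hausdorff_outer ?k (V \<inter> (\<lambda>x. x + v) -` B)" by (rule emM[OF pre])
    also have "\<dots> = hausdorff_outer ?k ((\<lambda>x. x + v) ` (V \<inter> (\<lambda>x. x + v) -` B))"
      by (intro hausdorff_outer_isometry[symmetric]) simp
    also have "(\<lambda>x. x + v) ` (V \<inter> (\<lambda>x. x + v) -` B) = V \<inter> B"
    proof (intro subset_antisym subsetI)
      fix x assume "x \<in> V \<inter> B"
      then have "x - v \<in> V \<inter> (\<lambda>x. x + v) -` B" using v by (simp add: V_def)
      then have "(x - v) + v \<in> (\<lambda>x. x + v) ` (V \<inter> (\<lambda>x. x + v) -` B)" by blast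
      then show "x \<in> (\<lambda>x. x + v) ` (V \<inter> (\<lambda>x. x + v) -` B)" by simp
    qed (use v in \<open>auto simp: V_def\<close>)
    finally show "emeasure (distr M borel (\<lambda>x. x + v)) B = emeasure M B" using emM[OF B] by simp
  qed (simp add: sM)
  have invN: "distr N borel (\<lambda>x. x + v) = N" if v: "v \<in> V" for v
  proof (rule measure_eqI)
    fix B assume "B \<in> sets (distr N borel (\<lambda>x. x + v))"
    then have B[measurable]: "B \<in> sets borel" by simp
    have pre: "(\<lambda>x. x + v) -` B \<in> sets borel"
      using measurable_sets[of "\<lambda>x. x + v" borel borel B] by simp
    have SPB: "S \<inter> P -` B \<in> sets borel" using measurable_sets[OF Pm B] by auto
    have Pv: "P (v + x) = P x + v" for x using v by (simp add: P_def V_def algebra_simps)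
    have "emeasure (distr N borel (\<lambda>x. x + v)) B = emeasure N ((\<lambda>x. x + v) -` B)"
      using sN by (subst emeasure_distr) (auto simp: N_def)
    also have "\<dots> = emeasure lborel (S \<inter> P -` (\<lambda>x. x + v) -` B)" by (rule emN[OF pre])
    also have "S \<inter> P -` (\<lambda>x. x + v) -` B = (+) v -` (S \<inter> P -` B)"
      using v Pv by (auto simp: S_def V_def)
    also have "emeasure lborel ((+) v -` (S \<inter> P -` B)) = emeasure (distr lborel borel ((+) v)) (S \<inter> P -` B)"
      using SPB by (subst emeasure_distr) auto
    also have "\<dots> = emeasure N B" by (simp add: lborel_distr_plus emN)
    finally show "emeasure (distr N borel (\<lambda>x. x + v)) B = emeasure N B" .
  qed (simp add: sN)
  have aeM: "AE x in M. x \<in> V"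
  proof (rule AE_I)
    show "{x \<in> space M. x \<notin> V} \<subseteq> - V" by auto
    show "emeasure M (- V) = 0" using emM[of "- V"] by simp
  qed (use sM in auto)
  have aeN: "AE x in N. x \<in> V"
  proof (rule AE_I)
    show "{x \<in> space N. x \<notin> V} \<subseteq> - V" by auto
    have "S \<inter> P -` (- V) = {}" using PV by auto
    then show "emeasure N (- V) = 0" using emN[of "- V"] by simp
  qed (use sN in auto)
  have Qsym: "uminus -` Q 1 = Q 1"
  proof -
    have "(\<forall>i. - 1 \<le> (- x) $ i \<and> (- x) $ i \<le> 1) \<longleftrightarrow> (\<forall>i. - 1 \<le> x $ i \<and> x $ i \<le> 1)" for x :: "real^'n"
      by (intro all_cong1) auto
    then show ?thesis by (intro set_eqI) (simp only: vimage_eq Q)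
  qed
  have Vm: "- v \<in> V" if "v \<in> V" for v using that by (simp add: V_def)
  have haar: "emeasure M (Q 1) * emeasure N B = emeasure M B * emeasure N (Q 1)" if "B \<in> sets borel" for B
    using translation_invariant_emeasure_commute[OF sfM sfN sM sN aeM aeN Vm invM invN Qb[of 1] that]
    unfolding Qsym .
  define W where "W = {x :: real^'n. x $ m = 0 \<and> (\<forall>i. 0 \<le> x $ i \<and> x $ i \<le> 1)}"
  have Wsub: "W \<subseteq> V \<inter> Q 1"
  proof
    fix x assume x: "x \<in> W"
    have "- 1 \<le> x $ i \<and> x $ i \<le> 1" for i
    proof -
      have "0 \<le> x $ i" "x $ i \<le> 1" using x by (auto simp: W_def)
      then show ?thesis by linarith
    qed
    then show "x \<in> V \<inter> Q 1" using x by (simp add: W_def V_def Q)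
  qed
  have cubeN: "cbox 0 1 \<subseteq> S \<inter> P -` Q 1"
  proof
    fix x :: "real^'n" assume x: "x \<in> cbox 0 1"
    have xi: "0 \<le> x $ i" "x $ i \<le> 1" for i using x by (simp_all add: mem_box_cart)
    have "- 1 \<le> P x $ i \<and> P x $ i \<le> 1" for i
      using xi[of i] by (cases "i = m") (simp_all add: P_def axis_def)
    then show "x \<in> S \<inter> P -` Q 1" using xi[of m] by (simp add: S_def Q)
  qed
  have N1: "1 \<le> emeasure N (Q 1)"
  proof -
    have "1 = emeasure lborel (cbox 0 (1 :: real^'n))"
      by (rule emeasure_unit_cube_cart[symmetric])
    also have "\<dots> \<le> emeasure lborel (S \<inter> P -` Q 1)"
      using measurable_sets[OF Pm Qb] by (intro emeasure_mono cubeN) auto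
    finally show ?thesis by (simp add: emN)
  qed
  \<comment> \<open>If a cube in the hyperplane had area zero, the prism over it would be Lebesgue
    null, although it contains the unit cube.\<close>
  have M1: "emeasure M (Q 1) \<noteq> 0"
  proof
    assume "emeasure M (Q 1) = 0"
    then have "hausdorff_outer ?k W = 0"
      using hausdorff_outer_null_subset[OF _ Wsub] emM[OF Qb] by simp
    then have "negligible (\<Union>x\<in>W. (\<lambda>t. x + t *\<^sub>R axis m 1) ` {0..1})"
    proof (rule lipschitz_cylinder_null[where L = 1])
      show "dist (x + s *\<^sub>R axis m 1) (y + t *\<^sub>R axis m 1) \<le> 1 * (dist x y + \<bar>s - t\<bar>)" for x y :: "real^'n" and s t
      proof -
        have eq: "(x + s *\<^sub>R axis m 1) - (y + t *\<^sub>R axis m 1) = (x - y) + (s - t) *\<^sub>R axis m 1"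
          by (simp add: algebra_simps)
        show ?thesis unfolding dist_norm eq
          using norm_triangle_ineq[of "x - y" "(s - t) *\<^sub>R axis m (1::real)"] by simp
      qed
    qed (use n in auto)
    moreover have "cbox 0 1 \<subseteq> (\<Union>x\<in>W. (\<lambda>t. x + t *\<^sub>R axis m 1) ` {0..1})"
    proof
      fix x :: "real^'n" assume x: "x \<in> cbox 0 1"
      then have xi: "0 \<le> x $ i" "x $ i \<le> 1" for i by (simp_all add: mem_box_cart)
      have "P x \<in> W" using xi by (auto simp: W_def P_def axis_def)
      moreover have "x = P x + (x $ m) *\<^sub>R axis m 1" by (simp add: P_def)
      ultimately show "x \<in> (\<Union>x\<in>W. (\<lambda>t. x + t *\<^sub>R axis m 1) ` {0..1})"
        using xi[of m] by (metis UN_I atLeastAtMost_iff image_eqI)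
    qed
    ultimately have "negligible (cbox 0 (1 :: real^'n))" using negligible_subset by blast
    then show False using content_unit_cube_cart[where 'n = 'n] by (simp add: negligible_iff_measure)
  qed
  define \<kappa> where "\<kappa> = enn2real (emeasure N (Q 1)) / enn2real (emeasure M (Q 1))"
  have pos: "0 < enn2real (emeasure N (Q 1))" "0 < enn2real (emeasure M (Q 1))"
    using N1 M1 QN[of 1] QM[of 1] by (auto simp: enn2real_positive_iff zero_less_iff_neq_zero)
  show ?thesis
  proof (intro exI[of _ \<kappa>] conjI allI impI)
    show "0 < \<kappa>" using pos by (simp add: \<kappa>_def)
    fix E :: "(real^'n) set" assume "E \<in> sets borel \<and> E \<subseteq> {x. x $ m = 0}"
    then have E: "E \<in> sets borel" "E \<subseteq> {x. x $ m = 0}" by auto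
    have eN: "emeasure N E = emeasure lborel {x. 0 \<le> x $ m \<and> x $ m \<le> 1 \<and> x - (x $ m) *\<^sub>R axis m 1 \<in> E}"
      unfolding emN[OF E(1)] by (intro arg_cong[where f = "emeasure lborel"]) (auto simp: S_def P_def)
    have eM: "emeasure M E = hausdorff_outer ?k E"
      using emM[OF E(1)] E(2) by (simp add: V_def Int_absorb1)
    define a b where "a = enn2real (emeasure M (Q 1))" and "b = enn2real (emeasure N (Q 1))"
    have a: "emeasure M (Q 1) = ennreal a" "0 < a" and b: "emeasure N (Q 1) = ennreal b" "0 < b"
      using pos QM[of 1] QN[of 1] by (simp_all add: a_def b_def)
    have "ennreal a * emeasure N E = emeasure M E * ennreal b" using haar[OF E(1)] a b by simp
    then have "ennreal (1 / a) * (ennreal a * emeasure N E) = ennreal (1 / a) * (emeasure M E * ennreal b)" by simp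
    then have "emeasure N E = ennreal (1 / a) * ennreal b * emeasure M E"
      using a(2) by (simp add: mult.assoc[symmetric] ennreal_mult[symmetric]) (simp add: mult_ac)
    also have "ennreal (1 / a) * ennreal b = ennreal \<kappa>"
      using a(2) b(2) by (simp add: \<kappa>_def a_def[symmetric] b_def[symmetric] ennreal_mult[symmetric])
    finally show "emeasure lborel {x. 0 \<le> x $ m \<and> x $ m \<le> 1 \<and> x - (x $ m) *\<^sub>R axis m 1 \<in> E}
        = ennreal \<kappa> * hausdorff_outer ?k E" using eN eM by simp
  qed
qed

text \<open>For \<open>E\<close> in the hyperplane, \<open>L\<close> maps the oblique prism over \<open>E\<close> with edge \<open>L\<^sup>-\<^sup>1 e\<close> to the right prism
  over \<open>L E\<close>, where \<open>e\<close> is the unit normal.\<close>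

lemma hausdorff_linear_image_coordinate_hyperplane:
  fixes L :: "real^'n \<Rightarrow> real^'n" and m :: 'n
  assumes n: "2 \<le> CARD('n)" and L: "linear L" "inj L" and LV: "\<And>x. x $ m = 0 \<Longrightarrow> L x $ m = 0"
    and B: "\<And>x. norm x \<le> B * norm (L x)" and E: "E \<in> sets borel" "E \<subseteq> {x. x $ m = 0}"
  shows "hausdorff_outer (CARD('n) - 1) (L ` E) \<le> ennreal (\<bar>det (matrix L)\<bar> * B) * hausdorff_outer (CARD('n) - 1) E"
proof -
  let ?k = "CARD('n) - 1" let ?e = "axis m (1::real) :: real^'n"
  obtain \<kappa> :: real where \<kappa>: "0 < \<kappa>" and \<kappa>eq: "\<forall>E :: (real^'n) set. E \<in> sets borel \<and> E \<subseteq> {x. x $ m = 0} \<longrightarrow>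
      emeasure lborel {x. 0 \<le> x $ m \<and> x $ m \<le> 1 \<and> x - (x $ m) *\<^sub>R ?e \<in> E} = ennreal \<kappa> * hausdorff_outer ?k E"
    using hausdorff_hyperplane_prism[OF n, of m] by blast
  obtain v where v: "L v = ?e" using linear_injective_imp_surjective[OF L] by (metis surj_def)
  \<comment> \<open>This map fixes the hyperplane and sends the normal \<open>?e\<close> to
    \<open>v\<close>, so that \<open>L \<circ> sh\<close> agrees with \<open>L\<close> on the
    hyperplane and fixes \<open>?e\<close>. Its determinant \<open>v $ m\<close> is the cosine-type
    factor relating volume to area.\<close>
  define sh where "sh x = x + (x $ m) *\<^sub>R (v - ?e)" for x
  have sh: "linear sh" unfolding sh_def by (rule linearI) (simp_all add: algebra_simps)
  have vm: "v $ m \<noteq> 0" using LV[of v] v by auto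
  have shm: "sh x $ m = x $ m * v $ m" for x by (simp add: sh_def algebra_simps)
  have "inj sh"
  proof (rule linear_injective_0[OF sh, THEN iffD2], intro allI impI)
    fix x assume "sh x = 0"
    then have "x $ m = 0" using shm[of x] vm by simp
    then show "x = 0" using \<open>sh x = 0\<close> by (simp add: sh_def)
  qed
  have "matrix sh = (\<chi> i j. if j = m then (mat 1 *v v) $ i else mat 1 $ i $ j)"
    unfolding matrix_vector_mul_lid by (auto simp: matrix_def vec_eq_iff sh_def mat_def axis_def)
  then have detsh: "det (matrix sh) = v $ m"
    using cramer_lemma[of m "mat 1 :: real^'n^'n" v] by simp
  define F where "F = L \<circ> sh"
  have F: "linear F" "inj F" unfolding F_def
    using L sh \<open>inj sh\<close> by (auto intro: linear_compose inj_compose)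
  have detF: "det (matrix F) = det (matrix L) * v $ m"
    unfolding F_def by (simp add: matrix_compose[OF sh L(1)] det_mul detsh)
  define pr where "pr E = {x :: real^'n. 0 \<le> x $ m \<and> x $ m \<le> 1 \<and> x - (x $ m) *\<^sub>R ?e \<in> E}" for E
  have Fx: "F x = L (x - (x $ m) *\<^sub>R ?e) + (x $ m) *\<^sub>R ?e" for x
  proof -
    have "sh x = (x - (x $ m) *\<^sub>R ?e) + (x $ m) *\<^sub>R v" by (simp add: sh_def algebra_simps)
    then show ?thesis by (simp add: F_def linear_add[OF L(1)] linear_scale[OF L(1)] v)
  qed
  have Fm: "F x $ m = x $ m" for x
    unfolding Fx using LV[of "x - (x $ m) *\<^sub>R ?e"] by simp
  have "pr (L ` E) = F ` pr E"
  proof (intro subset_antisym subsetI)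
    fix y assume y: "y \<in> pr (L ` E)"
    then obtain z where z: "z \<in> E" "y - (y $ m) *\<^sub>R ?e = L z" by (auto simp: pr_def)
    have zm: "z $ m = 0" using z E(2) by blast
    let ?x = "z + (y $ m) *\<^sub>R ?e"
    have "F ?x = L z + (y $ m) *\<^sub>R ?e" unfolding Fx using zm by simp
    then have "y = F ?x" using z(2) by (simp add: algebra_simps)
    moreover have "?x \<in> pr E" using y z zm by (simp add: pr_def)
    ultimately show "y \<in> F ` pr E" by blast
  next
    fix y assume "y \<in> F ` pr E"
    then obtain x where x: "x \<in> pr E" "y = F x" by blast
    have "y - (y $ m) *\<^sub>R ?e = L (x - (x $ m) *\<^sub>R ?e)" using x(2) Fm[of x] Fx[of x] by simp
    then show "y \<in> pr (L ` E)" using x Fm[of x] by (auto simp: pr_def)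
  qed
  moreover have prE: "pr E \<in> sets borel"
  proof -
    have "(\<lambda>x. x - (x $ m) *\<^sub>R ?e) -` E \<inter> space borel \<in> sets borel"
      by (rule measurable_sets[OF borel_measurable_continuous_onI E(1)]) (intro continuous_intros)
    moreover have "closed {x :: real^'n. 0 \<le> x $ m \<and> x $ m \<le> 1}"
      by (intro closed_Collect_conj closed_Collect_le continuous_intros)
    ultimately have "{x :: real^'n. 0 \<le> x $ m \<and> x $ m \<le> 1} \<inter> ((\<lambda>x. x - (x $ m) *\<^sub>R ?e) -` E \<inter> space borel) \<in> sets borel"
      by (intro sets.Int) auto
    then show ?thesis by (rule back_subst[of "\<lambda>S. S \<in> sets borel"]) (auto simp: pr_def)
  qed
  ultimately have "emeasure lborel (pr (L ` E)) = ennreal \<bar>det (matrix L) * v $ m\<bar> * emeasure lborel (pr E)"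
    using emeasure_linear_image_cart[OF F prE] detF by simp
  moreover have "emeasure lborel (pr (L ` E)) = ennreal \<kappa> * hausdorff_outer ?k (L ` E)"
    unfolding pr_def using E(2) LV sets_borel_linear_image[OF L E(1)] by (intro \<kappa>eq[rule_format]) auto
  moreover have "emeasure lborel (pr E) = ennreal \<kappa> * hausdorff_outer ?k E"
    unfolding pr_def using E by (intro \<kappa>eq[rule_format]) auto
  ultimately have "ennreal \<kappa> * hausdorff_outer ?k (L ` E)
      = ennreal \<kappa> * (ennreal \<bar>det (matrix L) * v $ m\<bar> * hausdorff_outer ?k E)"
    by (simp add: mult_ac)
  then have "hausdorff_outer ?k (L ` E) = ennreal \<bar>det (matrix L) * v $ m\<bar> * hausdorff_outer ?k E"
    using \<kappa> by (subst (asm) ennreal_mult_cancel_left) auto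
  also have "\<dots> \<le> ennreal (\<bar>det (matrix L)\<bar> * B) * hausdorff_outer ?k E"
  proof (intro mult_right_mono ennreal_leI)
    have "\<bar>v $ m\<bar> \<le> norm v" by (rule component_le_norm_cart)
    also have "\<dots> \<le> B" using B[of v] v by simp
    finally show "\<bar>det (matrix L) * v $ m\<bar> \<le> \<bar>det (matrix L)\<bar> * B" by (simp add: abs_mult mult_left_mono)
  qed simp
  finally show ?thesis .
qed

text \<open>Rotations before and after \<open>L\<close> turn the hyperplane and its image into the
  same coordinate hyperplane; they change neither Hausdorff measure, nor norms, nor the absolute
  determinant. A Borel hull inside the hyperplane removes the measurability assumption on
  \<open>E\<close>.\<close>

lemma hausdorff_linear_image_hyperplane:
  fixes L :: "real^'n \<Rightarrow> real^'n" and \<nu> :: "real^'n"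
  assumes n: "2 \<le> CARD('n)" and L: "linear L" "inj L"
    and B: "\<And>x. norm x \<le> B * norm (L x)" and \<nu>: "norm \<nu> = 1" and E: "\<And>x. x \<in> E \<Longrightarrow> x \<bullet> \<nu> = 0"
  shows "hausdorff_outer (CARD('n) - 1) (L ` E) \<le> ennreal (\<bar>det (matrix L)\<bar> * B) * hausdorff_outer (CARD('n) - 1) E"
proof -
  let ?k = "CARD('n) - 1"
  fix m :: 'n
  let ?e = "axis m (1::real) :: real^'n"
  obtain g where g: "linear g" "g \<circ> L = id" using linear_injective_left_inverse[OF L] by blast
  then have gL: "g (L x) = x" for x by (auto simp: fun_eq_iff)
  \<comment> \<open>The adjoint of the inverse sends a normal vector of a hyperplane to a normal
    vector of its image under \<open>L\<close>.\<close>
  define \<omega> where "\<omega> = adjoint g \<nu>"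
  have \<omega>: "L x \<bullet> \<omega> = x \<bullet> \<nu>" for x
    unfolding \<omega>_def using adjoint_works[OF g(1), of "L x" \<nu>] gL by simp
  have "\<omega> \<noteq> 0" using \<omega>[of \<nu>] \<nu> by (auto simp: dot_square_norm)
  define \<omega>' where "\<omega>' = \<omega> /\<^sub>R norm \<omega>"
  have "norm \<omega>' = 1" using \<open>\<omega> \<noteq> 0\<close> by (simp add: \<omega>'_def)
  then obtain R2 where R2: "orthogonal_transformation R2" "R2 \<omega>' = ?e"
    using orthogonal_transformation_exists_1[of \<omega>' ?e] by auto
  obtain R1 where R1: "orthogonal_transformation R1" "R1 ?e = \<nu>"
    using orthogonal_transformation_exists_1[of ?e \<nu>] \<nu> by auto
  have lin: "linear R1" "linear R2" using R1 R2 orthogonal_transformation_linear by blast+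
  have norms: "norm (R1 x) = norm x" "norm (R2 x) = norm x" for x
    using R1 R2 orthogonal_transformation by blast+
  have dists: "dist (R1 x) (R1 y) = dist x y" "dist (R2 x) (R2 y) = dist x y" for x y
    using norms[of "x - y"] by (simp_all add: dist_norm linear_diff[OF lin(1)] linear_diff[OF lin(2)])
  define L0 where "L0 = R2 \<circ> (L \<circ> R1)"
  have L0: "linear L0" "inj L0" unfolding L0_def
    using lin L orthogonal_transformation_inj[OF R1(1)] orthogonal_transformation_inj[OF R2(1)]
    by (auto intro!: linear_compose inj_compose)
  have detL0: "\<bar>det (matrix L0)\<bar> = \<bar>det (matrix L)\<bar>"
    unfolding L0_def using lin L R1(1) R2(1)
    by (simp add: matrix_compose linear_compose det_mul abs_mult)
  have comp: "x $ m = x \<bullet> ?e" for x :: "real^'n" by (simp add: inner_axis)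
  have LV: "L0 x $ m = 0" if "x $ m = 0" for x
  proof -
    have "R1 x \<bullet> \<nu> = x \<bullet> ?e" using R1 unfolding orthogonal_transformation_def by metis
    then have "L (R1 x) \<bullet> \<omega> = 0" using \<omega> that comp by simp
    then have "L (R1 x) \<bullet> \<omega>' = 0" by (simp add: \<omega>'_def)
    moreover have "R2 (L (R1 x)) \<bullet> R2 \<omega>' = L (R1 x) \<bullet> \<omega>'" using R2(1) unfolding orthogonal_transformation_def by blast
    ultimately show ?thesis by (simp add: L0_def comp R2(2))
  qed
  have B0: "norm x \<le> B * norm (L0 x)" for x using B[of "R1 x"] by (simp add: L0_def norms)
  define E0 where "E0 = {x. R1 x \<in> E}"
  have RE: "R1 ` E0 = E" using orthogonal_transformation_surj[OF R1(1)] by (auto simp: E0_def surj_def)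
  have E0V: "E0 \<subseteq> {x. x $ m = 0}"
  proof
    fix x assume "x \<in> E0"
    then have "R1 x \<bullet> R1 ?e = 0" using E R1(2) by (simp add: E0_def)
    then have "x \<bullet> ?e = 0" using R1(1) unfolding orthogonal_transformation_def by metis
    then show "x \<in> {x. x $ m = 0}" by (simp add: comp)
  qed
  have HE0: "hausdorff_outer ?k E0 = hausdorff_outer ?k E"
    using hausdorff_outer_isometry[of E0 R1 ?k] dists RE by simp
  obtain B1 where B1: "B1 \<in> sets borel" "E0 \<subseteq> B1" "hausdorff_outer ?k B1 = hausdorff_outer ?k E0"
    by (rule hausdorff_borel_hull)
  define B2 where "B2 = B1 \<inter> {x. x $ m = 0}"
  have "closed {x :: real^'n. x $ m = 0}" by (intro closed_Collect_eq continuous_intros)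
  then have B2: "B2 \<in> sets borel" using B1(1) by (auto simp: B2_def)
  have "hausdorff_outer ?k (L ` E) = hausdorff_outer ?k (R2 ` L ` E)"
    using dists by (intro hausdorff_outer_isometry[symmetric]) auto
  also have "R2 ` L ` E = L0 ` E0" by (simp add: L0_def RE[symmetric] image_image o_def)
  also have "hausdorff_outer ?k (L0 ` E0) \<le> hausdorff_outer ?k (L0 ` B2)"
    using B1(2) E0V by (intro hausdorff_outer_mono image_mono) (auto simp: B2_def)
  also have "\<dots> \<le> ennreal (\<bar>det (matrix L0)\<bar> * B) * hausdorff_outer ?k B2"
    by (intro hausdorff_linear_image_coordinate_hyperplane[OF n L0 LV B0 B2]) (auto simp: B2_def)
  also have "\<dots> \<le> ennreal (\<bar>det (matrix L0)\<bar> * B) * hausdorff_outer ?k E0"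
    using B1(3) hausdorff_outer_mono[of B2 B1 ?k] by (intro mult_left_mono) (auto simp: B2_def)
  finally show ?thesis unfolding HE0 detL0 .
qed

text \<open>
  If \<open>f\<close> is close to an affine map with inverse \<open>L\<close> and \<open>f ` E\<close> is nearly orthogonal to \<open>\<nu>\<close>, then
  \<open>E\<close> is a Lipschitz image, with constant close to \<open>1\<close>, of \<open>L\<close> applied to the projection of \<open>f ` E\<close>
  along \<open>\<nu>\<close>.
\<close>

lemma hausdorff_hypersurface_piece_le:
  fixes f L :: "real^'n \<Rightarrow> real^'n"
  assumes n: "2 \<le> CARD('n)" and L: "linear L" "inj L"
    and B: "\<And>x. norm x \<le> B * norm (L x)" and C: "\<And>w. norm (L w) \<le> C * norm w"
    and \<nu>: "norm \<nu> = 1" and \<theta>: "0 \<le> \<theta>" "5 * \<theta> < 1"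
    and near: "\<And>x z. \<lbrakk>x \<in> E; z \<in> E\<rbrakk> \<Longrightarrow> norm (L (f z - f x) - (z - x)) \<le> 3 * \<theta> * norm (z - x)"
    and flat: "\<And>x z. \<lbrakk>x \<in> E; z \<in> E\<rbrakk> \<Longrightarrow> C * \<bar>(f z - f x) \<bullet> \<nu>\<bar> \<le> 2 * \<theta> * norm (z - x)"
  shows "hausdorff_outer (CARD('n) - 1) E
    \<le> ennreal ((1 / (1 - 5 * \<theta>)) ^ (CARD('n) - 1) * (\<bar>det (matrix L)\<bar> * B)) * hausdorff_outer (CARD('n) - 1) (f ` E)"
proof -
  let ?k = "CARD('n) - 1"
  define \<pi> where "\<pi> w = w - (w \<bullet> \<nu>) *\<^sub>R \<nu>" for w
  define g where "g x = L (\<pi> (f x))" for x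
  have \<nu>\<nu>: "\<nu> \<bullet> \<nu> = 1" using \<nu> by (simp add: dot_square_norm)
  have \<pi>diff: "\<pi> w - \<pi> w' = \<pi> (w - w')" for w w' by (simp add: \<pi>_def inner_diff_left algebra_simps)
  have \<pi>orth: "\<pi> w \<bullet> \<nu> = 0" for w by (simp add: \<pi>_def inner_diff_left \<nu>\<nu>)
  have \<pi>le: "norm (\<pi> w) \<le> norm w" for w
  proof -
    have "\<pi> w \<bullet> \<pi> w = w \<bullet> w - (w \<bullet> \<nu>)\<^sup>2"
      by (simp add: \<pi>_def inner_diff_left inner_diff_right \<nu>\<nu> power2_eq_square inner_commute)
    then show ?thesis by (simp add: norm_le)
  qed
  have B0: "0 \<le> B"
  proof (rule ccontr)
    assume "\<not> 0 \<le> B"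
    then have "B * norm (L \<nu>) \<le> 0" by (intro mult_nonpos_nonneg) auto
    then show False using B[of \<nu>] \<nu> by linarith
  qed
  \<comment> \<open>Projecting along \<nu> costs at most 2\<theta> and the deviation of
    \<open>f\<close> from affine at most 3\<theta>, both relative to the distance of the two points;
    together this is the 5\<theta>.\<close>
  have low: "(1 - 5 * \<theta>) * dist x z \<le> dist (g x) (g z)" if "x \<in> E" "z \<in> E" for x z
  proof -
    let ?w = "f z - f x"
    have "g z - g x = L (\<pi> ?w)" by (simp add: g_def linear_diff[OF L(1), symmetric] \<pi>diff)
    also have "\<dots> = L ?w - (?w \<bullet> \<nu>) *\<^sub>R L \<nu>"
      by (simp add: \<pi>_def linear_diff[OF L(1)] linear_scale[OF L(1)])
    finally have eq: "z - x = (g z - g x) + (?w \<bullet> \<nu>) *\<^sub>R L \<nu> - (L ?w - (z - x))" by simp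
    have "norm (z - x) \<le> norm ((g z - g x) + (?w \<bullet> \<nu>) *\<^sub>R L \<nu>) + norm (L ?w - (z - x))"
      by (subst eq) (rule norm_triangle_ineq4)
    also have "\<dots> \<le> norm (g z - g x) + norm ((?w \<bullet> \<nu>) *\<^sub>R L \<nu>) + norm (L ?w - (z - x))"
      by (intro add_right_mono norm_triangle_ineq)
    also have "norm ((?w \<bullet> \<nu>) *\<^sub>R L \<nu>) \<le> C * \<bar>?w \<bullet> \<nu>\<bar>"
      using mult_left_mono[OF C[of \<nu>], of "\<bar>?w \<bullet> \<nu>\<bar>"] \<nu> by (simp add: mult.commute)
    also have "\<dots> \<le> 2 * \<theta> * norm (z - x)" by (rule flat[OF that])
    also have "norm (L ?w - (z - x)) \<le> 3 * \<theta> * norm (z - x)" by (rule near[OF that])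
    finally show ?thesis by (simp add: dist_norm norm_minus_commute algebra_simps)
  qed
  have pos: "0 < 1 - 5 * \<theta>" using \<theta> by simp
  have inj: "inj_on g E"
  proof (rule inj_onI)
    fix x z assume xz: "x \<in> E" "z \<in> E" "g x = g z"
    then have "(1 - 5 * \<theta>) * dist x z \<le> 0" using low[of x z] by simp
    then show "x = z" using pos by (simp add: mult_le_0_iff)
  qed
  have "hausdorff_outer ?k (the_inv_into E g ` (g ` E)) \<le> ennreal ((1 / (1 - 5 * \<theta>)) ^ ?k) * hausdorff_outer ?k (g ` E)"
  proof (rule hausdorff_outer_lipschitz_image)
    show "0 < 1 / (1 - 5 * \<theta>)" using pos by simp
    show "dist (the_inv_into E g a) (the_inv_into E g b) \<le> 1 / (1 - 5 * \<theta>) * dist a b"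
      if "a \<in> g ` E" "b \<in> g ` E" for a b
      using that low pos by (auto simp: the_inv_into_f_f[OF inj] field_simps)
  qed
  also have "the_inv_into E g ` (g ` E) = E" using inj by (simp add: image_image the_inv_into_f_f)
  also have "g ` E = L ` (\<pi> ` f ` E)" by (auto simp: g_def)
  also have "hausdorff_outer ?k (L ` (\<pi> ` f ` E)) \<le> ennreal (\<bar>det (matrix L)\<bar> * B) * hausdorff_outer ?k (\<pi> ` f ` E)"
    by (rule hausdorff_linear_image_hyperplane[OF n L B \<nu>]) (use \<pi>orth in auto)
  also have "hausdorff_outer ?k (\<pi> ` f ` E) \<le> ennreal (1 ^ ?k) * hausdorff_outer ?k (f ` E)"
    by (rule hausdorff_outer_lipschitz_image) (auto simp: dist_norm \<pi>diff \<pi>le)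
  finally show ?thesis
    using B0 pos by (simp add: mult_left_mono ennreal_mult mult.assoc)
qed

section \<open>Pieces on which the derivative is almost constant\<close>

text \<open>
  On a good piece the data of \<open>f\<close> are almost constant: \<open>b\<close> is close to \<open>|J|\<close> and bounds the change of
  volume under \<open>f\<close>, while \<open>c\<close> is close to \<open>\<parallel>f'\<parallel> / |J|\<close> and bounds the change of area under the inverse
  of \<open>f\<close>, on preimages of spheres about \<open>y0\<close>.
\<close>

definition good_piece :: "(real^'n \<Rightarrow> real^'n) \<Rightarrow> real^'n \<Rightarrow> real \<Rightarrow> (real^'n) set \<Rightarrow> bool" where
  "good_piece f y0 \<eta> K \<longleftrightarrow> inj_on f K \<and> (\<forall>x\<in>K. f differentiable (at x) \<and> jacobian_det f x \<noteq> 0) \<and>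
    (\<exists>b c. 0 < b \<and> 0 < c \<and>
      (\<forall>x\<in>K. b \<le> (1 + \<eta>) * \<bar>jacobian_det f x\<bar> \<and>
        c * \<bar>jacobian_det f x\<bar> \<le> (1 + \<eta>) * onorm (frechet_derivative f (at x))) \<and>
      (\<forall>E\<subseteq>K. E \<in> sets lebesgue \<longrightarrow> f ` E \<in> sets borel \<longrightarrow>
        emeasure lborel (f ` E) \<le> ennreal b * emeasure lebesgue E) \<and>
      (\<forall>r. \<forall>E\<subseteq>K \<inter> {x. dist (f x) y0 = r}.
        hausdorff_outer (CARD('n) - 1) E \<le> ennreal c * hausdorff_outer (CARD('n) - 1) (f ` E)))"

lemma good_piece_subset:
  fixes f :: "real^'n \<Rightarrow> real^'n"
  assumes "good_piece f y0 \<eta> K" "K' \<subseteq> K"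
  shows "good_piece f y0 \<eta> K'"
proof -
  from assms(1) obtain b c where *: "inj_on f K" "\<forall>x\<in>K. f differentiable (at x) \<and> jacobian_det f x \<noteq> 0"
    "0 < b" "0 < c"
    "\<forall>x\<in>K. b \<le> (1 + \<eta>) * \<bar>jacobian_det f x\<bar> \<and>
        c * \<bar>jacobian_det f x\<bar> \<le> (1 + \<eta>) * onorm (frechet_derivative f (at x))"
    "\<forall>E\<subseteq>K. E \<in> sets lebesgue \<longrightarrow> f ` E \<in> sets borel \<longrightarrow>
        emeasure lborel (f ` E) \<le> ennreal b * emeasure lebesgue E"
    "\<forall>r. \<forall>E\<subseteq>K \<inter> {x. dist (f x) y0 = r}.
        hausdorff_outer (CARD('n) - 1) E \<le> ennreal c * hausdorff_outer (CARD('n) - 1) (f ` E)"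
    unfolding good_piece_def by (elim conjE exE) (rule that)
  show ?thesis unfolding good_piece_def
  proof (intro conjI, goal_cases)
    case 3
    show ?case
    proof (rule exI[of _ b], rule exI[of _ c], intro conjI)
      show "\<forall>E\<subseteq>K'. E \<in> sets lebesgue \<longrightarrow> f ` E \<in> sets borel \<longrightarrow>
          emeasure lborel (f ` E) \<le> ennreal b * emeasure lebesgue E"
        using *(6) assms(2) by (meson order_trans)
      show "\<forall>r. \<forall>E\<subseteq>K' \<inter> {x. dist (f x) y0 = r}.
          hausdorff_outer (CARD('n) - 1) E \<le> ennreal c * hausdorff_outer (CARD('n) - 1) (f ` E)"
        using *(7) assms(2) by (meson Int_mono order_refl order_trans)
      show "0 < b" by (rule *(3))
      show "0 < c" by (rule *(4))
      show "\<forall>x\<in>K'. b \<le> (1 + \<eta>) * \<bar>jacobian_det f x\<bar> \<and>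
          c * \<bar>jacobian_det f x\<bar> \<le> (1 + \<eta>) * onorm (frechet_derivative f (at x))"
        using *(5) assms(2) by blast
    qed
  next
    case 1
    show ?case using *(1) assms(2) by (rule inj_on_subset)
  next
    case 2
    show ?case using *(2) assms(2) by blast
  qed
qed

section \<open>Estimates near one point of differentiability\<close>

text \<open>A chord of a sphere is orthogonal to the sum of the two radius vectors of its endpoints,
  and \<open>b - y0\<close> differs from half of this sum by at most \<open>t\<close>. Hence pieces
  of spheres about \<open>y0\<close> are nearly flat with normal \<open>b - y0\<close>, uniformly in
  \<open>r\<close>.\<close>

lemma inner_near_normal_bound:
  fixes y y' b y0 :: "'a::real_inner"
  assumes "dist y y0 = r" "dist y' y0 = r" "dist y b \<le> t" "dist y' b \<le> t"
  shows "\<bar>(y' - y) \<bullet> (b - y0)\<bar> \<le> norm (y' - y) * t"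
proof -
  have "(y' - y) \<bullet> ((y' - y0) + (y - y0)) = (y' - y0) \<bullet> (y' - y0) - (y - y0) \<bullet> (y - y0)"
    by (simp add: inner_add_right inner_diff_left inner_diff_right inner_commute)
  also have "\<dots> = 0" using assms(1,2) by (simp add: dist_norm dot_square_norm)
  finally have 0: "(y' - y) \<bullet> ((y' - y0) + (y - y0)) = 0" .
  have eq: "(b - y') + (b - y) = 2 *\<^sub>R (b - y0) - ((y' - y0) + (y - y0))" by (simp add: scaleR_2)
  have "2 * ((y' - y) \<bullet> (b - y0)) = (y' - y) \<bullet> ((b - y') + (b - y))"
    unfolding eq by (simp only: inner_diff_right inner_scaleR_right 0)
  also have "\<bar>\<dots>\<bar> \<le> norm (y' - y) * norm ((b - y') + (b - y))" by (rule Cauchy_Schwarz_ineq2)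
  also have "\<dots> \<le> norm (y' - y) * (2 * t)"
    using norm_triangle_ineq[of "b - y'" "b - y"] assms(3,4)
    by (intro mult_left_mono) (auto simp: dist_norm norm_minus_commute)
  finally show ?thesis by simp
qed

lemma norm_matrix_mult_le:
  fixes A :: "real^'n^'n"
  shows "norm (A *v x) \<le> real CARD('n) * real CARD('n) * norm A * norm x"
proof -
  have "\<bar>A $ i $ j\<bar> \<le> norm A" for i j
    by (rule order_trans[OF component_le_norm_cart Finite_Cartesian_Product.norm_nth_le])
  then have "onorm ((*v) A) \<le> real CARD('n) * real CARD('n) * norm A" by (rule onorm_le_matrix_component)
  then have "onorm ((*v) A) * norm x \<le> real CARD('n) * real CARD('n) * norm A * norm x"
    by (intro mult_right_mono) auto
  moreover have "norm (A *v x) \<le> onorm ((*v) A) * norm x" by (intro onorm) simp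
  ultimately show ?thesis by linarith
qed

lemma continuous_on_det: "continuous_on UNIV (det :: real^'n^'n \<Rightarrow> real)"
proof -
  have "continuous_on UNIV (\<lambda>A :: real^'n^'n. A $ i $ j)" for i j
    by (intro continuous_on_component continuous_on_id)
  then show ?thesis unfolding det_def
    by (intro continuous_on_sum continuous_on_mult[OF continuous_on_const] continuous_on_prod)
qed

text \<open>All of \<open>f\<close> on the piece is compared with the affine map given by the
  derivative \<open>T\<close> at \<open>x0\<close>. One tolerance \<delta> bounds both the variation
  of the derivative and the error of linear approximation, and every constant tends to its value at
  \<open>x0\<close> as \<delta> shrinks.\<close>

lemma good_piece_locally:
  fixes f :: "real^'n \<Rightarrow> real^'n"
  assumes n: "2 \<le> CARD('n)" and \<eta>: "0 < \<eta>"
    and diff: "f differentiable (at x0)" and J: "jacobian_det f x0 \<noteq> 0" and y0: "f x0 \<noteq> y0"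
  shows "\<exists>\<delta>>0. \<forall>K. (\<forall>x\<in>K. f differentiable (at x) \<and>
      dist (x, matrix (frechet_derivative f (at x))) (x0, matrix (frechet_derivative f (at x0))) < \<delta>) \<and>
    (\<forall>x\<in>K. \<forall>z\<in>K. norm (f z - f x - frechet_derivative f (at x) (z - x)) \<le> \<delta> * norm (z - x))
    \<longrightarrow> good_piece f y0 \<eta> K"
proof -
  let ?n = "CARD('n)" let ?k = "?n - 1"
  define N2 where "N2 = real ?n * real ?n"
  have N2: "1 \<le> N2" 
  proof -
    have "1 \<le> real ?n" using n by simp
    then show ?thesis unfolding N2_def by (rule mult_ge1_I) (use n in simp)
  qed
  let ?F = "\<lambda>x. frechet_derivative f (at x)"
  define T where "T = ?F x0"
  have linF: "linear (?F x)" if "f differentiable (at x)" for x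
    using that by (intro linear_frechet_derivative)
  have T: "linear T" using linF[OF diff] by (simp add: T_def)
  define d0 where "d0 = det (matrix T)"
  have d0: "d0 \<noteq> 0" using J by (simp add: d0_def T_def jacobian_det_def)
  have injT: "inj T" using det_nz_iff_inj[OF T] d0 by (simp add: d0_def)
  obtain L where L: "linear L" "L \<circ> T = id" using linear_injective_left_inverse[OF T injT] by blast
  have TL: "T \<circ> L = id" using linear_inverse_left[OF L(1) T] L(2) by blast
  have LT: "L (T x) = x" and TL': "T (L x) = x" for x using L(2) TL by (auto simp: fun_eq_iff)
  have injL: "inj L" using TL' by (metis injI)
  have detL: "\<bar>det (matrix L)\<bar> = 1 / \<bar>d0\<bar>"
  proof -
    have "det (matrix T) * det (matrix L) = 1"
    proof -
      have "matrix (id :: real^'n \<Rightarrow> real^'n) = mat 1"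
        by (simp add: matrix_def mat_def axis_def vec_eq_iff)
      then have "matrix T ** matrix L = mat 1" using matrix_compose[OF L(1) T] TL by simp
      then show ?thesis by (metis det_I det_mul)
    qed
    then show ?thesis using d0 unfolding d0_def by (metis abs_mult abs_one nonzero_eq_divide_eq abs_0_eq mult.commute)
  qed
  define B where "B = onorm T"
  define C where "C = onorm L"
  have bT: "bounded_linear T" and bL: "bounded_linear L" using T L(1) linear_conv_bounded_linear by auto
  have T_le: "norm (T v) \<le> B * norm v" for v unfolding B_def by (rule onorm[OF bT])
  have L_le: "norm (L v) \<le> C * norm v" for v unfolding C_def by (rule onorm[OF bL])
  have B_le: "norm v \<le> B * norm (L v)" for v using T_le[of "L v"] TL' by simp
  obtain e :: "real^'n" where e: "norm e = 1" using vector_choose_size[of 1] by auto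
  have Bpos: "0 < B"
    using B_le[of e] e by (smt (verit) norm_ge_zero mult_nonpos_nonneg)
  have Cpos: "0 < C"
  proof -
    have "norm e \<le> C * norm (T e)" using L_le[of "T e"] LT by simp
    then show ?thesis using e by (smt (verit) norm_ge_zero mult_nonpos_nonneg)
  qed
  \<comment> \<open>Up to three factors 1 + \<eta>1 accumulate below, and (1 + \<eta>1)^3 \<le> 1 +
    7 \<eta>1 when \<eta>1 \<le> 1.\<close>
  define \<eta>1 where "\<eta>1 = min 1 (\<eta> / 7)"
  have \<eta>1: "0 < \<eta>1" "(1 + \<eta>1) * (1 + \<eta>1) * (1 + \<eta>1) \<le> 1 + \<eta>" "(1 + \<eta>1) * (1 + \<eta>1) \<le> 1 + \<eta>"
  proof -
    have 0: "0 < \<eta>1" "\<eta>1 \<le> 1" "7 * \<eta>1 \<le> \<eta>" using \<eta> by (auto simp: \<eta>1_def)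
    have a: "\<eta>1 * \<eta>1 \<le> \<eta>1" using 0 by (simp add: mult_left_le)
    have b: "\<eta>1 * \<eta>1 * \<eta>1 \<le> \<eta>1" using 0 a by (smt (verit) mult_left_le mult_nonneg_nonneg)
    have "(1 + \<eta>1) * (1 + \<eta>1) * (1 + \<eta>1) = 1 + 3 * \<eta>1 + 3 * (\<eta>1 * \<eta>1) + \<eta>1 * \<eta>1 * \<eta>1" by (simp add: algebra_simps)
    then show "(1 + \<eta>1) * (1 + \<eta>1) * (1 + \<eta>1) \<le> 1 + \<eta>" using a b 0 by linarith
    have "(1 + \<eta>1) * (1 + \<eta>1) = 1 + 2 * \<eta>1 + \<eta>1 * \<eta>1" by (simp add: algebra_simps)
    then show "(1 + \<eta>1) * (1 + \<eta>1) \<le> 1 + \<eta>" using a 0 by linarith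
    show "0 < \<eta>1" by (rule 0)
  qed
  obtain \<theta> where \<theta>: "0 < \<theta>" "5 * \<theta> < 1" "(1 + 3 * \<theta>) ^ ?n \<le> 1 + \<eta>1" "(1 / (1 - 5 * \<theta>)) ^ ?k \<le> 1 + \<eta>1"
  proof -
    have "((\<lambda>t. (1 + 3 * t) ^ ?n) \<longlongrightarrow> (1 + 3 * 0) ^ ?n) (at_right (0::real))" by (intro tendsto_intros)
    then have e1: "\<forall>\<^sub>F t in at_right 0. (1 + 3 * t) ^ ?n < 1 + \<eta>1" by (rule order_tendstoD) (use \<eta>1 in simp)
    have "((\<lambda>t. (1 / (1 - 5 * t)) ^ ?k) \<longlongrightarrow> (1 / (1 - 5 * 0)) ^ ?k) (at_right (0::real))"
      by (intro tendsto_intros) auto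
    then have e2: "\<forall>\<^sub>F t in at_right 0. (1 / (1 - 5 * t)) ^ ?k < 1 + \<eta>1" by (rule order_tendstoD) (use \<eta>1 in simp)
    have e3: "\<forall>\<^sub>F t in at_right 0. t \<in> {0<..<1/5::real}" by (rule eventually_at_right_real) simp
    from e1 e2 e3 have "\<forall>\<^sub>F t in at_right 0. (1 + 3 * t) ^ ?n < 1 + \<eta>1 \<and> (1 / (1 - 5 * t)) ^ ?k < 1 + \<eta>1 \<and> t \<in> {0<..<1/5}"
      by eventually_elim simp
    then obtain t where "(1 + 3 * t) ^ ?n < 1 + \<eta>1 \<and> (1 / (1 - 5 * t)) ^ ?k < 1 + \<eta>1 \<and> t \<in> {0<..<1/5}"
      using eventually_happens trivial_limit_at_right_real by blast
    then show thesis by (intro that[of t]) auto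
  qed
  define \<rho> where "\<rho> = dist (f x0) y0"
  have \<rho>: "0 < \<rho>" using y0 by (simp add: \<rho>_def)
  \<comment> \<open>The closeness of image points to \<open>f x0\<close> that makes the deviation
    from the tangent plane, after scaling by \<open>C\<close> and \<open>B\<close>, come out as
    exactly \<open>2 * \<theta>\<close>.\<close>
  define t where "t = \<theta> * \<rho> / (C * B)"
  have t: "0 < t" using \<theta> \<rho> Cpos Bpos by (simp add: t_def)
  have "isCont f x0" using diff differentiable_imp_continuous_within by blast
  then obtain \<delta>1 where \<delta>1: "0 < \<delta>1" "\<And>x. dist x x0 < \<delta>1 \<Longrightarrow> dist (f x) (f x0) < t"
    using t unfolding continuous_at_eps_delta by blast
  \<comment> \<open>This is the smaller of the two margins |d0| (1 - 1 / (1 + \<eta>1)) and |d0|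
    \<eta>1, so it controls the Jacobian within the factor 1 + \<eta>1 from both sides.\<close>
  define s where "s = \<bar>d0\<bar> * (1 - 1 / (1 + \<eta>1))"
  have s: "0 < s" using d0 \<eta>1 by (simp add: s_def)
  have s': "s \<le> \<bar>d0\<bar> * \<eta>1"
  proof -
    have "1 - 1 / (1 + \<eta>1) \<le> \<eta>1" using \<eta>1(1) by (simp add: field_simps)
    then show ?thesis unfolding s_def by (intro mult_left_mono) auto
  qed
  have "isCont det (matrix T)" using continuous_on_det[where 'n = 'n] by (simp add: continuous_on_eq_continuous_at)
  then obtain \<delta>2 where \<delta>2: "0 < \<delta>2" "\<And>M. dist M (matrix T) < \<delta>2 \<Longrightarrow> \<bar>det M - d0\<bar> < s"
    using s unfolding continuous_at_eps_delta dist_real_def d0_def by blast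
  \<comment> \<open>The four entries secure, in this order, the position of \<open>f x\<close>, the
    Jacobian, the closeness of \<open>L \<circ> f\<close> to a translation, and a lower bound for
    the norm of the derivative.\<close>
  define \<delta> where "\<delta> = Min {\<delta>1, \<delta>2, \<theta> / (C * N2), B * (1 - 1 / (1 + \<eta>1)) / N2}"
  have \<delta>: "0 < \<delta>" unfolding \<delta>_def using \<delta>1 \<delta>2 \<theta> Cpos N2 Bpos \<eta>1 by simp
  have \<delta>_le: "\<delta> \<le> \<delta>1" "\<delta> \<le> \<delta>2" "\<delta> \<le> \<theta> / (C * N2)" "\<delta> \<le> B * (1 - 1 / (1 + \<eta>1)) / N2" by (auto simp: \<delta>_def)
  have \<delta>C: "C * (N2 * \<delta>) \<le> \<theta>" using \<delta>_le(3) Cpos N2 by (simp add: pos_le_divide_eq mult_ac)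
  have \<delta>B: "N2 * \<delta> \<le> B * (1 - 1 / (1 + \<eta>1))" using \<delta>_le(4) N2 by (simp add: pos_le_divide_eq mult_ac)
  have "good_piece f y0 \<eta> K"
    if K1: "\<And>x. x \<in> K \<Longrightarrow> f differentiable (at x)"
      "\<And>x. x \<in> K \<Longrightarrow> dist (x, matrix (?F x)) (x0, matrix T) < \<delta>"
    and K2: "\<And>x z. \<lbrakk>x \<in> K; z \<in> K\<rbrakk> \<Longrightarrow> norm (f z - f x - ?F x (z - x)) \<le> \<delta> * norm (z - x)" for K
  proof -
    have Kx: "dist x x0 < \<delta>" "dist (matrix (?F x)) (matrix T) < \<delta>" if "x \<in> K" for x
      using K1(2)[OF that] dist_fst_le[of "(x, matrix (?F x))" "(x0, matrix T)"]
        dist_snd_le[of "(x, matrix (?F x))" "(x0, matrix T)"] by auto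
    have FT: "norm (?F x h - T h) \<le> N2 * \<delta> * norm h" if "x \<in> K" for x h
    proof -
      have "?F x h - T h = (matrix (?F x) - matrix T) *v h"
        by (simp only: matrix_vector_mult_diff_rdistrib
            fun_cong[OF matrix_vector_mul(2)[OF T]] fun_cong[OF matrix_vector_mul(2)[OF linF[OF K1(1)[OF that]]]])
      then have "norm (?F x h - T h) \<le> N2 * norm (matrix (?F x) - matrix T) * norm h"
        using norm_matrix_mult_le[of "matrix (?F x) - matrix T" h] by (simp add: N2_def)
      also have "\<dots> \<le> N2 * \<delta> * norm h"
        using Kx(2)[OF that] N2 by (intro mult_right_mono mult_left_mono) (auto simp: dist_norm)
      finally show ?thesis .
    qed
    have near: "norm (L (f z - f x) - (z - x)) \<le> 3 * \<theta> * norm (z - x)" if xz: "x \<in> K" "z \<in> K" for x z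
    proof -
      let ?h = "z - x"
      have "L (f z - f x) - ?h = L (f z - f x - ?F x ?h) + L (?F x ?h - T ?h)"
        by (simp add: linear_add[OF L(1), symmetric] linear_diff[OF L(1)] LT)
      then have "norm (L (f z - f x) - ?h) \<le> norm (L (f z - f x - ?F x ?h)) + norm (L (?F x ?h - T ?h))"
        by (metis norm_triangle_ineq)
      also have "\<dots> \<le> C * (\<delta> * norm ?h) + C * (N2 * \<delta> * norm ?h)"
        using L_le[of "f z - f x - ?F x ?h"] L_le[of "?F x ?h - T ?h"] K2[OF xz] FT[OF xz(1), of ?h] Cpos
        by (intro add_mono) (auto elim: order_trans intro: mult_left_mono)
      also have "\<dots> = (C * \<delta> + C * (N2 * \<delta>)) * norm ?h" by (simp add: algebra_simps)
      also have "\<dots> \<le> 3 * \<theta> * norm ?h"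
      proof (rule mult_right_mono)
        have "C * \<delta> \<le> C * (N2 * \<delta>)" using Cpos N2 \<delta> by (intro mult_left_mono) (use mult_right_mono[of 1 N2 \<delta>] in auto)
        then show "C * \<delta> + C * (N2 * \<delta>) \<le> 3 * \<theta>" using \<delta>C \<theta>(1) by linarith
      qed simp
      finally show ?thesis .
    qed
    have inj: "inj_on f K"
    proof (rule inj_onI)
      fix x z assume xz: "x \<in> K" "z \<in> K" "f x = f z"
      then have "norm (z - x) \<le> 3 * \<theta> * norm (z - x)"
        using near[of x z] linear_0[OF L(1)] by (simp add: norm_minus_commute)
      moreover have "3 * \<theta> * norm (z - x) \<le> 3 / 5 * norm (z - x)" using \<theta> by (intro mult_right_mono) auto
      ultimately have "norm (z - x) \<le> 0" by linarith
      then show "x = z" by simp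
    qed
    have Jx: "jacobian_det f x \<noteq> 0" "\<bar>d0\<bar> \<le> (1 + \<eta>1) * \<bar>jacobian_det f x\<bar>" "\<bar>jacobian_det f x\<bar> \<le> (1 + \<eta>1) * \<bar>d0\<bar>" if "x \<in> K" for x
    proof -
      have ds: "\<bar>jacobian_det f x - d0\<bar> < s"
        unfolding jacobian_det_def using \<delta>2(2) Kx(2)[OF that] \<delta>_le(2) by auto
      then have 1: "\<bar>d0\<bar> / (1 + \<eta>1) < \<bar>jacobian_det f x\<bar>" by (simp add: s_def algebra_simps)
      then show "\<bar>d0\<bar> \<le> (1 + \<eta>1) * \<bar>jacobian_det f x\<bar>" using \<eta>1(1) by (simp add: field_simps)
      have "0 < \<bar>d0\<bar> / (1 + \<eta>1)" using d0 \<eta>1(1) by simp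
      then show "jacobian_det f x \<noteq> 0" using 1 by auto
      show "\<bar>jacobian_det f x\<bar> \<le> (1 + \<eta>1) * \<bar>d0\<bar>" using ds s' by (simp add: algebra_simps)
    qed
    have onx: "B \<le> (1 + \<eta>1) * onorm (?F x)" if "x \<in> K" for x
    proof -
      have bF: "bounded_linear (?F x)" using linF[OF K1(1)[OF that]] linear_conv_bounded_linear by blast
      have "norm (T h) \<le> (onorm (?F x) + N2 * \<delta>) * norm h" for h
      proof -
        have "T h = ?F x h - (?F x h - T h)" by simp
        then have "norm (T h) \<le> norm (?F x h) + norm (?F x h - T h)" by (metis norm_triangle_ineq4)
        also have "\<dots> \<le> onorm (?F x) * norm h + N2 * \<delta> * norm h" by (intro add_mono onorm bF FT that)
        finally show ?thesis by (simp add: algebra_simps)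
      qed
      then have "B \<le> onorm (?F x) + N2 * \<delta>" unfolding B_def by (rule onorm_le)
      then have "B / (1 + \<eta>1) \<le> onorm (?F x)" using \<delta>B by (simp add: algebra_simps)
      then show ?thesis using \<eta>1(1) by (simp add: field_simps)
    qed
    \<comment> \<open>\<open>f\<close> is \<open>T\<close> after the map \<open>L \<circ> f\<close>,
      whose Lipschitz constant is \<open>1 + 3 * \<theta>\<close>; \<open>b\<close> multiplies the
      two volume factors. The constant \<open>c\<close> is the one from the hypersurface estimate,
      close to \<open>B / \<bar>d0\<bar>\<close>.\<close>
    define b where "b = (1 + 3 * \<theta>) ^ ?n * \<bar>d0\<bar>"
    define c where "c = (1 / (1 - 5 * \<theta>)) ^ ?k * (\<bar>det (matrix L)\<bar> * B)"
    have bc: "0 < b" "0 < c" using \<theta> d0 Bpos by (auto simp: b_def c_def detL)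
    have bJ: "b \<le> (1 + \<eta>) * \<bar>jacobian_det f x\<bar>" if "x \<in> K" for x
    proof -
      have "b \<le> (1 + \<eta>1) * ((1 + \<eta>1) * \<bar>jacobian_det f x\<bar>)"
        unfolding b_def using \<theta> \<eta>1 Jx(2)[OF that] by (intro mult_mono) auto
      also have "\<dots> \<le> (1 + \<eta>) * \<bar>jacobian_det f x\<bar>"
        using mult_right_mono[OF \<eta>1(3), of "\<bar>jacobian_det f x\<bar>"] by (simp add: mult.assoc)
      finally show ?thesis .
    qed
    have cJ: "c * \<bar>jacobian_det f x\<bar> \<le> (1 + \<eta>) * onorm (?F x)" if "x \<in> K" for x
    proof -
      have "0 \<le> onorm (?F x)" using linF[OF K1(1)[OF that]] linear_conv_bounded_linear onorm_pos_le by blast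
      have "c * \<bar>jacobian_det f x\<bar> \<le> c * ((1 + \<eta>1) * \<bar>d0\<bar>)"
        using bc Jx(3)[OF that] by (intro mult_left_mono) auto
      also have "\<dots> = (1 / (1 - 5 * \<theta>)) ^ ?k * (1 + \<eta>1) * B"
        using d0 by (simp add: c_def detL)
      also have "\<dots> \<le> (1 + \<eta>1) * (1 + \<eta>1) * ((1 + \<eta>1) * onorm (?F x))"
        using \<theta> \<eta>1(1) Bpos onx[OF that] by (intro mult_mono) auto
      also have "\<dots> = ((1 + \<eta>1) * (1 + \<eta>1) * (1 + \<eta>1)) * onorm (?F x)" by (simp add: mult_ac)
      also have "\<dots> \<le> (1 + \<eta>) * onorm (?F x)" using \<open>0 \<le> onorm (?F x)\<close> \<eta>1(2) by (intro mult_right_mono)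
      finally show ?thesis .
    qed
    have meas: "emeasure lborel (f ` E) \<le> ennreal b * emeasure lebesgue E"
      if E: "E \<subseteq> K" "E \<in> sets lebesgue" "f ` E \<in> sets borel" for E
    proof -
      have "emeasure lborel (L ` f ` E) = emeasure lebesgue ((\<lambda>x. L (f x)) ` E)"
        using sets_borel_linear_image[OF L(1) injL E(3)] by (simp add: image_image)
      also have "\<dots> \<le> ennreal ((1 + 3 * \<theta>) ^ DIM(real^'n)) * emeasure lebesgue E"
      proof (rule emeasure_lipschitz_image[OF E(2)])
        show "0 < 1 + 3 * \<theta>" using \<theta> by simp
        show "dist (L (f x)) (L (f z)) \<le> (1 + 3 * \<theta>) * dist x z" if "x \<in> E" "z \<in> E" for x z
        proof -
          have "L (f z) - L (f x) = (L (f z - f x) - (z - x)) + (z - x)" by (simp add: linear_diff[OF L(1)])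
          then have "norm (L (f z) - L (f x)) \<le> norm (L (f z - f x) - (z - x)) + norm (z - x)"
            by (metis norm_triangle_ineq)
          moreover have "norm (L (f z - f x) - (z - x)) \<le> 3 * \<theta> * norm (z - x)"
            using that E(1) by (intro near) auto
          ultimately have "norm (L (f z) - L (f x)) \<le> (1 + 3 * \<theta>) * norm (z - x)" by (simp add: algebra_simps)
          then show ?thesis by (simp add: dist_norm norm_minus_commute)
        qed
      qed
      finally have 1: "emeasure lborel (L ` f ` E) \<le> ennreal ((1 + 3 * \<theta>) ^ ?n) * emeasure lebesgue E" by simp
      have "f ` E = T ` L ` f ` E" by (simp add: image_image TL')
      then have "emeasure lborel (f ` E) = ennreal \<bar>d0\<bar> * emeasure lborel (L ` f ` E)"
        using emeasure_linear_image_cart[OF T injT sets_borel_linear_image[OF L(1) injL E(3)]] d0_def by metis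
      also have "\<dots> \<le> ennreal \<bar>d0\<bar> * (ennreal ((1 + 3 * \<theta>) ^ ?n) * emeasure lebesgue E)"
        by (intro mult_left_mono 1) simp
      also have "\<dots> = ennreal b * emeasure lebesgue E"
        using \<theta> by (simp add: b_def ennreal_mult mult_ac)
      finally show ?thesis .
    qed
    have haus: "hausdorff_outer ?k E \<le> ennreal c * hausdorff_outer ?k (f ` E)"
      if E: "E \<subseteq> K \<inter> {x. dist (f x) y0 = r}" for r E
      unfolding c_def
    proof (rule hausdorff_hypersurface_piece_le[OF n L(1) injL B_le L_le])
      \<comment> \<open>The normal is frozen at the radial direction through \<open>f x0\<close>;
        this is where \<open>f x0\<close> must differ from \<open>y0\<close>.\<close>
      show "norm ((f x0 - y0) /\<^sub>R \<rho>) = 1" using \<rho> by (simp add: \<rho>_def dist_norm)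
      show "0 \<le> \<theta>" "5 * \<theta> < 1" using \<theta> by auto
      fix x z assume xz: "x \<in> E" "z \<in> E"
      then have xK: "x \<in> K" "z \<in> K" using E by auto
      show nr: "norm (L (f z - f x) - (z - x)) \<le> 3 * \<theta> * norm (z - x)" by (rule near[OF xK])
      have "norm (L (f z - f x)) \<le> norm (L (f z - f x) - (z - x)) + norm (z - x)"
        using norm_triangle_ineq[of "L (f z - f x) - (z - x)" "z - x"] by simp
      also have "\<dots> \<le> 2 * norm (z - x)"
      proof -
        have "3 * \<theta> * norm (z - x) \<le> 1 * norm (z - x)" using \<theta> by (intro mult_right_mono) auto
        then show ?thesis using nr by linarith
      qed
      finally have "B * norm (L (f z - f x)) \<le> B * (2 * norm (z - x))" using Bpos by (intro mult_left_mono) auto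
      then have w: "norm (f z - f x) \<le> B * (2 * norm (z - x))" using B_le[of "f z - f x"] by linarith
      have "\<bar>(f z - f x) \<bullet> (f x0 - y0)\<bar> \<le> norm (f z - f x) * t"
        using xz E Kx(1) xK \<delta>_le(1) \<delta>1(2)
        by (intro inner_near_normal_bound[where r = r] less_imp_le) (auto intro: less_le_trans)
      also have "\<dots> \<le> B * (2 * norm (z - x)) * t" using w t by (intro mult_right_mono) auto
      finally have "\<bar>(f z - f x) \<bullet> (f x0 - y0)\<bar> / \<rho> \<le> B * (2 * norm (z - x)) * t / \<rho>"
        using \<rho> by (intro divide_right_mono) auto
      then have "C * (\<bar>(f z - f x) \<bullet> (f x0 - y0)\<bar> / \<rho>) \<le> C * (B * (2 * norm (z - x)) * t / \<rho>)"
        using Cpos by (intro mult_left_mono) auto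
      also have "\<dots> = 2 * \<theta> * norm (z - x)" using Cpos Bpos \<rho> by (simp add: t_def)
      finally show "C * \<bar>(f z - f x) \<bullet> ((f x0 - y0) /\<^sub>R \<rho>)\<bar> \<le> 2 * \<theta> * norm (z - x)"
        using \<rho> by (simp add: abs_mult divide_inverse mult.commute)
    qed
    show ?thesis
      unfolding good_piece_def
    proof (intro conjI)
      show "inj_on f K" by (rule inj)
      show "\<forall>x\<in>K. f differentiable (at x) \<and> jacobian_det f x \<noteq> 0" using K1(1) Jx(1) by blast
      show "\<exists>b c. 0 < b \<and> 0 < c \<and>
        (\<forall>x\<in>K. b \<le> (1 + \<eta>) * \<bar>jacobian_det f x\<bar> \<and>
          c * \<bar>jacobian_det f x\<bar> \<le> (1 + \<eta>) * onorm (frechet_derivative f (at x))) \<and>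
        (\<forall>E\<subseteq>K. E \<in> sets lebesgue \<longrightarrow> f ` E \<in> sets borel \<longrightarrow>
          emeasure lborel (f ` E) \<le> ennreal b * emeasure lebesgue E) \<and>
        (\<forall>r. \<forall>E\<subseteq>K \<inter> {x. dist (f x) y0 = r}.
          hausdorff_outer (CARD('n) - 1) E \<le> ennreal c * hausdorff_outer (CARD('n) - 1) (f ` E))"
        using bc bJ cJ meas haus by - (rule exI[of _ b], rule exI[of _ c], blast)
    qed
  qed
  note piece = this
  show ?thesis
  proof (rule exI[of _ \<delta>], intro conjI allI impI)
    show "0 < \<delta>" by (rule \<delta>)
    fix K
    assume "(\<forall>x\<in>K. f differentiable (at x) \<and>
        dist (x, matrix (?F x)) (x0, matrix (?F x0)) < \<delta>) \<and>
      (\<forall>x\<in>K. \<forall>z\<in>K. norm (f z - f x - ?F x (z - x)) \<le> \<delta> * norm (z - x))"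
    then show "good_piece f y0 \<eta> K" by (intro piece) (simp_all add: T_def)
  qed
qed

section \<open>Measurability of the derivative and countable decomposition\<close>

text \<open>The derivative is a pointwise limit of difference quotients. They are formed with the
  extension of \<open>f\<close> by zero, which is Borel on the whole space, while for large
  \<open>m\<close> the increments stay in the open set \<open>D\<close>.\<close>

lemma frechet_derivative_measurable:
  fixes f :: "real^'n \<Rightarrow> real^'n"
  assumes S: "S \<in> sets lebesgue" and D: "open D" "S \<subseteq> D" and f: "continuous_on D f"
    and diff: "\<And>x. x \<in> S \<Longrightarrow> f differentiable (at x)"
  shows "(\<lambda>x. frechet_derivative f (at x) h) \<in> borel_measurable (lebesgue_on S)"
proof (rule borel_measurable_LIMSEQ_metric)
  define ft where "ft x = (if x \<in> D then f x else 0)" for x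
  have "ft \<in> borel_measurable borel"
    unfolding ft_def using borel_measurable_continuous_on_indicator[OF _ f] D(1)
    by (simp add: borel_measurable_continuous_on_if f)
  then have ft[measurable]: "ft \<in> borel_measurable lborel" by simp
  fix m :: nat
  have "(\<lambda>x. real (Suc m) *\<^sub>R (ft (x + (1 / real (Suc m)) *\<^sub>R h) - ft x)) \<in> borel_measurable lborel"
    by measurable
  then have "(\<lambda>x. real (Suc m) *\<^sub>R (ft (x + (1 / real (Suc m)) *\<^sub>R h) - ft x)) \<in> borel_measurable lebesgue"
    by (rule measurable_completion)
  then show "(\<lambda>x. real (Suc m) *\<^sub>R (ft (x + (1 / real (Suc m)) *\<^sub>R h) - ft x)) \<in> borel_measurable (lebesgue_on S)"
    by (rule measurable_restrict_space1)
next
  define ft where "ft x = (if x \<in> D then f x else 0)" for x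
  fix x assume "x \<in> space (lebesgue_on S)"
  then have x: "x \<in> S" by simp
  then have fd: "(f has_derivative frechet_derivative f (at x)) (at x)"
    using diff frechet_derivative_works by blast
  have lin: "linear (frechet_derivative f (at x))" using fd has_derivative_linear by blast
  show "(\<lambda>m. real (Suc m) *\<^sub>R (ft (x + (1 / real (Suc m)) *\<^sub>R h) - ft x)) \<longlonglongrightarrow> frechet_derivative f (at x) h"
  proof (rule LIMSEQ_I)
    fix \<epsilon> :: real assume "0 < \<epsilon>"
    define e where "e = \<epsilon> / (norm h + 1)"
    have e: "0 < e" using \<open>0 < \<epsilon>\<close> by (simp add: e_def add_nonneg_pos)
    have "norm h / (norm h + 1) < 1" by (simp add: divide_less_eq add_nonneg_pos)
    then have eh: "e * norm h < \<epsilon>"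
      using mult_strict_left_mono[of "norm h / (norm h + 1)" 1 \<epsilon>] \<open>0 < \<epsilon>\<close> by (simp add: e_def)
    obtain d where d: "0 < d" "\<And>y. norm (y - x) < d \<Longrightarrow>
        norm (f y - f x - frechet_derivative f (at x) (y - x)) \<le> e * norm (y - x)"
      using fd e unfolding has_derivative_at_alt by blast
    have "x \<in> D" using x D(2) by blast
    then obtain r where r: "0 < r" "ball x r \<subseteq> D" using D(1) open_contains_ball by blast
    have "0 < min d r / (norm h + 1)" using d r by (simp add: add_nonneg_pos)
    then obtain M where M: "1 / real (Suc M) < min d r / (norm h + 1)" by (rule nat_approx_posE)
    show "\<exists>no. \<forall>n\<ge>no. norm (real (Suc n) *\<^sub>R (ft (x + (1 / real (Suc n)) *\<^sub>R h) - ft x) - frechet_derivative f (at x) h) < \<epsilon>"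
    proof (intro exI[of _ M] allI impI)
      fix n assume "M \<le> n"
      define s where "s = 1 / real (Suc n)"
      have s: "0 < s" "real (Suc n) = 1 / s" by (simp_all add: s_def)
      have "s \<le> 1 / real (Suc M)" using \<open>M \<le> n\<close> by (simp add: s_def frac_le)
      then have "s < min d r / (norm h + 1)" using M by linarith
      then have "s * (norm h + 1) < min d r" by (simp add: pos_less_divide_eq add_nonneg_pos)
      then have sh: "s * norm h < min d r" using s by (simp add: algebra_simps)
      let ?y = "x + s *\<^sub>R h"
      have nd: "norm (?y - x) = s * norm h" using s by simp
      then have "dist x ?y = s * norm h" by (metis dist_commute dist_norm)
      then have "?y \<in> ball x r" using sh by simp
      then have "?y \<in> D" using r by blast
      then have fts: "ft ?y = f ?y" "ft x = f x" using \<open>x \<in> D\<close> by (auto simp: ft_def)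
      have "norm (f ?y - f x - frechet_derivative f (at x) (s *\<^sub>R h)) \<le> e * (s * norm h)"
      proof -
        have "norm (?y - x) < d" unfolding nd using sh by simp
        from d(2)[OF this] show ?thesis unfolding nd by simp
      qed
      then have "norm (f ?y - f x - s *\<^sub>R frechet_derivative f (at x) h) \<le> s * (e * norm h)"
        by (simp add: linear_scale[OF lin] mult_ac)
      also have "\<dots> < s * \<epsilon>" using s eh by simp
      finally have "norm (f ?y - f x - s *\<^sub>R frechet_derivative f (at x) h) < s * \<epsilon>" .
      then have "norm ((1 / s) *\<^sub>R (f ?y - f x - s *\<^sub>R frechet_derivative f (at x) h)) < \<epsilon>"
        using s by (simp add: divide_less_eq mult.commute)
      moreover have "(1 / s) *\<^sub>R (f ?y - f x - s *\<^sub>R frechet_derivative f (at x) h)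
          = (1 / s) *\<^sub>R (f ?y - f x) - frechet_derivative f (at x) h"
        using s by (simp add: scaleR_diff_right)
      ultimately have "norm ((1 / s) *\<^sub>R (ft ?y - ft x) - frechet_derivative f (at x) h) < \<epsilon>"
        by (simp add: fts)
      then show "norm (real (Suc n) *\<^sub>R (ft (x + (1 / real (Suc n)) *\<^sub>R h) - ft x) - frechet_derivative f (at x) h) < \<epsilon>"
        by (simp only: s(2)) (simp add: s_def)
    qed
  qed
qed

lemma matrix_frechet_measurable:
  fixes f :: "real^'n \<Rightarrow> real^'n"
  assumes "S \<in> sets lebesgue" "open D" "S \<subseteq> D" "continuous_on D f" "\<And>x. x \<in> S \<Longrightarrow> f differentiable (at x)"
  shows "(\<lambda>x. matrix (frechet_derivative f (at x))) \<in> borel_measurable (lebesgue_on S)"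
proof (rule borel_measurable_euclidean_space[THEN iffD2], intro ballI)
  fix b :: "real^'n^'n" assume "b \<in> Basis"
  then obtain i u where b: "b = axis i u" "u \<in> Basis" by (auto simp: Basis_vec_def)
  then obtain j where u: "u = axis j 1" by (auto simp: Basis_vec_def)
  have "(\<lambda>x. frechet_derivative f (at x) (axis j 1) \<bullet> axis i 1) \<in> borel_measurable (lebesgue_on S)"
    using frechet_derivative_measurable[OF assms, of "axis j 1"] by (intro borel_measurable_inner) auto
  moreover have "matrix (frechet_derivative f (at x)) \<bullet> b = frechet_derivative f (at x) (axis j 1) \<bullet> axis i 1" for x
    by (simp add: b u inner_axis matrix_def)
  ultimately show "(\<lambda>x. matrix (frechet_derivative f (at x)) \<bullet> b) \<in> borel_measurable (lebesgue_on S)" by simp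
qed

text \<open>
  Uniform differentiability on pieces only has to be tested against the countable dense set \<open>Q\<close>,
  which makes the pieces measurable; separability of the space of pairs \<open>(x, f'(x))\<close> makes them countably many.
\<close>

lemma good_pieces_cover:
  fixes f :: "real^'n \<Rightarrow> real^'n" and D :: "(real^'n) set"
  assumes n: "2 \<le> CARD('n)" and D: "open D" and f: "continuous_on D f"
    and ae: "AE x in lebesgue. x \<in> D \<longrightarrow> f differentiable (at x)" and \<eta>: "0 < \<eta>"
  obtains P :: "nat \<Rightarrow> (real^'n) set" where "\<And>i. good_piece f y0 \<eta> (P i)" "\<And>i. P i \<in> sets lebesgue" "\<And>i. P i \<subseteq> D"
    "{x \<in> D. f differentiable (at x) \<and> jacobian_det f x \<noteq> 0 \<and> f x \<noteq> y0} \<subseteq> (\<Union>i. P i)"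
proof -
  define S where "S = {x \<in> D. f differentiable (at x)}"
  define X where "X = {x \<in> S. jacobian_det f x \<noteq> 0 \<and> f x \<noteq> y0}"
  define F where "F x = frechet_derivative f (at x)" for x
  define MF where "MF x = matrix (F x)" for x
  have Sl: "S \<in> sets lebesgue"
  proof -
    obtain N where N: "{x \<in> space lebesgue. \<not> (x \<in> D \<longrightarrow> f differentiable (at x))} \<subseteq> N"
      "emeasure lebesgue N = 0" "N \<in> sets lebesgue" using AE_E[OF ae] by blast
    then have "negligible N" by (simp add: negligible_iff_null_sets null_setsI)
    then have "negligible (D - S)" by (rule negligible_subset) (use N(1) in \<open>auto simp: S_def\<close>)
    then have "D - S \<in> sets lebesgue" by (simp add: negligible_iff_null_sets null_setsD2)
    moreover have "D \<in> sets lebesgue" using D by simp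
    moreover have "S = D - (D - S)" by (auto simp: S_def)
    ultimately show ?thesis by (metis sets.Diff)
  qed
  have SD: "S \<subseteq> D" and Sd: "\<And>x. x \<in> S \<Longrightarrow> f differentiable (at x)" by (auto simp: S_def)
  have linF: "linear (F x)" if "x \<in> S" for x unfolding F_def using Sd[OF that] by (rule linear_frechet_derivative)
  have Fm: "(\<lambda>x. F x h) \<in> borel_measurable (lebesgue_on S)" for h
    unfolding F_def by (rule frechet_derivative_measurable[OF Sl D SD f Sd])
  have MFm: "MF \<in> borel_measurable (lebesgue_on S)"
    unfolding MF_def F_def by (rule matrix_frechet_measurable[OF Sl D SD f Sd])
  have fm: "f \<in> borel_measurable (lebesgue_on S)"
    using continuous_on_subset[OF f SD] Sl by (rule continuous_imp_measurable_on_sets_lebesgue)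
  have idm: "(\<lambda>x. x) \<in> borel_measurable (lebesgue_on S)"
    by (rule continuous_imp_measurable_on_sets_lebesgue[OF continuous_on_id Sl])
  obtain Q :: "(real^'n) set" where Q: "countable Q" "\<And>V. open V \<Longrightarrow> V \<noteq> {} \<Longrightarrow> \<exists>d \<in> Q. d \<in> V"
    using countable_dense_setE by blast
  \<comment> \<open>\<open>i\<close> fixes the scale and \<open>j\<close> the accuracy at which
    linear approximation holds.\<close>
  define G where "G i j = {x \<in> S. \<forall>z\<in>Q \<inter> D. dist z x < 1 / real (Suc i) \<longrightarrow>
      norm (f z - f x - F x (z - x)) \<le> 1 / real (Suc j) * norm (z - x)}" for i j
  have Gm: "G i j \<in> sets lebesgue" for i j
  proof -
    have one: "{x \<in> S. dist z x < 1 / real (Suc i) \<longrightarrow> norm (f z - f x - F x (z - x)) \<le> 1 / real (Suc j) * norm (z - x)}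
        \<in> sets lebesgue" for z
    proof -
      \<comment> \<open>The direction \<open>z - x\<close> varies with \<open>x\<close>; expanding
        it in coordinates leaves only derivatives in fixed directions, whose measurability is
        known.\<close>
      define h where "h x = (\<Sum>l\<in>UNIV. ((z - x) $ l) *\<^sub>R F x (axis l 1))" for x
      have Fh: "F x (z - x) = h x" if "x \<in> S" for x
      proof -
        have "z - x = (\<Sum>l\<in>UNIV. ((z - x) $ l) *\<^sub>R axis l 1)"
          using basis_expansion[of "z - x"] by (simp add: scalar_mult_eq_scaleR)
        then have "F x (z - x) = F x (\<Sum>l\<in>UNIV. ((z - x) $ l) *\<^sub>R axis l 1)" by (rule arg_cong)
        also have "\<dots> = h x" using linF[OF that] by (simp add: h_def linear_sum linear_scale)
        finally show ?thesis .
      qed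
      have comp: "(\<lambda>x. (z - x) $ l) \<in> borel_measurable (lebesgue_on S)" for l
        by (rule continuous_imp_measurable_on_sets_lebesgue[OF _ Sl]) (intro continuous_intros)
      have hm: "h \<in> borel_measurable (lebesgue_on S)"
        unfolding h_def by (intro borel_measurable_sum borel_measurable_scaleR comp Fm)
      have "{x \<in> space (lebesgue_on S). dist z x < 1 / real (Suc i) \<longrightarrow> norm (f z - f x - h x) \<le> 1 / real (Suc j) * norm (z - x)}
          \<in> sets (lebesgue_on S)"
        using fm hm idm by measurable
      then have "{x \<in> S. dist z x < 1 / real (Suc i) \<longrightarrow> norm (f z - f x - h x) \<le> 1 / real (Suc j) * norm (z - x)}
          \<in> sets lebesgue"
        using Sl by (simp add: sets_restrict_space_iff)
      moreover have "{x \<in> S. dist z x < 1 / real (Suc i) \<longrightarrow> norm (f z - f x - F x (z - x)) \<le> 1 / real (Suc j) * norm (z - x)}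
        = {x \<in> S. dist z x < 1 / real (Suc i) \<longrightarrow> norm (f z - f x - h x) \<le> 1 / real (Suc j) * norm (z - x)}"
        using Fh by auto
      ultimately show ?thesis by (simp only:)
    qed
    have "countable (Q \<inter> D)" using Q(1) by (rule countable_Int1)
    then have "S \<inter> (\<Inter>z\<in>Q \<inter> D. {x \<in> S. dist z x < 1 / real (Suc i) \<longrightarrow>
        norm (f z - f x - F x (z - x)) \<le> 1 / real (Suc j) * norm (z - x)}) \<in> sets lebesgue"
    proof (cases "Q \<inter> D = {}")
      case False
      show ?thesis by (intro sets.Int Sl sets.countable_INT'' one) (use \<open>countable (Q \<inter> D)\<close> False in auto)
    qed (use Sl in simp)
    then show ?thesis by (rule back_subst[of "\<lambda>A. A \<in> sets lebesgue"]) (auto simp: G_def)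
  qed
  \<comment> \<open>A violation at one point would, by continuity, persist on an open set and hence
    at a point of the dense set.\<close>
  have G_all: "norm (f z - f x - F x (z - x)) \<le> 1 / real (Suc j) * norm (z - x)"
    if x: "x \<in> G i j" and z: "z \<in> D" "dist z x < 1 / real (Suc i)" for i j x z
  proof (rule ccontr)
    assume neg: "\<not> ?thesis"
    define g where "g z = norm (f z - f x - F x (z - x)) - 1 / real (Suc j) * norm (z - x)" for z
    have lx: "bounded_linear (F x)" using linF x linear_conv_bounded_linear by (auto simp: G_def)
    have gc: "continuous_on (D \<inter> ball x (1 / real (Suc i))) g"
      unfolding g_def
      by (intro continuous_intros bounded_linear.continuous_on[OF lx] continuous_on_subset[OF f]) auto
    have "open (D \<inter> ball x (1 / real (Suc i)) \<inter> g -` {0<..})"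
      by (rule continuous_open_preimage[OF gc]) (use D in auto)
    moreover have "z \<in> D \<inter> ball x (1 / real (Suc i)) \<inter> g -` {0<..}"
      using neg z by (auto simp: g_def dist_commute)
    ultimately obtain q where "q \<in> Q" "q \<in> D \<inter> ball x (1 / real (Suc i)) \<inter> g -` {0<..}" using Q(2) by blast
    then show False using x by (auto simp: G_def g_def dist_commute)
  qed
  have "\<forall>x0. \<exists>d. x0 \<in> X \<longrightarrow> 0 < d \<and> (\<forall>K. (\<forall>x\<in>K. f differentiable (at x) \<and>
      dist (x, matrix (frechet_derivative f (at x))) (x0, matrix (frechet_derivative f (at x0))) < d) \<and>
    (\<forall>x\<in>K. \<forall>z\<in>K. norm (f z - f x - frechet_derivative f (at x) (z - x)) \<le> d * norm (z - x))
    \<longrightarrow> good_piece f y0 \<eta> K)"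
  proof
    fix x0
    show "\<exists>d. x0 \<in> X \<longrightarrow> 0 < d \<and> (\<forall>K. (\<forall>x\<in>K. f differentiable (at x) \<and>
      dist (x, matrix (frechet_derivative f (at x))) (x0, matrix (frechet_derivative f (at x0))) < d) \<and>
    (\<forall>x\<in>K. \<forall>z\<in>K. norm (f z - f x - frechet_derivative f (at x) (z - x)) \<le> d * norm (z - x))
    \<longrightarrow> good_piece f y0 \<eta> K)"
    proof (cases "x0 \<in> X")
      case True
      then have "f differentiable (at x0)" "jacobian_det f x0 \<noteq> 0" "f x0 \<noteq> y0" by (auto simp: X_def S_def)
      from good_piece_locally[OF n \<eta> this] show ?thesis by (elim exE) (rule exI, blast)
    qed blast
  qed
  from choice[OF this] obtain d where dX: "\<forall>x0. x0 \<in> X \<longrightarrow> 0 < d x0 \<and> (\<forall>K. (\<forall>x\<in>K. f differentiable (at x) \<and>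
      dist (x, matrix (frechet_derivative f (at x))) (x0, matrix (frechet_derivative f (at x0))) < d x0) \<and>
    (\<forall>x\<in>K. \<forall>z\<in>K. norm (f z - f x - frechet_derivative f (at x) (z - x)) \<le> d x0 * norm (z - x))
    \<longrightarrow> good_piece f y0 \<eta> K)" ..
  have d_pos: "0 < d x0" if "x0 \<in> X" for x0 using dX that by blast
  have d_good: "good_piece f y0 \<eta> K" if "x0 \<in> X" "\<And>x. x \<in> K \<Longrightarrow> f differentiable (at x) \<and> dist (x, MF x) (x0, MF x0) < d x0"
    "\<And>x z. \<lbrakk>x \<in> K; z \<in> K\<rbrakk> \<Longrightarrow> norm (f z - f x - F x (z - x)) \<le> d x0 * norm (z - x)" for x0 K
    using spec[OF conjunct2[OF mp[OF spec[OF dX, of x0] that(1)]], of K] that(2,3) unfolding MF_def F_def by blast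
  \<comment> \<open>Centres are sorted by an accuracy index \<open>j\<close> finer than their own
    tolerance \<open>d x0\<close>. The balls in \<open>O'\<close> have radius at most 1 / (2 (i +
    1)), so any two points of one piece lie within the scale 1 / (i + 1) of
    \<open>G\<close>.\<close>
  define A where "A i j = {x0 \<in> X \<inter> G i j. 1 / real (Suc j) < d x0}" for i j
  define O' where "O' i x0 = ball (x0, MF x0) (min (d x0) (1 / (2 * real (Suc i))))" for i x0
  define P where "P i j x0 = {x \<in> G i j. (x, MF x) \<in> O' i x0}" for i j x0
  have P_good: "good_piece f y0 \<eta> (P i j x0)" if x0: "x0 \<in> A i j" for i j x0
  proof (rule d_good)
    show "x0 \<in> X" using x0 by (simp add: A_def)
    show "f differentiable (at x) \<and> dist (x, MF x) (x0, MF x0) < d x0" if "x \<in> P i j x0" for x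
      using that Sd by (auto simp: P_def O'_def G_def dist_commute)
    show "norm (f z - f x - F x (z - x)) \<le> d x0 * norm (z - x)" if xz: "x \<in> P i j x0" "z \<in> P i j x0" for x z
    proof -
      have "dist x x0 < 1 / (2 * real (Suc i))" "dist z x0 < 1 / (2 * real (Suc i))"
        using xz dist_fst_le[of "(x0, MF x0)" "(x, MF x)"] dist_fst_le[of "(x0, MF x0)" "(z, MF z)"]
        by (auto simp: P_def O'_def dist_commute)
      then have "dist z x < 1 / (2 * real (Suc i)) + 1 / (2 * real (Suc i))"
        using dist_triangle2[of z x x0] by linarith
      also have "\<dots> = 1 / real (Suc i)" by (simp add: field_simps)
      finally have "dist z x < 1 / real (Suc i)" .
      moreover have "z \<in> D" "x \<in> G i j" using xz SD by (auto simp: P_def G_def)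
      ultimately have "norm (f z - f x - F x (z - x)) \<le> 1 / real (Suc j) * norm (z - x)" by (intro G_all)
      also have "\<dots> \<le> d x0 * norm (z - x)" using x0 by (intro mult_right_mono) (auto simp: A_def)
      finally show ?thesis .
    qed
  qed
  have P_meas: "P i j x0 \<in> sets lebesgue" for i j x0
  proof -
    have "(\<lambda>x. (x, MF x)) \<in> borel_measurable (lebesgue_on S)"
      using idm MFm by (rule borel_measurable_Pair)
    then have "(\<lambda>x. (x, MF x)) -` O' i x0 \<inter> space (lebesgue_on S) \<in> sets (lebesgue_on S)"
      by (rule measurable_sets) (simp add: O'_def)
    then have "(\<lambda>x. (x, MF x)) -` O' i x0 \<inter> S \<in> sets lebesgue"
      using Sl by (simp add: sets_restrict_space_iff)
    then have "G i j \<inter> ((\<lambda>x. (x, MF x)) -` O' i x0 \<inter> S) \<in> sets lebesgue" by (rule sets.Int[OF Gm])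
    then show ?thesis by (rule back_subst[of "\<lambda>A. A \<in> sets lebesgue"]) (auto simp: P_def G_def)
  qed
  have "\<exists>C. C \<subseteq> A i j \<and> countable C \<and> (\<Union>c\<in>C. O' i c) = (\<Union>c\<in>A i j. O' i c)" for i j
  proof -
    obtain \<F> where \<F>: "\<F> \<subseteq> O' i ` A i j" "countable \<F>" "\<Union>\<F> = \<Union>(O' i ` A i j)"
      by (rule Lindelof[of "O' i ` A i j"]) (auto simp: O'_def)
    then obtain C where "C \<subseteq> A i j" "countable C" "\<F> = O' i ` C" by (metis countable_subset_image)
    then show ?thesis using \<F>(3) by blast
  qed
  then obtain C where C: "\<And>i j. C i j \<subseteq> A i j" "\<And>i j. countable (C i j)"
    "\<And>i j. (\<Union>c\<in>C i j. O' i c) = (\<Union>c\<in>A i j. O' i c)" by metis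
  \<comment> \<open>The empty set is added so that the enumeration is of a nonempty family; it is a
    good piece trivially.\<close>
  define \<P> where "\<P> = insert {} (\<Union>i. \<Union>j. P i j ` C i j)"
  have "countable \<P>" unfolding \<P>_def using C(2) by auto
  have range: "range (from_nat_into \<P>) = \<P>"
    using \<open>countable \<P>\<close> by (intro range_from_nat_into) (auto simp: \<P>_def)
  have empty_good: "good_piece f y0 \<eta> {}"
    unfolding good_piece_def by (auto intro!: exI[of _ 1])
  show thesis
  proof (rule that[of "from_nat_into \<P>"])
    fix i
    have "from_nat_into \<P> i \<in> \<P>" using range by blast
    then consider "from_nat_into \<P> i = {}" | i' j c where "from_nat_into \<P> i = P i' j c" "c \<in> A i' j"
      unfolding \<P>_def using C(1) by blast
    then have "good_piece f y0 \<eta> (from_nat_into \<P> i) \<and> from_nat_into \<P> i \<in> sets lebesgue \<and> from_nat_into \<P> i \<subseteq> D"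
    proof cases
      case 1
      then show ?thesis using empty_good by simp
    next
      case 2
      have "P i' j c \<subseteq> D" using SD by (auto simp: P_def G_def)
      then show ?thesis unfolding 2(1) using P_good[OF 2(2)] P_meas by blast
    qed
    then show "good_piece f y0 \<eta> (from_nat_into \<P> i)" "from_nat_into \<P> i \<in> sets lebesgue" "from_nat_into \<P> i \<subseteq> D"
      by blast+
  next
    show "{x \<in> D. f differentiable (at x) \<and> jacobian_det f x \<noteq> 0 \<and> f x \<noteq> y0} \<subseteq> \<Union> (range (from_nat_into \<P>))"
      unfolding range
    proof
      fix x assume "x \<in> {x \<in> D. f differentiable (at x) \<and> jacobian_det f x \<noteq> 0 \<and> f x \<noteq> y0}"
      then have x: "x \<in> X" "x \<in> S" by (auto simp: X_def S_def)
      obtain j where j: "1 / real (Suc j) < d x" by (rule nat_approx_posE[OF d_pos[OF x(1)]])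
      have "(f has_derivative F x) (at x)" unfolding F_def using Sd[OF x(2)] frechet_derivative_works by blast
      then obtain e where e: "0 < e" "\<And>z. norm (z - x) < e \<Longrightarrow> norm (f z - f x - F x (z - x)) \<le> 1 / real (Suc j) * norm (z - x)"
        unfolding has_derivative_at_alt by (meson divide_pos_pos of_nat_0_less_iff zero_less_Suc zero_less_one)
      obtain i where i: "1 / real (Suc i) < e" by (rule nat_approx_posE[OF e(1)])
      have "x \<in> G i j" using x(2) e(2) i unfolding G_def by (auto simp: dist_norm)
      then have "x \<in> A i j" using x(1) j by (simp add: A_def)
      then have "(x, MF x) \<in> (\<Union>c\<in>A i j. O' i c)" using d_pos[OF x(1)] by (intro UN_I[of x]) (auto simp: O'_def)
      then obtain c where c: "c \<in> C i j" "(x, MF x) \<in> O' i c" using C(3) by blast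
      then have "x \<in> P i j c" using \<open>x \<in> G i j\<close> by (simp add: P_def)
      then show "x \<in> \<Union>\<P>" using c(1) unfolding \<P>_def by blast
    qed
  qed
qed

lemma fsigma_compact_Diff:
  fixes Q :: "'a::euclidean_space set"
  assumes "compact Q" "closed R"
  shows "fsigma (Q - R)"
proof -
  obtain C :: "nat \<Rightarrow> 'a set" where C: "\<And>n. compact (C n)" "\<Union>(range C) = - R"
    using open_Union_compact_subsets[of "- R"] assms(2) by (metis open_Compl)
  have "Q - R = (\<Union>n. Q \<inter> C n)" using C(2) by blast
  then show ?thesis
    unfolding fsigma_Union_compact using C(1) assms(1)
    by (intro exI[of _ "\<lambda>n. Q \<inter> C n"]) (auto intro: compact_Int)
qed

text \<open>Each measurable piece is, up to a null set, a countable union of compact sets. Making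
  these disjoint removes finitely many compact sets from a compact one, which leaves an F-sigma set;
  the null remainders are collected in the exceptional set.\<close>

lemma good_pieces_disjoint:
  fixes f :: "real^'n \<Rightarrow> real^'n" and D :: "(real^'n) set"
  assumes "2 \<le> CARD('n)" "open D" "continuous_on D f"
    "AE x in lebesgue. x \<in> D \<longrightarrow> f differentiable (at x)" "0 < \<eta>"
  obtains K :: "nat \<Rightarrow> (real^'n) set" where "\<And>i. good_piece f y0 \<eta> (K i)" "\<And>i. fsigma (K i)" "\<And>i. K i \<subseteq> D"
    "disjoint_family K"
    "{x \<in> D. f differentiable (at x) \<and> jacobian_det f x \<noteq> 0 \<and> f x \<noteq> y0} - (\<Union>i. K i) \<in> null_sets lebesgue"
proof -
  obtain P :: "nat \<Rightarrow> (real^'n) set" where P: "\<And>i. good_piece f y0 \<eta> (P i)" "\<And>i. P i \<in> sets lebesgue" "\<And>i. P i \<subseteq> D"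
    "{x \<in> D. f differentiable (at x) \<and> jacobian_det f x \<noteq> 0 \<and> f x \<noteq> y0} \<subseteq> (\<Union>i. P i)"
    using good_pieces_cover[OF assms] by blast
  have "\<exists>F T. (\<forall>m::nat. compact (F m)) \<and> T \<in> null_sets lebesgue \<and> (\<Union>m. F m) \<union> T = P i" for i
  proof -
    obtain C T where CT: "fsigma C" "T \<in> null_sets lebesgue" "C \<union> T = P i"
      by (rule lebesgue_set_almost_fsigma[OF P(2)])
    obtain F :: "nat \<Rightarrow> (real^'n) set" where F: "range F \<subseteq> Collect compact" "C = \<Union>(range F)"
      using CT(1) unfolding fsigma_Union_compact by blast
    show ?thesis
      by (rule exI[of _ F], rule exI[of _ T]) (use F CT in auto)
  qed
  then obtain F T where F: "\<And>i m. compact (F i m)" "\<And>i. T i \<in> null_sets lebesgue" "\<And>i. (\<Union>m::nat. F i m) \<union> T i = P i"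
    by metis
  define Q where "Q l = F (fst (prod_decode l)) (snd (prod_decode l))" for l
  have Q: "compact (Q l)" "Q l \<subseteq> P (fst (prod_decode l))" for l
    using F(1,3) unfolding Q_def by blast+
  have UQ: "(\<Union>l. Q l) = (\<Union>i. \<Union>m. F i m)"
  proof (intro subset_antisym subsetI)
    fix x assume "x \<in> (\<Union>i. \<Union>m. F i m)"
    then obtain i m where "x \<in> F i m" by blast
    then show "x \<in> (\<Union>l. Q l)" by (intro UN_I[of "prod_encode (i, m)"]) (auto simp: Q_def)
  qed (auto simp: Q_def)
  have sub: "disjointed Q i \<subseteq> P (fst (prod_decode i))" for i
    using disjointed_subset[of Q i] Q(2)[of i] by blast
  show thesis
  proof (rule that[of "disjointed Q"])
    fix i
    show "good_piece f y0 \<eta> (disjointed Q i)" using P(1) sub by (rule good_piece_subset)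
    show "disjointed Q i \<subseteq> D" using sub P(3) by blast
    show "fsigma (disjointed Q i)"
      unfolding disjointed_def using Q(1) by (intro fsigma_compact_Diff closed_UN) (auto intro: compact_imp_closed)
  next
    show "disjoint_family (disjointed Q)" by (rule disjoint_family_disjointed)
    let ?X = "{x \<in> D. f differentiable (at x) \<and> jacobian_det f x \<noteq> 0 \<and> f x \<noteq> y0}"
    have "?X - (\<Union>i. disjointed Q i) \<subseteq> (\<Union>i. T i)"
      unfolding UN_disjointed_eq UQ
    proof
      fix x assume x: "x \<in> ?X - (\<Union>i. \<Union>m. F i m)"
 
      have "x \<in> (\<Union>i. P i)" using subsetD[OF P(4), of x] x by simp
      then obtain i where "x \<in> P i" by (rule UN_E)
      then have "x \<in> (\<Union>m. F i m) \<union> T i" using F(3)[of i] by simp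
      then show "x \<in> (\<Union>i. T i)" using x by blast
    qed
    moreover have "(\<Union>i. T i) \<in> null_sets lebesgue" using F(2) by blast
    ultimately show "?X - (\<Union>i. disjointed Q i) \<in> null_sets lebesgue"
      using negligible_subset negligible_iff_null_sets by blast
  qed
qed

section \<open>Push-forward of densities\<close>

text \<open>An inequality between two measures on Borel sets passes to integrals of Borel functions.
  It serves twice: for areas along \<open>f\<close>, and for volumes along its local inverse.
  Pushing to the Borel sets accommodates the larger sigma-algebra of Hausdorff measure.\<close>

lemma nn_integral_transfer_le:
  fixes M :: "'a measure" and N :: "'b::topological_space measure"
  assumes h: "h \<in> M \<rightarrow>\<^sub>M borel" and X: "X \<in> sets M" and Y: "Y \<in> sets N"
    and N: "sets borel \<subseteq> sets N" "space N = UNIV" and \<phi>: "\<phi> \<in> borel_measurable borel"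
    and le: "\<And>B. B \<in> sets borel \<Longrightarrow> emeasure M (X \<inter> (h -` B \<inter> space M)) \<le> c * emeasure N (Y \<inter> B)"
  shows "(\<integral>\<^sup>+x. \<phi> (h x) * indicator X x \<partial>M) \<le> c * (\<integral>\<^sup>+y. \<phi> y * indicator Y y \<partial>N)"
proof -
  have idm: "(\<lambda>y. y) \<in> N \<rightarrow>\<^sub>M borel" using N by (intro measurableI) auto
  define M' where "M' = distr (density M (indicator X)) borel h"
  define N' where "N' = distr (density N (indicator Y)) borel (\<lambda>y. y)"
  have M': "(\<integral>\<^sup>+z. \<phi> z \<partial>M') = (\<integral>\<^sup>+x. \<phi> (h x) * indicator X x \<partial>M)"
  proof -
    have "(\<integral>\<^sup>+z. \<phi> z \<partial>M') = (\<integral>\<^sup>+x. \<phi> (h x) \<partial>density M (indicator X))"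
      unfolding M'_def using h \<phi> by (subst nn_integral_distr) auto
    also have "\<dots> = (\<integral>\<^sup>+x. indicator X x * \<phi> (h x) \<partial>M)"
      using X measurable_compose[OF h \<phi>] by (subst nn_integral_density) auto
    finally show ?thesis by (simp add: mult.commute)
  qed
  have N': "(\<integral>\<^sup>+z. \<phi> z \<partial>N') = (\<integral>\<^sup>+y. \<phi> y * indicator Y y \<partial>N)"
  proof -
    have "(\<integral>\<^sup>+z. \<phi> z \<partial>N') = (\<integral>\<^sup>+y. \<phi> y \<partial>density N (indicator Y))"
      unfolding N'_def using idm \<phi> by (subst nn_integral_distr) auto
    also have "\<dots> = (\<integral>\<^sup>+y. indicator Y y * \<phi> y \<partial>N)"
      using Y measurable_compose[OF idm \<phi>] by (subst nn_integral_density) auto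
    finally show ?thesis by (simp add: mult.commute)
  qed
  have s: "sets M' = sets (scale_measure c N')" by (simp add: M'_def N'_def)
  have "M' \<le> scale_measure c N'"
    unfolding le_measure[OF s]
  proof
    fix B assume "B \<in> sets M'"
    then have B: "B \<in> sets borel" by (simp add: M'_def)
    have "emeasure M' B = emeasure M (X \<inter> (h -` B \<inter> space M))"
      unfolding M'_def by (rule emeasure_distr_density_indicator[OF h X B])
    also have "\<dots> \<le> c * emeasure N (Y \<inter> B)" by (rule le[OF B])
    also have "emeasure N (Y \<inter> B) = emeasure N' B"
      unfolding N'_def using emeasure_distr_density_indicator[OF idm Y B] N(2) by simp
    finally show "emeasure M' B \<le> emeasure (scale_measure c N') B" by simp
  qed
  then have "(\<integral>\<^sup>+z. \<phi> z \<partial>M') \<le> (\<integral>\<^sup>+z. \<phi> z \<partial>scale_measure c N')"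
    by (intro nn_integral_mono_measure s)
  also have "\<dots> = c * (\<integral>\<^sup>+z. \<phi> z \<partial>N')"
    using \<phi> by (intro nn_integral_scale_measure) (simp add: N'_def)
  finally show ?thesis by (simp only: M' N')
qed

lemma fsigma_Int_closed:
  fixes K :: "'a::euclidean_space set"
  assumes "fsigma K" "closed C"
  shows "fsigma (K \<inter> C)"
proof -
  obtain F :: "nat \<Rightarrow> 'a set" where F: "range F \<subseteq> Collect compact" "K = \<Union>(range F)"
    using assms(1) unfolding fsigma_Union_compact by blast
  show ?thesis unfolding fsigma_Union_compact
    by (rule exI[of _ "\<lambda>n. F n \<inter> C"]) (use F assms(2) in \<open>auto intro: compact_Int_closed\<close>)
qed

lemma fsigma_imp_borel: "fsigma K \<Longrightarrow> K \<in> sets borel"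
  by (induction rule: fsigma.induct) auto

lemma fsigma_image_borel:
  fixes f :: "'a::euclidean_space \<Rightarrow> 'b::euclidean_space"
  assumes "fsigma K" "continuous_on K f"
  shows "f ` K \<in> sets borel"
proof -
  obtain F :: "nat \<Rightarrow> 'a set" where F: "range F \<subseteq> Collect compact" "K = \<Union>(range F)"
    using assms(1) unfolding fsigma_Union_compact by blast
  have "compact (f ` F n)" for n
    using F assms(2) by (intro compact_continuous_image) (auto intro: continuous_on_subset)
  then have "(\<Union>n. f ` F n) \<in> sets borel" by (intro sets.countable_UN) (auto intro: borel_compact)
  then show ?thesis using F(2) by (simp add: image_UN)
qed

text \<open>By injectivity the preimage of an open set \<open>S\<close> in \<open>f\<close> is
  described by images: remove from the image of \<open>K\<close> the image of the part of
  \<open>K\<close> outside \<open>S\<close>. Both are continuous images of F-sigma sets, hence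
  Borel.\<close>

lemma the_inv_into_fsigma_measurable:
  fixes f :: "'a::euclidean_space \<Rightarrow> 'b::euclidean_space"
  assumes K: "fsigma K" and f: "continuous_on K f" and inj: "inj_on f K"
  shows "(\<lambda>y. if y \<in> f ` K then the_inv_into K f y else 0) \<in> borel_measurable borel"
proof (rule borel_measurableI)
  let ?g = "\<lambda>y. if y \<in> f ` K then the_inv_into K f y else 0"
  fix S :: "'a set" assume "open S"
  have fK: "f ` K \<in> sets borel" by (rule fsigma_image_borel[OF K f])
  have "f ` (K \<inter> - S) \<in> sets borel"
    using \<open>open S\<close> K f by (intro fsigma_image_borel fsigma_Int_closed) (auto intro: continuous_on_subset)
  then have A: "f ` K - f ` (K \<inter> - S) \<in> sets borel" using fK by auto
  have "?g -` S = (f ` K - f ` (K \<inter> - S)) \<union> (if 0 \<in> S then - (f ` K) else {})"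
  proof (rule set_eqI)
    fix y
    show "y \<in> ?g -` S \<longleftrightarrow> y \<in> (f ` K - f ` (K \<inter> - S)) \<union> (if 0 \<in> S then - (f ` K) else {})"
    proof (cases "y \<in> f ` K")
      case True
      then obtain x where x: "x \<in> K" "y = f x" by blast
      have "y \<in> f ` (K \<inter> - S) \<longleftrightarrow> x \<notin> S"
        using x inj by (auto dest: inj_onD)
      then show ?thesis using x the_inv_into_f_f[OF inj x(1)] by auto
    qed auto
  qed
  then show "?g -` S \<inter> space borel \<in> sets borel" using A fK by simp
qed

section \<open>Hoelder's inequality on a fibre\<close>

text \<open>Jensen's inequality for x^q with normalized weights proportional to s^\<alpha> / j, at
  the points t s^(1 - \<alpha>). The choice of \<alpha> makes the powers of s cancel on the right,
  since \<alpha> + (1 - \<alpha>) q = 0.\<close>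

lemma holder_sum_powr:
  fixes t s j :: "'i \<Rightarrow> real"
  assumes I: "finite I" and q: "1 < q" and \<alpha>: "\<alpha> = q / (q - 1)"
    and pos: "\<And>i. i \<in> I \<Longrightarrow> 0 \<le> t i" "\<And>i. i \<in> I \<Longrightarrow> 0 < s i" "\<And>i. i \<in> I \<Longrightarrow> 0 < j i"
  shows "(\<Sum>i\<in>I. t i * s i / j i) powr q \<le> (\<Sum>i\<in>I. s i powr \<alpha> / j i) powr (q - 1) * (\<Sum>i\<in>I. t i powr q / j i)"
proof -
  \<comment> \<open>Convexity is used on the open half-line, so terms with \<open>t i = 0\<close>
    are dropped beforehand.\<close>
  define S where "S = {i \<in> I. 0 < t i}"
  have S: "finite S" "S \<subseteq> I" using I by (auto simp: S_def)
  have t0: "t i = 0" if "i \<in> I - S" for i using that pos(1)[of i] by (auto simp: S_def)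
  have X: "(\<Sum>i\<in>I. t i * s i / j i) = (\<Sum>i\<in>S. t i * s i / j i)"
    by (rule sum.mono_neutral_right[OF I S(2)]) (use t0 in auto)
  have Y: "(\<Sum>i\<in>I. t i powr q / j i) = (\<Sum>i\<in>S. t i powr q / j i)"
    by (rule sum.mono_neutral_right[OF I S(2)]) (use t0 q in auto)
  have Ynn: "0 \<le> (\<Sum>i\<in>S. t i powr q / j i)" using pos S(2) by (intro sum_nonneg) (auto intro!: divide_nonneg_pos)
  show ?thesis
  proof (cases "S = {}")
    case True
    then show ?thesis using q Ynn by (simp add: X Y)
  next
    case False
    define A where "A = (\<Sum>i\<in>S. s i powr \<alpha> / j i)"
    have term_pos: "0 < s i powr \<alpha> / j i" if "i \<in> I" for i using pos[OF that] by simp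
    have A: "0 < A" unfolding A_def using S(2) by (intro sum_pos S(1) False term_pos) auto
    have AI: "A \<le> (\<Sum>i\<in>I. s i powr \<alpha> / j i)"
      unfolding A_def using I S(2) term_pos by (intro sum_mono2) (auto intro: less_imp_le)
    define a where "a i = s i powr \<alpha> / j i / A" for i
    define y where "y i = t i * s i powr (1 - \<alpha>)" for i
    have suma: "(\<Sum>i\<in>S. a i) = 1"
      unfolding a_def by (simp only: sum_divide_distrib[symmetric] A_def[symmetric]) (use A in simp)
    have conv: "(\<Sum>i\<in>S. a i *\<^sub>R y i) powr q \<le> (\<Sum>i\<in>S. a i * (y i powr q))"
    proof (rule convex_on_sum[OF S(1) False _ suma])
      show "convex_on {0<..} (\<lambda>x. x powr q)" using q by (intro powr_convex) simp
      show "0 \<le> a i" if "i \<in> S" for i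
        unfolding a_def using subsetD[OF S(2) that] A by (intro divide_nonneg_pos less_imp_le term_pos)
      show "y i \<in> {0<..}" if "i \<in> S" for i using that pos(2)[of i] S(2) by (auto simp: y_def S_def)
    qed
    have eq1: "(\<Sum>i\<in>S. a i *\<^sub>R y i) = (\<Sum>i\<in>S. t i * s i / j i) / A"
    proof -
      have "a i *\<^sub>R y i = t i * s i / j i / A" if "i \<in> S" for i
      proof -
        have "s i powr \<alpha> * s i powr (1 - \<alpha>) = s i"
          using pos(2)[of i] that S(2) by (auto simp: powr_add[symmetric])
        then show ?thesis by (simp add: a_def y_def mult_ac)
      qed
      then show ?thesis by (simp add: sum_divide_distrib)
    qed
    have eq2: "(\<Sum>i\<in>S. a i * (y i powr q)) = (\<Sum>i\<in>S. t i powr q / j i) / A"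
    proof -
      have ex: "\<alpha> + (1 - \<alpha>) * q = 0"
      proof -
        have "\<alpha> * (q - 1) = q" using q by (simp add: \<alpha>)
        then show ?thesis by (simp add: algebra_simps)
      qed
      have "a i * (y i powr q) = t i powr q / j i / A" if "i \<in> S" for i
      proof -
        have si: "0 < s i" "0 < t i" using pos(2)[of i] that S(2) by (auto simp: S_def)
        have "s i powr \<alpha> * (s i powr (1 - \<alpha>)) powr q = 1"
          using si ex by (simp add: powr_powr powr_add[symmetric])
        then show ?thesis using si by (simp add: a_def y_def powr_mult mult_ac)
      qed
      then show ?thesis by (simp add: sum_divide_distrib)
    qed
    have Xnn: "0 \<le> (\<Sum>i\<in>S. t i * s i / j i)"
    proof (rule sum_nonneg)
      fix i assume "i \<in> S"
      then have "i \<in> I" using S(2) by blast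
      from pos[OF this] show "0 \<le> t i * s i / j i" by simp
    qed
    have "(\<Sum>i\<in>S. t i * s i / j i) powr q / A powr q \<le> (\<Sum>i\<in>S. t i powr q / j i) / A"
      using conv unfolding eq1 eq2 using Xnn A by (simp add: powr_divide)
    then have "(\<Sum>i\<in>S. t i * s i / j i) powr q \<le> (\<Sum>i\<in>S. t i powr q / j i) / A * A powr q"
      using A by (simp add: pos_divide_le_eq)
    also have "\<dots> = A powr (q - 1) * (\<Sum>i\<in>S. t i powr q / j i)"
      using A by (simp add: powr_diff)
    also have "\<dots> \<le> (\<Sum>i\<in>I. s i powr \<alpha> / j i) powr (q - 1) * (\<Sum>i\<in>S. t i powr q / j i)"
      using A AI q Ynn by (intro mult_right_mono powr_mono2) auto
    finally show ?thesis unfolding X Y .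
  qed
qed

lemma enn_powr_ennreal: "0 \<le> x \<Longrightarrow> enn_powr (ennreal x) a = ennreal (x powr a)"
  by (simp add: enn_powr_def)

lemma enn_powr_top [simp]: "enn_powr top a = top"
  by (simp add: enn_powr_def)

lemma enn_powr_0 [simp]: "enn_powr 0 a = 0"
  by (simp add: enn_powr_def)

lemma enn_powr_measurable [measurable]: "(\<lambda>x. enn_powr x a) \<in> borel_measurable borel"
  unfolding enn_powr_def by measurable

lemma enn_powr_powr: "enn_powr (enn_powr x a) b = enn_powr x (a * b)"
  by (simp add: enn_powr_def powr_powr)

lemma enn_powr_inverse_power: "0 < k \<Longrightarrow> enn_powr x (1 / real k) ^ k = x"
proof (cases "x = top")
  case False
  assume "0 < k"
  have "enn_powr x (1 / real k) ^ k = ennreal ((enn2real x powr (1 / real k)) ^ k)"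
    using False by (simp add: enn_powr_def ennreal_power)
  also have "(enn2real x powr (1 / real k)) ^ k = enn2real x"
  proof (cases "enn2real x = 0")
    case False
    then have "0 < enn2real x" using enn2real_nonneg[of x] by linarith
    then show ?thesis using \<open>0 < k\<close> by (simp add: powr_realpow[symmetric] powr_powr)
  qed (use \<open>0 < k\<close> in simp)
  finally show ?thesis using False by (simp add: less_top)
qed (simp add: power_eq_top_ennreal)

text \<open>Replacing the true weights by \<open>c\<close> costs (1 + \<eta>)^q and replacing the
  Jacobians by \<open>b\<close> another 1 + \<eta>. \<open>Q\<close> is only bounded below by the
  sum because a fibre may also contain points outside all pieces.\<close>

lemma weighted_sum_powr_div_le:
  fixes \<rho> :: "'i \<Rightarrow> ennreal" and b c s j :: "'i \<Rightarrow> real"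
  assumes I: "finite I" and q: "1 < q" and \<alpha>: "\<alpha> = q / (q - 1)" and \<eta>: "0 < \<eta>"
    and pos: "\<And>i. i \<in> I \<Longrightarrow> 0 < b i" "\<And>i. i \<in> I \<Longrightarrow> 0 < c i" "\<And>i. i \<in> I \<Longrightarrow> 0 < s i" "\<And>i. i \<in> I \<Longrightarrow> 0 < j i"
    and c: "\<And>i. i \<in> I \<Longrightarrow> c i * j i \<le> (1 + \<eta>) * s i" and b: "\<And>i. i \<in> I \<Longrightarrow> b i \<le> (1 + \<eta>) * j i"
    and Q: "(\<Sum>i\<in>I. ennreal (s i powr \<alpha> / j i)) \<le> Q"
  shows "enn_powr (\<Sum>i\<in>I. ennreal (c i) * \<rho> i) q / enn_powr Q (q - 1)
    \<le> ennreal ((1 + \<eta>) powr (q + 1)) * (\<Sum>i\<in>I. ennreal (1 / b i) * enn_powr (\<rho> i) q)"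
\<comment> \<open>In the first two cases the left side is 0, division by \<open>top\<close> giving 0
  whatever the numerator; an infinite value of \<rho> makes the right side infinite.\<close>
proof (cases "I = {} \<or> Q = top \<or> (\<exists>i\<in>I. \<rho> i = top)")
  case True
  then consider "I = {}" | "Q = top" | i where "i \<in> I" "\<rho> i = top" by blast
  then show ?thesis
  proof cases
    case 2
    then show ?thesis by (simp add: divide_ennreal_def)
  next
    case (3 i)
    have "ennreal (1 / b i) * enn_powr (\<rho> i) q = top" using 3(2) pos(1)[OF 3(1)] by (simp add: ennreal_mult_top)
    then have "(\<Sum>i\<in>I. ennreal (1 / b i) * enn_powr (\<rho> i) q) = top"
      using 3(1) I by (metis (mono_tags, lifting) member_le_sum top.extremum_unique zero_le)
    then show ?thesis using \<eta> by (simp add: ennreal_mult_top)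
  qed (simp add: divide_ennreal_def)
next
  case False
  define t where "t i = enn2real (\<rho> i)" for i
  have t: "\<rho> i = ennreal (t i)" "0 \<le> t i" if "i \<in> I" for i
    using that False by (auto simp: t_def less_top)
  define Qr where "Qr = enn2real Q"
  have Qr: "Q = ennreal Qr" "0 \<le> Qr" using False by (auto simp: Qr_def less_top)
  define A where "A = (\<Sum>i\<in>I. s i powr \<alpha> / j i)"
  have wpos: "0 < s i powr \<alpha> / j i" if "i \<in> I" for i using pos(3,4)[OF that] by simp
  then have A: "0 < A" unfolding A_def using False by (intro sum_pos I) auto
  have AQ: "A \<le> Qr"
  proof -
    have "(\<Sum>i\<in>I. ennreal (s i powr \<alpha> / j i)) = ennreal A"
      unfolding A_def by (rule sum_ennreal) (rule less_imp_le[OF wpos])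
    then have "ennreal A \<le> ennreal Qr" using Q unfolding Qr(1) by simp
    then show ?thesis using Qr(2) by (simp add: ennreal_le_iff)
  qed
  define X where "X = (\<Sum>i\<in>I. c i * t i)"
  have X0: "0 \<le> X" unfolding X_def using t(2) pos(2) by (intro sum_nonneg mult_nonneg_nonneg) (auto intro: less_imp_le)
  have sumc: "(\<Sum>i\<in>I. ennreal (c i) * \<rho> i) = ennreal X"
  proof -
    have "(\<Sum>i\<in>I. ennreal (c i) * \<rho> i) = (\<Sum>i\<in>I. ennreal (c i * t i))"
      using t pos(2) by (intro sum.cong) (auto simp: ennreal_mult less_imp_le)
    also have "\<dots> = ennreal X" unfolding X_def using t(2) pos(2) by (subst sum_ennreal) (auto simp: less_imp_le)
    finally show ?thesis .
  qed
  have "X \<le> (1 + \<eta>) * (\<Sum>i\<in>I. t i * s i / j i)"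
    unfolding X_def sum_distrib_left
  proof (rule sum_mono)
    fix i assume i: "i \<in> I"
    have "c i \<le> (1 + \<eta>) * s i / j i" using c[OF i] pos(4)[OF i] by (simp add: pos_le_divide_eq)
    then have "c i * t i \<le> (1 + \<eta>) * s i / j i * t i" using t(2)[OF i] by (rule mult_right_mono)
    then show "c i * t i \<le> (1 + \<eta>) * (t i * s i / j i)" by (simp add: mult_ac)
  qed
  then have "X powr q \<le> ((1 + \<eta>) * (\<Sum>i\<in>I. t i * s i / j i)) powr q"
    using X0 q by (intro powr_mono2) auto
  also have "\<dots> = (1 + \<eta>) powr q * (\<Sum>i\<in>I. t i * s i / j i) powr q"
    by (rule powr_mult)
  also have "\<dots> \<le> (1 + \<eta>) powr q * (A powr (q - 1) * (\<Sum>i\<in>I. t i powr q / j i))"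
    unfolding A_def using t(2) pos by (intro mult_left_mono holder_sum_powr[OF I q \<alpha>]) auto
  also have "\<dots> \<le> (1 + \<eta>) powr q * (Qr powr (q - 1) * ((1 + \<eta>) * (\<Sum>i\<in>I. (1 / b i) * t i powr q)))"
  proof (intro mult_left_mono mult_mono)
    show "A powr (q - 1) \<le> Qr powr (q - 1)" using A AQ q by (intro powr_mono2) auto
    show "(\<Sum>i\<in>I. t i powr q / j i) \<le> (1 + \<eta>) * (\<Sum>i\<in>I. (1 / b i) * t i powr q)"
      unfolding sum_distrib_left
    proof (rule sum_mono)
      fix i assume i: "i \<in> I"
      have "1 / j i \<le> (1 + \<eta>) / b i" using b[OF i] pos(1,4)[OF i] by (simp add: field_simps)
      then have "1 / j i * t i powr q \<le> (1 + \<eta>) / b i * t i powr q" by (intro mult_right_mono) auto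
      then show "t i powr q / j i \<le> (1 + \<eta>) * (1 / b i * t i powr q)" by simp
    qed
    show "0 \<le> (\<Sum>i\<in>I. t i powr q / j i)" by (intro sum_nonneg divide_nonneg_pos pos(4)) auto
  qed auto
  also have "\<dots> = (1 + \<eta>) powr (q + 1) * (\<Sum>i\<in>I. (1 / b i) * t i powr q) * Qr powr (q - 1)"
    using \<eta> by (simp add: powr_add mult_ac)
  finally have main: "X powr q \<le> (1 + \<eta>) powr (q + 1) * (\<Sum>i\<in>I. (1 / b i) * t i powr q) * Qr powr (q - 1)" .
  have Qpos: "0 < Qr powr (q - 1)" using A AQ by simp
  have "enn_powr (\<Sum>i\<in>I. ennreal (c i) * \<rho> i) q / enn_powr Q (q - 1) = ennreal (X powr q / Qr powr (q - 1))"
    unfolding sumc Qr(1) using X0 Qr(2) Qpos by (simp add: enn_powr_ennreal divide_ennreal)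
  also have "\<dots> \<le> ennreal ((1 + \<eta>) powr (q + 1) * (\<Sum>i\<in>I. (1 / b i) * t i powr q))"
    using main Qpos by (intro ennreal_leI) (simp add: pos_divide_le_eq)
  also have "\<dots> = ennreal ((1 + \<eta>) powr (q + 1)) * (\<Sum>i\<in>I. ennreal (1 / b i) * enn_powr (\<rho> i) q)"
  proof -
    have nn: "0 \<le> 1 / b i * t i powr q" if "i \<in> I" for i using pos(1)[OF that] by simp
    have "(\<Sum>i\<in>I. ennreal (1 / b i) * enn_powr (\<rho> i) q) = (\<Sum>i\<in>I. ennreal ((1 / b i) * t i powr q))"
    proof (rule sum.cong[OF refl])
      fix i assume i: "i \<in> I"
      have "0 \<le> 1 / b i" using pos(1)[OF i] by simp
      then show "ennreal (1 / b i) * enn_powr (\<rho> i) q = ennreal ((1 / b i) * t i powr q)"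
        unfolding t(1)[OF i] enn_powr_ennreal[OF t(2)[OF i]] by (rule ennreal_mult[symmetric]) simp
    qed
    also have "\<dots> = ennreal (\<Sum>i\<in>I. (1 / b i) * t i powr q)" by (rule sum_ennreal[OF nn])
    finally show ?thesis by (simp only:) (rule ennreal_mult[OF _ sum_nonneg[OF nn]], simp)
  qed
  finally show ?thesis .
qed

section \<open>Summation over the pieces\<close>

lemma space_hyper_measure [simp]: "space hyper_measure = UNIV"
  by (simp add: hyper_measure_def space_hausdorff_measure)

lemma sets_borel_subset_hyper_measure: "sets borel \<subseteq> sets hyper_measure"
  unfolding hyper_measure_def by (rule sets_borel_subset_hausdorff_measure)

lemma borel_measurable_hyper_measure:
  "\<phi> \<in> borel_measurable borel \<Longrightarrow> \<phi> \<in> borel_measurable hyper_measure"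
  using sets_borel_subset_hyper_measure
  by (auto simp: measurable_def intro: subsetD)

lemma emeasure_hyper_measure_borel:
  fixes A :: "(real^'n) set"
  shows "A \<in> sets borel \<Longrightarrow> emeasure hyper_measure A = hausdorff_outer (CARD('n) - 1) A"
  unfolding hyper_measure_def by (rule emeasure_hausdorff_borel)

lemma good_piece_constants:
  fixes f :: "real^'n \<Rightarrow> real^'n"
  assumes "\<And>i. good_piece f y0 \<eta> (K i)"
  obtains b c :: "'i \<Rightarrow> real" where "\<And>i. 0 < b i" "\<And>i. 0 < c i"
    "\<And>i x. x \<in> K i \<Longrightarrow> b i \<le> (1 + \<eta>) * \<bar>jacobian_det f x\<bar>"
    "\<And>i x. x \<in> K i \<Longrightarrow> c i * \<bar>jacobian_det f x\<bar> \<le> (1 + \<eta>) * onorm (frechet_derivative f (at x))"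
    "\<And>i E. \<lbrakk>E \<subseteq> K i; E \<in> sets lebesgue; f ` E \<in> sets borel\<rbrakk> \<Longrightarrow>
        emeasure lborel (f ` E) \<le> ennreal (b i) * emeasure lebesgue E"
    "\<And>i r E. E \<subseteq> K i \<inter> {x. dist (f x) y0 = r} \<Longrightarrow>
        hausdorff_outer (CARD('n) - 1) E \<le> ennreal (c i) * hausdorff_outer (CARD('n) - 1) (f ` E)"
proof -
  define PP where "PP i b c \<longleftrightarrow> 0 < b \<and> 0 < c \<and>
      (\<forall>x\<in>K i. b \<le> (1 + \<eta>) * \<bar>jacobian_det f x\<bar> \<and>
        c * \<bar>jacobian_det f x\<bar> \<le> (1 + \<eta>) * onorm (frechet_derivative f (at x))) \<and>
      (\<forall>E\<subseteq>K i. E \<in> sets lebesgue \<longrightarrow> f ` E \<in> sets borel \<longrightarrow>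
        emeasure lborel (f ` E) \<le> ennreal b * emeasure lebesgue E) \<and>
      (\<forall>r. \<forall>E\<subseteq>K i \<inter> {x. dist (f x) y0 = r}.
        hausdorff_outer (CARD('n) - 1) E \<le> ennreal c * hausdorff_outer (CARD('n) - 1) (f ` E))" for i b c
  have "\<forall>i. \<exists>b c. PP i b c"
    using assms unfolding good_piece_def PP_def by blast
  from choice[OF this] obtain b where "\<forall>i. \<exists>c. PP i (b i) c" ..
  from choice[OF this] obtain c where PP: "\<forall>i. PP i (b i) (c i)" ..
  note PPi = spec[OF PP, unfolded PP_def]
  show thesis
    by (rule that[of b c]) (use PPi in blast)+
qed

text \<open>Three kinds of points remain outside the pieces: points of non-differentiability and the
  null remainder, handled by Luzin's property, and critical points, handled by the assumption on
  their image.\<close>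

lemma image_bad_null:
  fixes f :: "real^'n \<Rightarrow> real^'n"
  assumes ae: "AE x in lebesgue. x \<in> D \<longrightarrow> f differentiable (at x)" and N: "luzin_N D f"
    and J: "f ` {x \<in> D. f differentiable (at x) \<and> jacobian_det f x = 0} \<in> null_sets lebesgue"
    and B: "{x \<in> D. f differentiable (at x) \<and> jacobian_det f x \<noteq> 0 \<and> f x \<noteq> y0} - U \<in> null_sets lebesgue"
  shows "f ` ({x \<in> D. f x \<noteq> y0} - U) \<in> null_sets lebesgue"
proof -
  let ?B1 = "{x \<in> D. \<not> f differentiable (at x)}"
  let ?B2 = "{x \<in> D. f differentiable (at x) \<and> jacobian_det f x = 0}"
  let ?B3 = "{x \<in> D. f differentiable (at x) \<and> jacobian_det f x \<noteq> 0 \<and> f x \<noteq> y0} - U"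
  obtain Z where Z: "{x \<in> space lebesgue. \<not> (x \<in> D \<longrightarrow> f differentiable (at x))} \<subseteq> Z"
    "emeasure lebesgue Z = 0" "Z \<in> sets lebesgue" using AE_E[OF ae] by blast
  then have "negligible Z" by (simp add: negligible_iff_null_sets null_setsI)
  then have "negligible ?B1" by (rule negligible_subset) (use Z(1) in auto)
  then have B1: "?B1 \<in> null_sets lebesgue" by (simp only: negligible_iff_null_sets)
  have lN: "f ` E \<in> null_sets lebesgue" if "E \<subseteq> D" "E \<in> null_sets lebesgue" for E
    using N that by (simp add: luzin_N_def)
  have "f ` ?B1 \<in> null_sets lebesgue" by (rule lN[OF _ B1]) auto
  moreover have "f ` ?B3 \<in> null_sets lebesgue" by (rule lN[OF _ B]) auto
  ultimately have "negligible (f ` ?B1 \<union> f ` ?B2 \<union> f ` ?B3)"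
    using J by (intro negligible_Un) (auto simp: negligible_iff_null_sets)
  moreover have "f ` ({x \<in> D. f x \<noteq> y0} - U) \<subseteq> f ` ?B1 \<union> f ` ?B2 \<union> f ` ?B3" by blast
  ultimately have "negligible (f ` ({x \<in> D. f x \<noteq> y0} - U))" by (rule negligible_subset)
  then show ?thesis by (simp add: negligible_iff_null_sets)
qed

text \<open>
  The density on the image is \<open>R(y) = \<Sum> \<rho>(x) \<parallel>f'(x)\<parallel> / |J(x)|\<close>, summed over the preimages \<open>x\<close> of \<open>y\<close>, with
  the weights replaced by constants on countably many pieces, at the price of a factor \<open>1 + \<eta>\<close>.
\<close>

lemma push_forward_density:
  fixes f :: "real^'n \<Rightarrow> real^'n" and D :: "(real^'n) set" and \<rho> :: "real^'n \<Rightarrow> ennreal"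
  assumes n: "2 \<le> CARD('n)" and D: "open D" and f: "continuous_on D f"
    and ae: "AE x in lebesgue. x \<in> D \<longrightarrow> f differentiable (at x)" and N: "luzin_N D f"
    and J: "f ` {x \<in> D. f differentiable (at x) \<and> jacobian_det f x = 0} \<in> null_sets lebesgue"
    and fin: "\<And>y. finite {x \<in> D. f x = y}"
    and q: "1 < q" and \<alpha>: "\<alpha> = q / (q - 1)" and \<eta>: "0 < \<eta>" and \<rho>[measurable]: "\<rho> \<in> borel_measurable borel"
  obtains R where "R \<in> borel_measurable borel"
    "AE r in lebesgue. 0 < r \<longrightarrow> luzin_N_inv_on_sphere D f y0 r \<longrightarrow>
      (\<integral>\<^sup>+x\<in>D \<inter> f -` (sphere y0 r \<inter> f ` D). \<rho> x \<partial>hyper_measure) \<le> (\<integral>\<^sup>+y\<in>sphere y0 r \<inter> f ` D. R y \<partial>hyper_measure)"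
    "(\<integral>\<^sup>+y. enn_powr (R y) q / enn_powr (Q_dilatation D f \<alpha> y) (q - 1) \<partial>lebesgue)
      \<le> ennreal ((1 + \<eta>) powr (q + 1)) * (\<integral>\<^sup>+x. enn_powr (\<rho> x) q \<partial>lebesgue)"
proof -
  let ?k = "CARD('n) - 1"
  obtain K :: "nat \<Rightarrow> (real^'n) set" where K: "\<And>i. good_piece f y0 \<eta> (K i)" "\<And>i. fsigma (K i)" "\<And>i. K i \<subseteq> D"
    "disjoint_family K"
    "{x \<in> D. f differentiable (at x) \<and> jacobian_det f x \<noteq> 0 \<and> f x \<noteq> y0} - (\<Union>i. K i) \<in> null_sets lebesgue"
    using good_pieces_disjoint[OF n D f ae \<eta>] by blast
  obtain b c where bc: "\<And>i. 0 < b i" "\<And>i. 0 < c i"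
    "\<And>i x. x \<in> K i \<Longrightarrow> b i \<le> (1 + \<eta>) * \<bar>jacobian_det f x\<bar>"
    "\<And>i x. x \<in> K i \<Longrightarrow> c i * \<bar>jacobian_det f x\<bar> \<le> (1 + \<eta>) * onorm (frechet_derivative f (at x))"
    "\<And>i E. \<lbrakk>E \<subseteq> K i; E \<in> sets lebesgue; f ` E \<in> sets borel\<rbrakk> \<Longrightarrow>
        emeasure lborel (f ` E) \<le> ennreal (b i) * emeasure lebesgue E"
    "\<And>i r E. E \<subseteq> K i \<inter> {x. dist (f x) y0 = r} \<Longrightarrow>
        hausdorff_outer ?k E \<le> ennreal (c i) * hausdorff_outer ?k (f ` E)"
    by (rule good_piece_constants[OF K(1)]) (rule that)
  have inj: "inj_on f (K i)" and Jne: "\<And>x. x \<in> K i \<Longrightarrow> jacobian_det f x \<noteq> 0" for i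
    using K(1)[of i] unfolding good_piece_def by blast+
  have fK: "continuous_on (K i) f" for i using f K(3) by (rule continuous_on_subset)
  have Kb[measurable]: "K i \<in> sets borel" for i using K(2) by (rule fsigma_imp_borel)
  have fKb[measurable]: "f ` K i \<in> sets borel" for i by (rule fsigma_image_borel[OF K(2) fK])
  \<comment> \<open>The default value 0 is always multiplied by the indicator of the image of the
    piece.\<close>
  define g where "g i y = (if y \<in> f ` K i then the_inv_into (K i) f y else 0)" for i y
  have gm[measurable]: "g i \<in> borel_measurable borel" for i
    unfolding g_def by (rule the_inv_into_fsigma_measurable[OF K(2) fK inj])
  have gf: "g i (f x) = x" if "x \<in> K i" for i x
    using that the_inv_into_f_f[OF inj that] by (simp add: g_def)
  have gK: "g i y \<in> K i" "f (g i y) = y" if "y \<in> f ` K i" for i y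
    using that gf by auto
  define fh where "fh i x = (if x \<in> K i then f x else 0)" for i x
  have fhm[measurable]: "fh i \<in> borel_measurable borel" for i
    unfolding fh_def by (intro borel_measurable_continuous_on_if Kb fK continuous_on_const)
  define R where "R y = (\<Sum>i. ennreal (c i) * (indicator (f ` K i) y * \<rho> (g i y)))" for y
  have Rm: "R \<in> borel_measurable borel" unfolding R_def by measurable
  define Bad where "Bad = {x \<in> D. f x \<noteq> y0} - (\<Union>i. K i)"
  have "f ` Bad \<in> null_sets lebesgue" unfolding Bad_def by (rule image_bad_null[OF ae N J K(5)])
  then have "AE r in lebesgue. hausdorff_outer ?k (f ` Bad \<inter> {y. dist y y0 = r}) = 0"
  proof (rule AE_slice_hausdorff_null)
    show "0 < ?k" "DIM(real^'n) = Suc ?k" using n by auto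
    show "\<bar>dist x y0 - dist y y0\<bar> \<le> dist x y" for x y
      using dist_triangle[of x y0 y] dist_triangle[of y y0 x] dist_commute[of x y] by linarith
  qed
  then have surf: "AE r in lebesgue. 0 < r \<longrightarrow> luzin_N_inv_on_sphere D f y0 r \<longrightarrow>
      (\<integral>\<^sup>+x\<in>D \<inter> f -` (sphere y0 r \<inter> f ` D). \<rho> x \<partial>hyper_measure) \<le> (\<integral>\<^sup>+y\<in>sphere y0 r \<inter> f ` D. R y \<partial>hyper_measure)"
  proof eventually_elim
    case (elim r)
    show ?case
    proof (intro impI)
      assume r: "0 < r" and inv: "luzin_N_inv_on_sphere D f y0 r"
      define \<sigma> where "\<sigma> = D \<inter> f -` (sphere y0 r \<inter> f ` D)"
      have [measurable]: "sphere y0 r \<in> sets borel" by auto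
      have \<sigma>: "\<sigma> = D \<inter> f -` sphere y0 r" by (auto simp: \<sigma>_def)
      have "closedin (top_of_set D) \<sigma>"
        unfolding \<sigma> by (rule continuous_closedin_preimage[OF f]) simp
      then obtain T where "closed T" "\<sigma> = D \<inter> T" by (auto simp: closedin_closed)
      then have \<sigma>b[measurable]: "\<sigma> \<in> sets borel" using D by auto
      have "f ` Bad \<inter> {y. dist y y0 = r} \<subseteq> sphere y0 r \<inter> f ` D" by (auto simp: Bad_def dist_commute)
      then have "hausdorff_outer ?k (D \<inter> f -` (f ` Bad \<inter> {y. dist y y0 = r})) = 0"
        using inv elim unfolding luzin_N_inv_on_sphere_def by blast
      \<comment> \<open>Here \<open>r > 0\<close> guarantees that no point of the surface lies over
        \<open>y0\<close>.\<close>
      moreover have "\<sigma> - (\<Union>i. K i) \<subseteq> D \<inter> f -` (f ` Bad \<inter> {y. dist y y0 = r})"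
        using r by (auto simp: \<sigma> Bad_def dist_commute)
      ultimately have "hausdorff_outer ?k (\<sigma> - (\<Union>i. K i)) = 0" by (rule hausdorff_outer_null_subset)
      then have "emeasure hyper_measure (\<sigma> - (\<Union>i. K i)) = 0"
        by (subst emeasure_hyper_measure_borel) auto
      moreover have "\<sigma> - (\<Union>i. K i) \<in> sets hyper_measure"
        by (rule subsetD[OF sets_borel_subset_hyper_measure]) measurable
      ultimately have "AE x in hyper_measure. x \<notin> \<sigma> - (\<Union>i. K i)"
        by (intro AE_not_in null_setsI)
      then have ae2: "AE x in hyper_measure. \<rho> x * indicator \<sigma> x = (\<Sum>i. \<rho> x * indicator (K i \<inter> \<sigma>) x)"
      proof eventually_elim
        case (elim x)
        have "disjoint_family (\<lambda>i. K i \<inter> \<sigma>)" using K(4) by (rule disjoint_family_on_bisimulation) auto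
        then have "(\<Sum>i. indicator (K i \<inter> \<sigma>) x :: ennreal) = indicator (\<Union>i. K i \<inter> \<sigma>) x"
          by (rule suminf_indicator)
        also have "\<dots> = indicator \<sigma> x" using elim by (auto simp: indicator_def)
        finally show ?case by simp
      qed
      have "(\<integral>\<^sup>+x. \<rho> x * indicator \<sigma> x \<partial>hyper_measure) = (\<integral>\<^sup>+x. (\<Sum>i. \<rho> x * indicator (K i \<inter> \<sigma>) x) \<partial>hyper_measure)"
        by (rule nn_integral_cong_AE[OF ae2])
      also have "\<dots> = (\<Sum>i. \<integral>\<^sup>+x. \<rho> x * indicator (K i \<inter> \<sigma>) x \<partial>hyper_measure)"
        by (intro nn_integral_suminf borel_measurable_hyper_measure) measurable
      also have "\<dots> \<le> (\<Sum>i. ennreal (c i) * (\<integral>\<^sup>+y. \<rho> (g i y) * indicator (f ` K i \<inter> sphere y0 r) y \<partial>hyper_measure))"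
      proof (intro suminf_le)
        fix i
        \<comment> \<open>On the piece \<open>x\<close> is recovered from its image, so the
          integrand becomes a Borel function of the image point.\<close>
        have "(\<integral>\<^sup>+x. \<rho> x * indicator (K i \<inter> \<sigma>) x \<partial>hyper_measure) = (\<integral>\<^sup>+x. \<rho> (g i (fh i x)) * indicator (K i \<inter> \<sigma>) x \<partial>hyper_measure)"
          by (intro nn_integral_cong) (auto simp: indicator_def fh_def gf)
        also have "\<dots> \<le> ennreal (c i) * (\<integral>\<^sup>+y. \<rho> (g i y) * indicator (f ` K i \<inter> sphere y0 r) y \<partial>hyper_measure)"
        proof (rule nn_integral_transfer_le)
          show "fh i \<in> borel_measurable hyper_measure" by (rule borel_measurable_hyper_measure[OF fhm])
          show "K i \<inter> \<sigma> \<in> sets hyper_measure" by (rule subsetD[OF sets_borel_subset_hyper_measure]) measurable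
          show Y: "f ` K i \<inter> sphere y0 r \<in> sets hyper_measure"
            by (rule subsetD[OF sets_borel_subset_hyper_measure]) (use fKb in auto)
          show "sets borel \<subseteq> sets hyper_measure" by (rule sets_borel_subset_hyper_measure)
          show "space hyper_measure = UNIV" by simp
          show "(\<lambda>y. \<rho> (g i y)) \<in> borel_measurable borel" by measurable
          fix B :: "(real^'n) set" assume B[measurable]: "B \<in> sets borel"
          let ?E = "K i \<inter> \<sigma> \<inter> fh i -` B"
          have "fh i -` B \<in> sets borel" using measurable_sets[OF fhm B] by simp
          then have E: "?E \<in> sets borel" by auto
          have YB: "f ` K i \<inter> sphere y0 r \<inter> B \<in> sets borel" using fKb B by auto
          have "emeasure hyper_measure (K i \<inter> \<sigma> \<inter> (fh i -` B \<inter> space hyper_measure)) = hausdorff_outer ?k ?E"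
            using emeasure_hyper_measure_borel[OF E] by (simp add: Int_assoc)
          also have "\<dots> \<le> ennreal (c i) * hausdorff_outer ?k (f ` ?E)"
            by (rule bc(6)[where r = r]) (auto simp: \<sigma> dist_commute)
          also have "\<dots> \<le> ennreal (c i) * hausdorff_outer ?k (f ` K i \<inter> sphere y0 r \<inter> B)"
            by (intro mult_left_mono hausdorff_outer_mono) (auto simp: \<sigma> fh_def)
          also have "\<dots> = ennreal (c i) * emeasure hyper_measure (f ` K i \<inter> sphere y0 r \<inter> B)"
            using emeasure_hyper_measure_borel[OF YB] by simp
          finally show "emeasure hyper_measure (K i \<inter> \<sigma> \<inter> (fh i -` B \<inter> space hyper_measure))
            \<le> ennreal (c i) * emeasure hyper_measure (f ` K i \<inter> sphere y0 r \<inter> B)" .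
        qed
        finally show "(\<integral>\<^sup>+x. \<rho> x * indicator (K i \<inter> \<sigma>) x \<partial>hyper_measure)
          \<le> ennreal (c i) * (\<integral>\<^sup>+y. \<rho> (g i y) * indicator (f ` K i \<inter> sphere y0 r) y \<partial>hyper_measure)" .
      qed auto
      also have "\<dots> = (\<Sum>i. \<integral>\<^sup>+y. ennreal (c i) * (\<rho> (g i y) * indicator (f ` K i \<inter> sphere y0 r) y) \<partial>hyper_measure)"
        by (intro suminf_cong nn_integral_cmult[symmetric] borel_measurable_hyper_measure) measurable
      also have "\<dots> = (\<integral>\<^sup>+y. (\<Sum>i. ennreal (c i) * (\<rho> (g i y) * indicator (f ` K i \<inter> sphere y0 r) y)) \<partial>hyper_measure)"
        by (intro nn_integral_suminf[symmetric] borel_measurable_hyper_measure) measurable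
      also have "\<dots> = (\<integral>\<^sup>+y. R y * indicator (sphere y0 r \<inter> f ` D) y \<partial>hyper_measure)"
      proof (rule nn_integral_cong)
        fix y
        have "R y * indicator (sphere y0 r \<inter> f ` D) y
            = (\<Sum>i. ennreal (c i) * (indicator (f ` K i) y * \<rho> (g i y)) * indicator (sphere y0 r \<inter> f ` D) y)"
          unfolding R_def by simp
        also have "\<dots> = (\<Sum>i. ennreal (c i) * (\<rho> (g i y) * indicator (f ` K i \<inter> sphere y0 r) y))"
        proof (rule suminf_cong)
          fix i
          have "f ` K i \<subseteq> f ` D" using K(3) by blast
          then show "ennreal (c i) * (indicator (f ` K i) y * \<rho> (g i y)) * indicator (sphere y0 r \<inter> f ` D) y
            = ennreal (c i) * (\<rho> (g i y) * indicator (f ` K i \<inter> sphere y0 r) y)"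
            by (auto simp: indicator_def)
        qed
        finally show "(\<Sum>i. ennreal (c i) * (\<rho> (g i y) * indicator (f ` K i \<inter> sphere y0 r) y))
          = R y * indicator (sphere y0 r \<inter> f ` D) y" by simp
      qed
      finally show "(\<integral>\<^sup>+x\<in>D \<inter> f -` (sphere y0 r \<inter> f ` D). \<rho> x \<partial>hyper_measure)
          \<le> (\<integral>\<^sup>+y\<in>sphere y0 r \<inter> f ` D. R y \<partial>hyper_measure)" unfolding \<sigma>_def .
    qed
  qed
  let ?C = "ennreal ((1 + \<eta>) powr (q + 1))"
  \<comment> \<open>The counterpart of \<open>R\<close> for the right side of Hoelder's inequality:
    it approximates the sum of \<rho>(x)^q / |J(x)| over the fibre.\<close>
  define S where "S y = (\<Sum>i. ennreal (1 / b i) * (indicator (f ` K i) y * enn_powr (\<rho> (g i y)) q))" for y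
  have Sm: "S \<in> borel_measurable borel" unfolding S_def by measurable
  have pointwise: "enn_powr (R y) q / enn_powr (Q_dilatation D f \<alpha> y) (q - 1) \<le> ?C * S y" for y
  proof -
    define I where "I = {i. y \<in> f ` K i}"
    have gI: "g i y \<in> K i" "f (g i y) = y" if "i \<in> I" for i using that gK by (auto simp: I_def)
    have inI: "inj_on (\<lambda>i. g i y) I"
    proof (rule inj_onI, rule ccontr)
      fix i j assume "i \<in> I" "j \<in> I" "g i y = g j y" "i \<noteq> j"
      then have "g i y \<in> K i \<inter> K j" using gI(1)[of i] gI(1)[of j] by simp
      then show False using K(4) \<open>i \<noteq> j\<close> by (auto simp: disjoint_family_on_def)
    qed
    have sub: "(\<lambda>i. g i y) ` I \<subseteq> {x \<in> D. f x = y}" using gI K(3) by blast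
    have I: "finite I" using inj_on_finite[OF inI sub fin] .
    have Rsum: "R y = (\<Sum>i\<in>I. ennreal (c i) * \<rho> (g i y))"
    proof -
      have "R y = (\<Sum>i\<in>I. ennreal (c i) * (indicator (f ` K i) y * \<rho> (g i y)))"
        unfolding R_def by (rule suminf_finite[OF I]) (simp add: I_def)
      also have "\<dots> = (\<Sum>i\<in>I. ennreal (c i) * \<rho> (g i y))" by (intro sum.cong) (auto simp: I_def)
      finally show ?thesis .
    qed
    have Ssum: "S y = (\<Sum>i\<in>I. ennreal (1 / b i) * enn_powr (\<rho> (g i y)) q)"
    proof -
      have "S y = (\<Sum>i\<in>I. ennreal (1 / b i) * (indicator (f ` K i) y * enn_powr (\<rho> (g i y)) q))"
        unfolding S_def by (rule suminf_finite[OF I]) (simp add: I_def)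
      also have "\<dots> = (\<Sum>i\<in>I. ennreal (1 / b i) * enn_powr (\<rho> (g i y)) q)" by (intro sum.cong) (auto simp: I_def)
      finally show ?thesis .
    qed
    \<comment> \<open>The pieces are disjoint, so different indices give different points of the
      fibre and the sum over pieces is part of the sum defining \<open>Q_dilatation\<close>.\<close>
    have Qge: "(\<Sum>i\<in>I. ennreal (onorm (frechet_derivative f (at (g i y))) powr \<alpha> / \<bar>jacobian_det f (g i y)\<bar>))
        \<le> Q_dilatation D f \<alpha> y"
    proof -
      have "(\<Sum>i\<in>I. ennreal (onorm (frechet_derivative f (at (g i y))) powr \<alpha> / \<bar>jacobian_det f (g i y)\<bar>))
          = (\<Sum>i\<in>I. outer_dilatation \<alpha> f (g i y))"
        using Jne gI(1) by (intro sum.cong) (auto simp: outer_dilatation_def)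
      also have "\<dots> = (\<Sum>x\<in>(\<lambda>i. g i y) ` I. outer_dilatation \<alpha> f x)"
        by (simp add: sum.reindex[OF inI])
      also have "\<dots> \<le> Q_dilatation D f \<alpha> y"
        unfolding Q_dilatation_def by (intro sum_mono2 fin sub) auto
      finally show ?thesis .
    qed
    show ?thesis
      unfolding Rsum Ssum
    proof (rule weighted_sum_powr_div_le[OF I q \<alpha> \<eta> _ _ _ _ _ _ Qge])
      fix i assume i: "i \<in> I"
      show "0 < b i" "0 < c i" by (rule bc)+
      show Jp: "0 < \<bar>jacobian_det f (g i y)\<bar>" using Jne[OF gI(1)[OF i]] by simp
      show "b i \<le> (1 + \<eta>) * \<bar>jacobian_det f (g i y)\<bar>" by (rule bc(3)[OF gI(1)[OF i]])
      show cj: "c i * \<bar>jacobian_det f (g i y)\<bar> \<le> (1 + \<eta>) * onorm (frechet_derivative f (at (g i y)))"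
        by (rule bc(4)[OF gI(1)[OF i]])
      have "0 < c i * \<bar>jacobian_det f (g i y)\<bar>" using bc(2) Jp by simp
      then have "0 < (1 + \<eta>) * onorm (frechet_derivative f (at (g i y)))" using cj by linarith
      then show "0 < onorm (frechet_derivative f (at (g i y)))" using \<eta> by (simp add: zero_less_mult_iff)
    qed
  qed
  have piece: "(\<integral>\<^sup>+y. enn_powr (\<rho> (g i y)) q * indicator (f ` K i) y \<partial>lborel)
      \<le> ennreal (b i) * (\<integral>\<^sup>+x. enn_powr (\<rho> x) q * indicator (K i) x \<partial>lborel)" for i
  proof (rule nn_integral_transfer_le[where \<phi> = "\<lambda>x. enn_powr (\<rho> x) q"])
    show "g i \<in> borel_measurable lborel" by simp
    show "f ` K i \<in> sets lborel" "K i \<in> sets lborel" using fKb Kb by auto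
    show "(\<lambda>x. enn_powr (\<rho> x) q) \<in> borel_measurable borel" by measurable
    fix B :: "(real^'n) set" assume B: "B \<in> sets borel"
    have eq: "f ` K i \<inter> (g i -` B \<inter> space lborel) = f ` (K i \<inter> B)"
      using gf by auto
    have "f ` K i \<inter> (g i -` B \<inter> space lborel) \<in> sets borel"
      using measurable_sets[OF gm B] fKb by auto
    then have "f ` (K i \<inter> B) \<in> sets borel" unfolding eq .
    then have "emeasure lborel (f ` (K i \<inter> B)) \<le> ennreal (b i) * emeasure lebesgue (K i \<inter> B)"
      using Kb B by (intro bc(5)) auto
    then show "emeasure lborel (f ` K i \<inter> (g i -` B \<inter> space lborel)) \<le> ennreal (b i) * emeasure lborel (K i \<inter> B)"
      unfolding eq using Kb B by simp
  qed auto
  \<comment> \<open>Monotonicity of the integral holds for arbitrary functions, so the pointwise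
    bound moves the estimate to the Borel function \<open>S\<close>.\<close>
  have "(\<integral>\<^sup>+y. enn_powr (R y) q / enn_powr (Q_dilatation D f \<alpha> y) (q - 1) \<partial>lebesgue) \<le> (\<integral>\<^sup>+y. ?C * S y \<partial>lebesgue)"
    by (intro nn_integral_mono pointwise)
  also have "\<dots> = (\<integral>\<^sup>+y. ?C * S y \<partial>lborel)"
    by (rule nn_integral_completion)
  also have "\<dots> = ?C * (\<integral>\<^sup>+y. S y \<partial>lborel)" using Sm by (intro nn_integral_cmult) simp
  also have "(\<integral>\<^sup>+y. S y \<partial>lborel) = (\<Sum>i. \<integral>\<^sup>+y. ennreal (1 / b i) * (indicator (f ` K i) y * enn_powr (\<rho> (g i y)) q) \<partial>lborel)"
    unfolding S_def by (intro nn_integral_suminf) measurable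
  also have "\<dots> \<le> (\<Sum>i. \<integral>\<^sup>+x. enn_powr (\<rho> x) q * indicator (K i) x \<partial>lborel)"
  proof (intro suminf_le)
    fix i
    have "(\<integral>\<^sup>+y. ennreal (1 / b i) * (indicator (f ` K i) y * enn_powr (\<rho> (g i y)) q) \<partial>lborel)
        = ennreal (1 / b i) * (\<integral>\<^sup>+y. enn_powr (\<rho> (g i y)) q * indicator (f ` K i) y \<partial>lborel)"
      by (subst nn_integral_cmult) (auto simp: mult.commute)
    also have "\<dots> \<le> ennreal (1 / b i) * (ennreal (b i) * (\<integral>\<^sup>+x. enn_powr (\<rho> x) q * indicator (K i) x \<partial>lborel))"
      by (intro mult_left_mono piece) simp
    also have "\<dots> = (\<integral>\<^sup>+x. enn_powr (\<rho> x) q * indicator (K i) x \<partial>lborel)"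
    proof -
      have "ennreal (1 / b i) * ennreal (b i) = ennreal (1 / b i * b i)"
        using bc(1)[of i] by (intro ennreal_mult[symmetric]) auto
      also have "\<dots> = 1" using bc(1)[of i] by simp
      finally show ?thesis by (simp add: mult.assoc[symmetric])
    qed
    finally show "(\<integral>\<^sup>+y. ennreal (1 / b i) * (indicator (f ` K i) y * enn_powr (\<rho> (g i y)) q) \<partial>lborel)
      \<le> (\<integral>\<^sup>+x. enn_powr (\<rho> x) q * indicator (K i) x \<partial>lborel)" .
  qed auto
  also have "\<dots> = (\<integral>\<^sup>+x. (\<Sum>i. enn_powr (\<rho> x) q * indicator (K i) x) \<partial>lborel)"
    by (intro nn_integral_suminf[symmetric]) measurable
  also have "\<dots> \<le> (\<integral>\<^sup>+x. enn_powr (\<rho> x) q \<partial>lborel)"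
  proof (rule nn_integral_mono)
    fix x
    have "(\<Sum>i. enn_powr (\<rho> x) q * indicator (K i) x) = enn_powr (\<rho> x) q * indicator (\<Union>i. K i) x"
      by (simp add: suminf_indicator[OF K(4)])
    also have "\<dots> \<le> enn_powr (\<rho> x) q" by (auto simp: indicator_def)
    finally show "(\<Sum>i. enn_powr (\<rho> x) q * indicator (K i) x) \<le> enn_powr (\<rho> x) q" .
  qed
  also have "\<dots> = (\<integral>\<^sup>+x. enn_powr (\<rho> x) q \<partial>lebesgue)"
    by (rule nn_integral_completion[symmetric])
  finally have vol: "(\<integral>\<^sup>+y. enn_powr (R y) q / enn_powr (Q_dilatation D f \<alpha> y) (q - 1) \<partial>lebesgue)
      \<le> ?C * (\<integral>\<^sup>+x. enn_powr (\<rho> x) q \<partial>lebesgue)" by (simp add: mult_left_mono)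
  show thesis by (rule that[OF Rm surf vol])
qed

section \<open>Exceptional radii\<close>

text \<open>The union of the spheres with radii in \<open>Z\<close> is Lebesgue null, so the density
  equal to \<open>top\<close> there and 0 elsewhere has integral zero. On a slice of positive area
  the same density has infinite integral.\<close>

lemma modulus_sphere_family_null:
  fixes f :: "real^'n \<Rightarrow> real^'n"
  assumes Z: "Z \<in> null_sets lborel" and p: "0 < p" and n: "2 \<le> CARD('n)" and fD: "f ` D \<in> sets borel"
    and pos: "\<And>r. r \<in> W \<Longrightarrow> r \<in> Z \<and> hausdorff_outer (CARD('n) - 1) (sphere y0 r \<inter> f ` D) \<noteq> 0"
  shows "modulus p {sphere y0 r \<inter> f ` D | r. r \<in> W} = 0"
proof -
  have Zb[measurable]: "Z \<in> sets borel" using Z by auto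
  define A where "A = {y. dist y y0 \<in> Z}"
  have An: "A \<in> null_sets lborel" unfolding A_def by (rule null_sets_radial[OF Z])
  then have Ab[measurable]: "A \<in> sets borel" by auto
  define \<rho> :: "real^'n \<Rightarrow> ennreal" where "\<rho> y = top * indicator A y" for y :: "real^'n"
  have \<rho>m: "\<rho> \<in> borel_measurable borel" unfolding \<rho>_def by measurable
  have "1 \<le> (\<integral>\<^sup>+y\<in>sphere y0 r \<inter> f ` D. \<rho> y ^ (CARD('n) - 1) \<partial>hyper_measure)" if "r \<in> W" for r
  proof -
    have Sb: "sphere y0 r \<inter> f ` D \<in> sets borel" using fD by auto
    have Sh: "sphere y0 r \<inter> f ` D \<in> sets hyper_measure"
      using sets_borel_subset_hyper_measure Sb by blast
    have "(\<integral>\<^sup>+y\<in>sphere y0 r \<inter> f ` D. \<rho> y ^ (CARD('n) - 1) \<partial>hyper_measure)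
        = (\<integral>\<^sup>+y. top * indicator (sphere y0 r \<inter> f ` D) y \<partial>hyper_measure)"
    proof (rule nn_integral_cong)
      fix y
      have "\<rho> y ^ (CARD('n) - 1) = top" if "y \<in> sphere y0 r"
        using that pos[OF \<open>r \<in> W\<close>] n
        by (simp add: \<rho>_def A_def dist_commute power_eq_top_ennreal)
      then show "\<rho> y ^ (CARD('n) - 1) * indicator (sphere y0 r \<inter> f ` D) y = top * indicator (sphere y0 r \<inter> f ` D) y"
        by (auto simp: indicator_def)
    qed
    also have "\<dots> = top * emeasure hyper_measure (sphere y0 r \<inter> f ` D)"
      by (rule nn_integral_cmult_indicator[OF Sh])
    also have "\<dots> = top"
      using pos[OF that] emeasure_hyper_measure_borel[OF Sb] by (simp add: ennreal_top_mult)
    finally show ?thesis by simp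
  qed
  then have "\<rho> \<in> adm {sphere y0 r \<inter> f ` D | r. r \<in> W}"
    using \<rho>m unfolding adm_def by blast
  then have "modulus p {sphere y0 r \<inter> f ` D | r. r \<in> W} \<le> (\<integral>\<^sup>+x. enn_powr (\<rho> x) p \<partial>lebesgue)"
    unfolding modulus_def by (rule INF_lower)
  also have "\<dots> = (\<integral>\<^sup>+x. enn_powr (\<rho> x) p \<partial>lborel)" by (rule nn_integral_completion)
  also have "\<dots> = (\<integral>\<^sup>+(x::real^'n). 0 \<partial>lborel)"
  proof (rule nn_integral_cong_AE)
    have "AE x in lborel. x \<notin> A" using An by (rule AE_not_in)
    then show "AE x in lborel. enn_powr (\<rho> x) p = 0" by eventually_elim (simp add: \<rho>_def)
  qed
  finally show ?thesis by simp
qed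

section \<open>The modulus inequality\<close>

lemma emeasure_count_space_fibre_le_multiplicity:
  "emeasure (count_space UNIV) {x \<in> D. f x = y} \<le> multiplicity_on D f"
  unfolding multiplicity_on_def by (rule SUP_upper) simp

lemma finite_fibre:
  assumes "multiplicity_on D f < \<infinity>"
  shows "finite {x \<in> D. f x = y}"
proof (rule ccontr)
  assume "infinite {x \<in> D. f x = y}"
  then have "emeasure (count_space UNIV) {x \<in> D. f x = y} = top"
    by (simp add: emeasure_count_space_infinite)
  then show False
    using assms emeasure_count_space_fibre_le_multiplicity[of D f y] by (simp add: top_unique)
qed

lemma one_le_multiplicity:
  assumes "D \<noteq> {}"
  shows "1 \<le> multiplicity_on D f"
proof -
  obtain a where "a \<in> D" using assms by blast
  then have "emeasure (count_space UNIV) {a} \<le> emeasure (count_space UNIV) {x \<in> D. f x = f a}"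
    by (intro emeasure_mono) auto
  then show ?thesis
    using emeasure_count_space_fibre_le_multiplicity[of D f "f a"] by (simp add: order_trans)
qed

lemma one_le_enn_powr: "1 \<le> x \<Longrightarrow> 0 \<le> a \<Longrightarrow> 1 \<le> enn_powr x a"
proof (cases x)
  case (real r)
  then show "1 \<le> x \<Longrightarrow> 0 \<le> a \<Longrightarrow> 1 \<le> enn_powr x a"
    by (simp add: enn_powr_ennreal ge_one_powr_ge_zero)
qed simp

lemma continuous_image_open_borel:
  fixes f :: "'a::euclidean_space \<Rightarrow> 'b::euclidean_space"
  assumes "open D" "continuous_on D f"
  shows "f ` D \<in> sets borel"
proof -
  obtain C :: "nat \<Rightarrow> 'a set" where "\<And>n. compact (C n)" "D = \<Union>(range C)"
    using open_Union_compact_subsets[OF \<open>open D\<close>] by metis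
  then have "range C \<subseteq> Collect compact" by auto
  with \<open>D = \<Union>(range C)\<close> have "fsigma D" using fsigma_Union_compact[of D] by metis
  then show ?thesis using \<open>continuous_on D f\<close> by (rule fsigma_image_borel)
qed

text \<open>That \<open>y0\<close> is in the closure of the image gives an image point inside the
  sphere, and the supremum defining the outer radius gives one outside.\<close>

lemma image_slice_hausdorff_nonnull:
  fixes f :: "real^'n \<Rightarrow> real^'n"
  assumes n: "2 \<le> CARD('n)" and D: "open D" "connected D" and f: "continuous_on D f"
    and fin: "\<And>y. finite {x \<in> D. f x = y}" and y0: "y0 \<in> closure (f ` D)"
    and r: "0 < r" "ereal r < (SUP y \<in> f ` D. ereal (dist y y0))"
  shows "hausdorff_outer (CARD('n) - 1) (sphere y0 r \<inter> f ` D) \<noteq> 0"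
proof -
  obtain a where "a \<in> D" "dist (f a) y0 < r"
    using y0 r(1) unfolding closure_approachable by blast
  moreover obtain b where "b \<in> D" "r < dist (f b) y0"
    using r(2) unfolding less_SUP_iff by auto
  ultimately show ?thesis
    using n by (intro sphere_slice_hausdorff_nonnull[OF D f fin]) auto
qed

text \<open>The exceptional set is enlarged to a Borel null set, as the Fubini argument along rays
  needs a Borel set of radii.\<close>

lemma AE_lebesgue_null_set_real:
  assumes "AE r in lebesgue. P r"
  obtains Z :: "real set" where "Z \<in> null_sets lborel" "\<And>r. r \<notin> Z \<Longrightarrow> P r"
proof -
  obtain N where "{r \<in> space lebesgue. \<not> P r} \<subseteq> N" "emeasure lebesgue N = 0" "N \<in> sets lebesgue"
    using AE_E[OF assms] by blast
  then have "N \<in> null_sets lebesgue" by (intro null_setsI)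
  then obtain Z where "Z \<in> null_sets lborel" "N \<subseteq> Z" unfolding null_sets_completion_iff2 by blast
  with \<open>{r \<in> space lebesgue. \<not> P r} \<subseteq> N\<close> show thesis by (intro that[of Z]) auto
qed

theorem lemma2p1:
  fixes f :: "real ^ 'n \<Rightarrow> real ^ 'n" and D :: "(real ^ 'n) set"
    and y\<^sub>0 :: "real ^ 'n" and p \<epsilon> \<epsilon>\<^sub>0 \<alpha> :: real and r\<^sub>0 :: ereal and n :: nat
  assumes "n = CARD('n)" and "n \<ge> 2"
    and "open D" and "connected D" and "D \<noteq> {}"
    and "p > real n - 1"
    and "continuous_on D f"
    and "AE x in lebesgue. x \<in> D \<longrightarrow> f differentiable (at x)"
    and "luzin_N D f"
    and "multiplicity_on D f < \<infinity>"
    and "y\<^sub>0 \<in> closure (f ` D)"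
    and "r\<^sub>0 = (SUP y \<in> f ` D. ereal (dist y y\<^sub>0))"
    and "0 < \<epsilon>\<^sub>0" and "ereal \<epsilon>\<^sub>0 < r\<^sub>0"
    and "0 < \<epsilon>" and "\<epsilon> < \<epsilon>\<^sub>0"
    and "f ` {x \<in> D. f differentiable (at x) \<and> jacobian_det f x = 0} \<in> null_sets lebesgue"
    and "AE r in lebesgue. \<epsilon> < r \<and> ereal r < r\<^sub>0 \<longrightarrow> luzin_N_inv_on_sphere D f y\<^sub>0 r"
    and "\<alpha> = p / (p - real n + 1)"
  shows "modulus_tilde (p / (real n - 1)) (preimage_surfaces D f y\<^sub>0 \<epsilon> r\<^sub>0) \<ge>
    1 / enn_powr (multiplicity_on D f) (p / (real n - 1)) *
    (INF \<rho> \<in> ext_adm p (image_surfaces D f y\<^sub>0 \<epsilon> r\<^sub>0).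
       \<integral>\<^sup>+y\<in>f ` D \<inter> annulus y\<^sub>0 \<epsilon> r\<^sub>0.
         (enn_powr (\<rho> y) p / enn_powr (Q_dilatation D f \<alpha> y) ((p - real n + 1) / (real n - 1))) \<partial>lebesgue)"
proof -
  define k where "k = n - 1"
  define q where "q = p / real k"
  have card: "2 \<le> CARD('n)" and k: "0 < k" "real n - 1 = real k" "CARD('n) - 1 = k"
    using assms(1,2) by (auto simp: k_def)
  have kp: "real k < p" and p0: "0 < p" using assms(6) k by auto
  have q: "1 < q" using kp k by (simp add: q_def)
  have q1: "(p - real n + 1) / (real n - 1) = q - 1" "p / (real n - 1) = q"
    using k by (auto simp: q_def field_simps)
  have \<alpha>: "\<alpha> = q / (q - 1)"
    using k kp assms(19) by (simp add: q_def divide_simps) (simp add: algebra_simps)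
  have fin: "finite {x \<in> D. f x = y}" for y by (rule finite_fibre[OF assms(10)])
  have fD: "f ` D \<in> sets borel" using assms(3,7) by (rule continuous_image_open_borel)
  let ?I = "INF \<rho> \<in> ext_adm p (image_surfaces D f y\<^sub>0 \<epsilon> r\<^sub>0). \<integral>\<^sup>+y\<in>f ` D \<inter> annulus y\<^sub>0 \<epsilon> r\<^sub>0.
         (enn_powr (\<rho> y) p / enn_powr (Q_dilatation D f \<alpha> y) (q - 1)) \<partial>lebesgue"
  have main: "?I \<le> ennreal ((1 + \<eta>) powr (q + 1)) * (\<integral>\<^sup>+x. enn_powr (\<rho> x) q \<partial>lebesgue)"
    if \<eta>: "0 < \<eta>" and \<rho>: "\<rho> \<in> borel_measurable borel"
      "\<forall>\<sigma>\<in>preimage_surfaces D f y\<^sub>0 \<epsilon> r\<^sub>0. 1 \<le> (\<integral>\<^sup>+x\<in>\<sigma>. \<rho> x \<partial>hyper_measure)" for \<eta> \<rho>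
  proof -
    obtain R where R: "R \<in> borel_measurable borel"
      and surf: "AE r in lebesgue. 0 < r \<longrightarrow> luzin_N_inv_on_sphere D f y\<^sub>0 r \<longrightarrow>
        (\<integral>\<^sup>+x\<in>D \<inter> f -` (sphere y\<^sub>0 r \<inter> f ` D). \<rho> x \<partial>hyper_measure)
          \<le> (\<integral>\<^sup>+y\<in>sphere y\<^sub>0 r \<inter> f ` D. R y \<partial>hyper_measure)"
      and vol: "(\<integral>\<^sup>+y. enn_powr (R y) q / enn_powr (Q_dilatation D f \<alpha> y) (q - 1) \<partial>lebesgue)
        \<le> ennreal ((1 + \<eta>) powr (q + 1)) * (\<integral>\<^sup>+x. enn_powr (\<rho> x) q \<partial>lebesgue)"
      by (rule push_forward_density[OF card assms(3,7-9,17) fin q \<alpha> \<eta> \<rho>(1)])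
    have "AE r in lebesgue. \<epsilon> < r \<and> ereal r < r\<^sub>0 \<longrightarrow> 1 \<le> (\<integral>\<^sup>+y\<in>sphere y\<^sub>0 r \<inter> f ` D. R y \<partial>hyper_measure)"
      using surf assms(18)
    proof eventually_elim
      case (elim r)
      show ?case
      proof
        assume r: "\<epsilon> < r \<and> ereal r < r\<^sub>0"
        then have "D \<inter> f -` (sphere y\<^sub>0 r \<inter> f ` D) \<in> preimage_surfaces D f y\<^sub>0 \<epsilon> r\<^sub>0"
          unfolding preimage_surfaces_def by blast
        with \<rho>(2) have "1 \<le> (\<integral>\<^sup>+x\<in>D \<inter> f -` (sphere y\<^sub>0 r \<inter> f ` D). \<rho> x \<partial>hyper_measure)" ..
        also have "\<dots> \<le> (\<integral>\<^sup>+y\<in>sphere y\<^sub>0 r \<inter> f ` D. R y \<partial>hyper_measure)"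
          using elim r assms(15) by simp
        finally show "1 \<le> (\<integral>\<^sup>+y\<in>sphere y\<^sub>0 r \<inter> f ` D. R y \<partial>hyper_measure)" .
      qed
    qed
    then obtain Z where Z: "Z \<in> null_sets lborel"
      and good: "\<And>r. r \<notin> Z \<Longrightarrow> \<epsilon> < r \<and> ereal r < r\<^sub>0 \<longrightarrow> 1 \<le> (\<integral>\<^sup>+y\<in>sphere y\<^sub>0 r \<inter> f ` D. R y \<partial>hyper_measure)"
      by (rule AE_lebesgue_null_set_real) (rule that)
    \<comment> \<open>Only radii in the prescribed range belong to surfaces of the family; for them
      the slices have positive area.\<close>
    define W where "W = {r \<in> Z. \<epsilon> < r \<and> ereal r < r\<^sub>0}"
    define \<Gamma>\<^sub>0 where "\<Gamma>\<^sub>0 = {sphere y\<^sub>0 r \<inter> f ` D | r. r \<in> W}"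
    have "modulus p \<Gamma>\<^sub>0 = 0" unfolding \<Gamma>\<^sub>0_def
    proof (rule modulus_sphere_family_null[OF Z p0 card fD])
      fix r assume "r \<in> W"
      then have "r \<in> Z" "0 < r" "ereal r < (SUP y \<in> f ` D. ereal (dist y y\<^sub>0))"
        using assms(12,15) by (auto simp: W_def)
      then show "r \<in> Z \<and> hausdorff_outer (CARD('n) - 1) (sphere y\<^sub>0 r \<inter> f ` D) \<noteq> 0"
        using image_slice_hausdorff_nonnull[OF card assms(3,4,7) fin assms(11)] by blast
    qed
    moreover have "\<Gamma>\<^sub>0 \<subseteq> image_surfaces D f y\<^sub>0 \<epsilon> r\<^sub>0"
      unfolding \<Gamma>\<^sub>0_def W_def image_surfaces_def by blast
    moreover have "1 \<le> (\<integral>\<^sup>+y\<in>S. R y \<partial>hyper_measure)" if S: "S \<in> image_surfaces D f y\<^sub>0 \<epsilon> r\<^sub>0 - \<Gamma>\<^sub>0" for S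
    proof -
      obtain r where r: "S = sphere y\<^sub>0 r \<inter> f ` D" "\<epsilon> < r" "ereal r < r\<^sub>0"
        using S unfolding image_surfaces_def by blast
      have "r \<notin> Z"
      proof
        assume "r \<in> Z"
        then have "S \<in> \<Gamma>\<^sub>0" unfolding \<Gamma>\<^sub>0_def W_def using r by blast
        then show False using S by blast
      qed
      then show ?thesis using good r by blast
    qed
    \<comment> \<open>Admissibility integrates the power n - 1 of the density over surfaces, so the
      root of \<open>R\<close> is taken; its p-th power is then the q-th power of
      \<open>R\<close>.\<close>
    moreover define \<rho>' where "\<rho>' y = enn_powr (R y) (1 / real k)" for y
    have "\<rho>' y ^ (CARD('n) - 1) = R y" for y
      unfolding \<rho>'_def k(3) by (rule enn_powr_inverse_power[OF k(1)])
    moreover have "\<rho>' \<in> borel_measurable lebesgue"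
      unfolding \<rho>'_def using R by (intro measurable_completion) simp
    ultimately have "\<rho>' \<in> ext_adm p (image_surfaces D f y\<^sub>0 \<epsilon> r\<^sub>0)"
      unfolding ext_adm_def almost_all_surfaces_def by auto
    then have "?I \<le> (\<integral>\<^sup>+y\<in>f ` D \<inter> annulus y\<^sub>0 \<epsilon> r\<^sub>0.
         (enn_powr (\<rho>' y) p / enn_powr (Q_dilatation D f \<alpha> y) (q - 1)) \<partial>lebesgue)"
      by (rule INF_lower)
    also have "\<dots> \<le> (\<integral>\<^sup>+y. enn_powr (\<rho>' y) p / enn_powr (Q_dilatation D f \<alpha> y) (q - 1) \<partial>lebesgue)"
      by (intro nn_integral_mono) (auto simp: indicator_def)
    also have "\<dots> = (\<integral>\<^sup>+y. enn_powr (R y) q / enn_powr (Q_dilatation D f \<alpha> y) (q - 1) \<partial>lebesgue)"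
      by (simp add: \<rho>'_def enn_powr_powr q_def)
    finally show ?thesis using vol by (rule order_trans)
  qed
  have "?I \<le> (\<integral>\<^sup>+x. enn_powr (\<rho> x) q \<partial>lebesgue)"
    if \<rho>: "\<rho> \<in> borel_measurable borel"
      "\<forall>\<sigma>\<in>preimage_surfaces D f y\<^sub>0 \<epsilon> r\<^sub>0. 1 \<le> (\<integral>\<^sup>+x\<in>\<sigma>. \<rho> x \<partial>hyper_measure)" for \<rho>
  proof (cases "(\<integral>\<^sup>+x. enn_powr (\<rho> x) q \<partial>lebesgue)")
    case (real L)
    \<comment> \<open>The density depends on \<eta>, but the infimum \<open>?I\<close> does not, so
      \<eta> can tend to 0 in the bound.\<close>
    have lim: "((\<lambda>\<eta>. ennreal ((1 + \<eta>) powr (q + 1) * L)) \<longlongrightarrow> ennreal ((1 + 0) powr (q + 1) * L)) (at_right 0)"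
      by (intro tendsto_intros) auto
    have "?I \<le> ennreal ((1 + 0) powr (q + 1) * L)"
    proof (rule tendsto_lowerbound[OF lim])
      show "\<forall>\<^sub>F \<eta> in at_right 0. ?I \<le> ennreal ((1 + \<eta>) powr (q + 1) * L)"
        using eventually_at_right_less[of 0]
      proof eventually_elim
        case (elim \<eta>)
        then show ?case using main[OF elim \<rho>] real by (simp add: ennreal_mult)
      qed
    qed simp
    then show ?thesis using real by simp
  qed simp
  then have "?I \<le> modulus_tilde q (preimage_surfaces D f y\<^sub>0 \<epsilon> r\<^sub>0)"
    unfolding modulus_tilde_def by (intro INF_greatest) blast
  \<comment> \<open>A nonempty domain has a nonempty fibre, so the multiplicity is at least
    1.\<close>
  moreover have "1 / enn_powr (multiplicity_on D f) q * ?I \<le> 1 * ?I"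
  proof (intro mult_right_mono)
    have "1 \<le> enn_powr (multiplicity_on D f) q"
      using one_le_multiplicity[OF assms(5)] q by (intro one_le_enn_powr) auto
    then show "1 / enn_powr (multiplicity_on D f) q \<le> 1"
      by (intro divide_le_posI_ennreal) (auto intro: less_le_trans[OF zero_less_one])
  qed simp
  ultimately show ?thesis unfolding q1 by simp
qed

end
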